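(* There is a universal constant $C>0$ such that the following holds for every $k\ge1$ and every $\pi\in\Pi_k$. Let $\mathcal A^*\in\mathrm{OA}(\pi)$ denote the canonical algorithm for $\pi$. Then $$\mathbb E[T_{\mathcal A^*}]=\beta(\pi),$$ and $$\mathbb P\left(|T_{\mathcal A^*}-\beta(\pi)|>y\,\beta(\pi)^{3/4}\right)\le C\,y^{-2}\qquad\text{for all } y\ge1.$$ Conversely, for any $\mathcal A\in\mathrm{OA}(\pi)$ and any $\delta\in(0,1)$, $$\mathbb P\left(T_{\mathcal A}\le(1-\delta)\beta(\pi)\right)\le 1-\delta.$$
   Context: $[k]=\{1,\dots,k\}$; $\Pi_k$ is the set of permutations of $[k]$, with $\Pi_0=\{\emptyset\}$. Let $X_1,X_2,\dots$ be i.i.d. uniform on $[0,1]$ (the stream); $\mathbb P$ is its law. For $\pi\in\Pi_k$, $\mathrm{OA}(\pi)$ is the set of online embedding algorithms for $\pi$: sequences $\mathcal A=(\tau_1,\dots,\tau_k)$ of stopping times $1\le\tau_1<\dots<\tau_k$ with respect to the natural filtration $\sigma(X_1,\dots,X_t)$ such that almost surely $(X_{\tau_1},\dots,X_{\tau_k})$ is order-isomorphic to $\pi$, i.e. $\pi(i)<\pi(j)\Leftrightarrow X_{\tau_i}<X_{\tau_j}$. Write $T_{\mathcal A}:=\tau_k$. Define $\beta(\pi):=\inf_{\mathcal A\in\mathrm{OA}(\pi)}\mathbb E[T_{\mathcal A}]$ and $\beta(\emptyset):=0$. $L(\pi)\in\Pi_{\pi(1)-1}$ and $R(\pi)\in\Pi_{k-\pi(1)}$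 are the permutations order-isomorphic to $(\pi(j):\pi(j)<\pi(1))$ and $(\pi(j):\pi(j)>\pi(1))$. For non-empty $\pi$, let $(a_*(\pi),b_*(\pi))$ be a minimizer over $0\le a<b\le1$ of $$\frac{1}{b-a}\left(1+\int_a^b\frac{\beta(L(\pi))}{x}+\frac{\beta(R(\pi))}{1-x}\,dx\right),$$ terms from empty subpermutations being omitted. Canonical algorithm for $\pi\in\Pi_k$. Insert the keys $\pi(1),\dots,\pi(k)$ in order into a binary search tree $\mathcal T_\pi$, labelling each node by its insertion time $1,\dots,k$. For a node $i$, let $\pi^{(i)}$ be the permutation order-isomorphic to the sequence of keys $\pi(j)$, $j$ in the subtree consisting of $i$ and all its descendants, taken in increasing order of $j$. Each node $i$ gets an interval $(\ell_i,u_i)$; the root has $(\ell_1,u_1)=(0,1)$. For $i=1,\dots,k$ in order: let $I_i=(\ell_i+(u_i-\ell_i)a_*(\pi^{(i)}),\ \ell_i+(u_i-\ell_i)b_*(\pi^{(i)}))$; let $\tau_i$ be the first $t>\tau_{i-1}$ (with $\tau_0=0$) such that $X_t\in I_i$; set $y_i=X_{\tau_i}$; give the left child of $i$ (if any) the interval $(\ell_i,y_i)$ and the right child (if any) the interval $(y_i,u_i)$. The canonical algorithm is $(\tau_1,\dots,\tau_k)$. *)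

theory Defs
  imports
    "HOL-Probability.Probability"
    "HOL-Combinatorics.Multiset_Permutations"
    "HOL-Library.Tree"
    "HOL-Library.Extended_Nat"
begin

section \<open>Permutations\<close>

text \<open>A permutation of \<open>{1..k}\<close> is the list of its values; \<open>\<pi>(i)\<close> is the 1-based
  entry \<open>entry \<pi> i\<close>.\<close>

definition Perms :: "nat \<Rightarrow> nat list set" where
  "Perms k = permutations_of_set {1..k}"

definition entry :: "nat list \<Rightarrow> nat \<Rightarrow> nat" where
  "entry \<pi> i = \<pi> ! (i - 1)"

text \<open>The permutation order-isomorphic to a list of distinct numbers: every element is replaced
  by its rank.\<close>

definition standardize :: "nat list \<Rightarrow> nat list" where
  "standardize xs = map (\<lambda>x. card {y \<in> set xs. y \<le> x}) xs"

definition left_perm :: "nat list \<Rightarrow> nat list" where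
  "left_perm \<pi> = standardize (filter (\<lambda>x. x < entry \<pi> 1) \<pi>)"

definition right_perm :: "nat list \<Rightarrow> nat list" where
  "right_perm \<pi> = standardize (filter (\<lambda>x. x > entry \<pi> 1) \<pi>)"

section \<open>The stream and online embedding algorithms\<close>

definition stream_law :: "real stream measure" where
  "stream_law = stream_space (uniform_measure lborel {0..1})"

text \<open>The stream is indexed by \<open>t \<ge> 1\<close>; \<open>X 0\<close> is never used.\<close>

definition X :: "nat \<Rightarrow> real stream \<Rightarrow> real" where
  "X t \<omega> = \<omega> !! (t - 1)"

text \<open>The natural filtration, indexed by \<open>enat\<close> because a stopping time may be infinite on a
  null set (such as the event that an interval is never hit).\<close>

definition nat_filtration :: "enat \<Rightarrow> real stream measure" where
  "nat_filtration t = sigma (space stream_law)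
     {X s -` B \<inter> space stream_law | s B. 1 \<le> s \<and> enat s \<le> t \<and> B \<in> sets borel}"

text \<open>An algorithm for \<open>\<pi> \<in> \<Pi>\<^sub>k\<close> is a family \<open>\<tau>\<close> of which only \<open>\<tau> 1, \<dots>, \<tau> k\<close> matter.
  Finiteness and strict monotonicity are required almost surely.\<close>

definition OA :: "nat list \<Rightarrow> (nat \<Rightarrow> real stream \<Rightarrow> enat) set" where
  "OA \<pi> = {\<tau>.
     (\<forall>i\<in>{1..length \<pi>}. stopping_time nat_filtration (\<tau> i)) \<and>
     (AE \<omega> in stream_law.
        (\<forall>i\<in>{1..length \<pi>}. 1 \<le> \<tau> i \<omega> \<and> \<tau> i \<omega> < \<infinity>) \<and>
        (\<forall>i\<in>{1..length \<pi>}. \<forall>j\<in>{1..length \<pi>}. i < j \<longrightarrow> \<tau> i \<omega> < \<tau> j \<omega>) \<and>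
        (\<forall>i\<in>{1..length \<pi>}. \<forall>j\<in>{1..length \<pi>}.
           entry \<pi> i < entry \<pi> j \<longleftrightarrow> X (the_enat (\<tau> i \<omega>)) \<omega> < X (the_enat (\<tau> j \<omega>)) \<omega>))}"

definition final_time :: "nat list \<Rightarrow> (nat \<Rightarrow> real stream \<Rightarrow> enat) \<Rightarrow> real stream \<Rightarrow> enat" where
  "final_time \<pi> \<tau> = \<tau> (length \<pi>)"

definition expected_time :: "nat list \<Rightarrow> (nat \<Rightarrow> real stream \<Rightarrow> enat) \<Rightarrow> ennreal" where
  "expected_time \<pi> \<tau> = (\<integral>\<^sup>+\<omega>. ennreal_of_enat (final_time \<pi> \<tau> \<omega>) \<partial>stream_law)"

definition beta :: "nat list \<Rightarrow> real" where
  "beta \<pi> = (if \<pi> = [] then 0 else enn2real (INF \<tau>\<in>OA \<pi>. expected_time \<pi> \<tau>))"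

section \<open>The minimization problem\<close>

text \<open>The integral is taken in \<open>ennreal\<close>, so a divergent integral really counts as \<open>\<infinity>\<close>.
  The terms of empty subpermutations vanish since \<open>beta [] = 0\<close>.\<close>

definition objective :: "nat list \<Rightarrow> real \<Rightarrow> real \<Rightarrow> ennreal" where
  "objective \<pi> a b =
     (1 + (\<integral>\<^sup>+x\<in>{a..b}. ennreal (beta (left_perm \<pi>) / x + beta (right_perm \<pi>) / (1 - x)) \<partial>lborel))
       / ennreal (b - a)"

definition is_minimizer :: "nat list \<Rightarrow> real \<Rightarrow> real \<Rightarrow> bool" where
  "is_minimizer \<pi> a b \<longleftrightarrow> 0 \<le> a \<and> a < b \<and> b \<le> 1 \<and>
     (\<forall>a' b'. 0 \<le> a' \<and> a' < b' \<and> b' \<le> 1 \<longrightarrow> objective \<pi> a b \<le> objective \<pi> a' b')"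

text \<open>A choice \<open>(a, b)\<close> of a minimizer \<open>(a\<^sub>*(\<sigma>), b\<^sub>*(\<sigma>))\<close> for every non-empty permutation \<open>\<sigma>\<close>.\<close>

definition minimizer_choice :: "(nat list \<Rightarrow> real) \<Rightarrow> (nat list \<Rightarrow> real) \<Rightarrow> bool" where
  "minimizer_choice a b \<longleftrightarrow> (\<forall>k\<ge>1. \<forall>\<sigma>\<in>Perms k. is_minimizer \<sigma> (a \<sigma>) (b \<sigma>))"

section \<open>The canonical algorithm\<close>

text \<open>The binary search tree stores the insertion times; node \<open>i\<close> has key \<open>entry \<pi> i\<close>.\<close>

fun bst_insert :: "nat list \<Rightarrow> nat \<Rightarrow> nat tree \<Rightarrow> nat tree" where
  "bst_insert \<pi> i Leaf = Node Leaf i Leaf"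
| "bst_insert \<pi> i (Node l j r) =
     (if entry \<pi> i < entry \<pi> j then Node (bst_insert \<pi> i l) j r
      else Node l j (bst_insert \<pi> i r))"

definition search_tree :: "nat list \<Rightarrow> nat tree" where
  "search_tree \<pi> = fold (bst_insert \<pi>) [1..<length \<pi> + 1] Leaf"

fun subtree_at :: "nat \<Rightarrow> nat tree \<Rightarrow> nat tree" where
  "subtree_at i Leaf = Leaf"
| "subtree_at i (Node l j r) =
     (if i = j then Node l j r
      else if i \<in> set_tree l then subtree_at i l else subtree_at i r)"

definition subtree_perm :: "nat list \<Rightarrow> nat \<Rightarrow> nat list" where
  "subtree_perm \<pi> i =
     standardize (map (entry \<pi>) (sorted_list_of_set (set_tree (subtree_at i (search_tree \<pi>)))))"

definition first_hit :: "enat \<Rightarrow> real set \<Rightarrow> real stream \<Rightarrow> enat" where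
  "first_hit s I \<omega> = Inf {enat t | t. s < enat t \<and> X t \<omega> \<in> I}"

text \<open>Give the root of the tree (if any) an interval.\<close>

fun set_root :: "nat tree \<Rightarrow> real \<times> real \<Rightarrow> (nat \<Rightarrow> real \<times> real) \<Rightarrow> (nat \<Rightarrow> real \<times> real)" where
  "set_root Leaf lu iv = iv"
| "set_root (Node l j r) lu iv = iv(j := lu)"

text \<open>State after handling nodes \<open>1, \<dots>, i\<close>: the time \<open>\<tau>\<^sub>i\<close> and the intervals \<open>(\<ell>\<^sub>j, u\<^sub>j)\<close> assigned
  so far. The initial value \<open>(0, 1)\<close> is meant for the root, node 1; every other node has been given
  its interval by its parent before it is reached. If \<open>\<tau>\<^sub>i = \<infinity>\<close>, all later times are \<open>\<infinity>\<close> as well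
  and the value of \<open>y\<close> is irrelevant.\<close>

primrec canonical_state ::
  "(nat list \<Rightarrow> real) \<Rightarrow> (nat list \<Rightarrow> real) \<Rightarrow> nat list \<Rightarrow> real stream \<Rightarrow> nat
     \<Rightarrow> enat \<times> (nat \<Rightarrow> real \<times> real)" where
  "canonical_state a b \<pi> \<omega> 0 = (0, \<lambda>_. (0, 1))"
| "canonical_state a b \<pi> \<omega> (Suc n) =
     (let i = Suc n;
          (\<tau>_prev, iv) = canonical_state a b \<pi> \<omega> n;
          (l, u) = iv i;
          \<sigma> = subtree_perm \<pi> i;
          \<tau> = first_hit \<tau>_prev {l + (u - l) * a \<sigma> <..< l + (u - l) * b \<sigma>} \<omega>;
          y = X (the_enat \<tau>) \<omega>;
          iv' = (case subtree_at i (search_tree \<pi>) of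
                   Leaf \<Rightarrow> iv
                 | Node lt _ rt \<Rightarrow> set_root lt (l, y) (set_root rt (y, u) iv))
      in (\<tau>, iv'))"

definition canonical ::
  "(nat list \<Rightarrow> real) \<Rightarrow> (nat list \<Rightarrow> real) \<Rightarrow> nat list \<Rightarrow> nat \<Rightarrow> real stream \<Rightarrow> enat" where
  "canonical a b \<pi> i \<omega> = fst (canonical_state a b \<pi> \<omega> i)"

end

theory Submission
  imports Defs
begin

text \<open>
  Everything is read off from one number attached to a partially completed embedding. After the first
  \<open>n\<close> keys have been placed, the remaining keys form disjoint subtrees of the search tree, and the keys
  of each subtree have to be found inside one open interval \<open>(l, u)\<close>. Let \<open>V\<close> be the sum of
  \<open>val \<sigma> / (u - l)\<close> over these subtrees, \<open>\<sigma>\<close> being the permutation of the subtree. Here \<open>val \<sigma>\<close> is defined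
  recursively from the values \<open>A\<close>, \<open>B\<close> of the two child permutations, as the level \<open>c\<close> at which
  \<open>\<integral>\<^sub>0\<^sup>1 max 0 (c - A/x - B/(1 - x)) dx = 1\<close>. Accepting \<open>x\<close> as the next key, whose interval is \<open>(l, u)\<close>, lowers
  \<open>V\<close> by exactly \<open>c/(u - l) - A/(x - l) - B/(u - x)\<close>. The choice of \<open>c\<close> says that the positive part of
  this amount has integral 1, so one observation lowers \<open>V\<close> by at most 1 on average whatever the
  algorithm does, and by exactly 1 if it accepts precisely where the amount is positive.

  Consider an arbitrary algorithm. \<open>V\<close> starts at \<open>val \<pi>\<close> and ends at 0, so almost surely
  the rewards (the positive parts) offered by the observations of the rounds \<open>n < T\<close> add up to at
  least \<open>val \<pi>\<close> (\<open>val_le_round_payoffs\<close>). Since the state before round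
  \<open>n\<close> does not depend on the observation of that round, this observation may be replaced by a fresh one,
  and the expected reward of round \<open>n\<close> is at most the probability of \<open>n < T\<close>
  (\<open>expected_round_payoff\<close>). Summing over all rounds gives the lower bound on the expectation of \<open>T\<close>;
  summing over the first \<open>N\<close> rounds gives \<open>val \<pi> * P(T \<le> N) \<le> N\<close>, which implies the last claim.

  In the one-step problem, write \<open>f x = A/x + B/(1 - x)\<close>. The set \<open>{f < c}\<close> is an interval \<open>(a, b)\<close>, and
  equating the two values of \<open>f\<close> at its end points gives \<open>A = c a b\<close> and \<open>B = c (1 - a) (1 - b)\<close>, hence
  \<open>c - f x = c (x - a) (b - x) / (x (1 - x))\<close>. Integrating \<open>f - c\<close> over any other window shows that
  \<open>(a, b)\<close> is the only minimizer of the objective function and that the minimum is \<open>c\<close>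
  (\<open>window_cost_minimal\<close>).

  For the moments of the canonical algorithm, let \<open>W\<close> be the analogue of \<open>V\<close> with summands
  \<open>2 \<surd>2 (val \<sigma>)\<^bsup>3/2\<^esup> / (u - l)\<^sup>2\<close>. Looking at the first observation only, induction on a time horizon
  shows that the remaining time has mean at most \<open>V\<close> and second moment at most \<open>V\<^sup>2 + W\<close>
  (\<open>truncated_moments\<close>). The induction step for the second moment comes down to
  \<open>\<integral>\<^sub>a\<^sup>b (c - f)\<^sup>2 \<le> 2 \<surd>2 \<integral>\<^sub>a\<^sup>b (c\<^bsup>3/2\<^esup> - A\<^bsup>3/2\<^esup>/x\<^sup>2 - B\<^bsup>3/2\<^esup>/(1 - x)\<^sup>2) dx\<close>, and by the closed forms of \<open>A\<close>
  and \<open>B\<close> the right-hand side is \<open>2 \<surd>2 c\<^bsup>3/2\<^esup> (b - a) q\<close> with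
  \<open>q = 1 - \<surd>(a b) - \<surd>((1 - a) (1 - b))\<close>. The same \<open>q\<close> controls the left-hand side, as
  \<open>c - f \<le> 2 c q\<close> and \<open>q \<le> b - a\<close> (\<open>variance_budget\<close>). So the variance of \<open>T\<close> is at most
  \<open>2 \<surd>2 (val \<pi>)\<^bsup>3/2\<^esup>\<close>, and Chebyshev's inequality gives the concentration bound. Both halves together
  identify \<open>beta\<close> with \<open>val\<close>, so that minimizers for \<open>beta\<close> are the windows \<open>(a, b)\<close> above.
\<close>

section \<open>The optimal acceptance window\<close>

text \<open>\<open>A\<close> and \<open>B\<close> are the values of the two subproblems, \<open>c\<close> is the resulting value and \<open>(a, b)\<close> the window.
  The two equations are the conditions \<open>f a = f b = c\<close> for \<open>f x = A/x + B/(1 - x)\<close>, written so that they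
  also make sense for \<open>a = 0\<close> (no left subproblem) and \<open>b = 1\<close> (no right subproblem). In the integral,
  \<open>ennreal\<close> replaces the integrand by its positive part.\<close>

definition optimal_window :: "real \<Rightarrow> real \<Rightarrow> real \<Rightarrow> real \<Rightarrow> real \<Rightarrow> bool" where
  "optimal_window A B c a b \<longleftrightarrow> 0 \<le> a \<and> a < b \<and> b \<le> 1 \<and> 0 < c \<and>
     A = c * a * b \<and> B = c * (1 - a) * (1 - b) \<and>
     (\<integral>\<^sup>+x\<in>{0<..<1}. ennreal (c - A / x - B / (1 - x)) \<partial>lborel) = 1"

lemma excess_factor:
  fixes x :: real
  assumes "0 < x" "x < 1"
  shows "c - c * a * b / x - c * (1 - a) * (1 - b) / (1 - x) = c * ((x - a) * (b - x)) / (x * (1 - x))"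
  using assms by (simp add: field_simps)

lemma optimal_window_excess:
  assumes "optimal_window A B c a b" "0 < x" "x < 1"
  shows "c - A / x - B / (1 - x) = c * ((x - a) * (b - x)) / (x * (1 - x))"
  using assms excess_factor[of x c a b] by (simp add: optimal_window_def)

lemma excess_sign:
  assumes "optimal_window A B c a b" "0 < x" "x < 1"
  shows "0 < c - A / x - B / (1 - x) \<longleftrightarrow> a < x \<and> x < b"
    and "c - A / x - B / (1 - x) < 0 \<longleftrightarrow> x < a \<or> b < x"
proof -
  have "0 < c" "a < b" using assms by (auto simp: optimal_window_def)
  then show "0 < c - A / x - B / (1 - x) \<longleftrightarrow> a < x \<and> x < b"
    "c - A / x - B / (1 - x) < 0 \<longleftrightarrow> x < a \<or> b < x"
    unfolding optimal_window_excess[OF assms] using assms(2,3)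
    by (auto simp: zero_less_divide_iff divide_less_0_iff zero_less_mult_iff mult_less_0_iff)
qed

lemma optimal_window_nonneg:
  "optimal_window A B c a b \<Longrightarrow> 0 \<le> A \<and> 0 \<le> B"
  by (auto simp: optimal_window_def)

lemma quadratic_two_roots:
  fixes c :: real
  assumes "a \<noteq> b" and "- c * a\<^sup>2 + (c + A - B) * a - A = 0" and "- c * b\<^sup>2 + (c + A - B) * b - A = 0"
  shows "A = c * a * b" and "B = c * (1 - a) * (1 - b)"
proof -
  have "(b - a) * (c + A - B - c * (a + b)) = 0"
    using assms(2,3) by (simp add: algebra_simps power2_eq_square)
  then have s: "c + A - B = c * (a + b)" using assms(1) by auto
  show "A = c * a * b"
    using assms(2) unfolding s by (simp add: algebra_simps power2_eq_square)
  then show "B = c * (1 - a) * (1 - b)" using s by (simp add: algebra_simps)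
qed

text \<open>As a function of the level \<open>c\<close>, the integral of the positive part is nondecreasing and 1-Lipschitz;
  it vanishes at 0 and exceeds 1 for large \<open>c\<close>, hence takes the value 1. At this level, the excess
  multiplied by \<open>x (1 - x)\<close> is a concave quadratic that is positive somewhere in \<open>(0, 1)\<close> and at most 0
  at both ends, so it has one root on each side; these two roots are \<open>a\<close> and \<open>b\<close>, and comparing
  coefficients yields the closed forms of \<open>A\<close> and \<open>B\<close>.\<close>

lemma optimal_window_exists:
  assumes A: "0 \<le> A" and B: "0 \<le> (B::real)"
  shows "\<exists>c a b. optimal_window A B c a b"
proof -
  define F where "F c = (\<integral>\<^sup>+x\<in>{0<..<1}. ennreal (c - A / x - B / (1 - x)) \<partial>lborel)" for c :: real
  have F_mono: "F c \<le> F c'" if "c \<le> c'" for c c'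
    unfolding F_def using that by (intro nn_integral_mono) (auto simp: indicator_def intro!: ennreal_leI)
  have F_lip: "F c' \<le> F c + ennreal (c' - c)" if "c \<le> c'" for c c'
  proof -
    have "F c' \<le> (\<integral>\<^sup>+x. ennreal (c - A / x - B / (1 - x)) * indicator {0<..<1} x
        + ennreal (c' - c) * indicator {0<..<1} x \<partial>lborel)"
      unfolding F_def
    proof (intro nn_integral_mono)
      fix x :: real
      have "ennreal (c' - A / x - B / (1 - x)) = ennreal ((c - A / x - B / (1 - x)) + (c' - c))"
        by (rule arg_cong[where f=ennreal]) simp
      also have "\<dots> \<le> ennreal (c - A / x - B / (1 - x)) + ennreal (c' - c)"
      proof (cases "0 \<le> c - A / x - B / (1 - x)")
        case False
        then show ?thesis by (auto simp: ennreal_neg intro!: ennreal_leI)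
      next
        case True
        show ?thesis by (subst ennreal_plus[OF True]) (use that in auto)
      qed
      finally show "ennreal (c' - A / x - B / (1 - x)) * indicator {0<..<1} x
        \<le> ennreal (c - A / x - B / (1 - x)) * indicator {0<..<1} x + ennreal (c' - c) * indicator {0<..<1} x"
        by (auto simp: indicator_def)
    qed
    also have "\<dots> = F c + ennreal (c' - c)"
      unfolding F_def by (subst nn_integral_add) (auto simp: nn_integral_cmult_indicator)
    finally show ?thesis .
  qed
  have F0: "F 0 = 0"
  proof -
    have "ennreal (0 - A / x - B / (1 - x)) * indicator {0<..<1} x = 0" for x :: real
    proof -
      have "0 \<le> A / x + B / (1 - x)" if "0 < x" "x < 1" using that A B by simp
      then show ?thesis by (auto simp: indicator_def ennreal_neg)
    qed
    then show ?thesis unfolding F_def by (simp only: nn_integral_const mult_zero_left)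
  qed
  have F_fin: "F c < \<infinity>" if "0 \<le> c" for c
    using F_lip[OF that] F0 by (simp add: le_less_trans[OF _ ennreal_less_top])
  \<comment> \<open>on \<open>[1/4, 3/4]\<close> the cost \<open>A/x + B/(1 - x)\<close> is at most \<open>4 (A + B)\<close>, so the excess at level \<open>M\<close> is at least 2 there\<close>
  define M where "M = 4 * (A + B) + 2"
  have M0: "0 \<le> M" using A B by (simp add: M_def)
  have FM: "1 \<le> F M"
  proof -
    have "1 = (\<integral>\<^sup>+x. 2 * indicator {1/4..3/4::real} x \<partial>lborel)"
    proof -
      have "1 = ennreal (2 * (1 / 2))" by simp
      also have "\<dots> = 2 * emeasure lborel {1/4..3/4::real}"
        by (subst ennreal_mult) auto
      also have "\<dots> = (\<integral>\<^sup>+x. 2 * indicator {1/4..3/4::real} x \<partial>lborel)"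
        by (rule nn_integral_cmult_indicator[symmetric]) simp
      finally show ?thesis .
    qed
    also have "\<dots> \<le> F M"
      unfolding F_def
    proof (intro nn_integral_mono)
      fix x :: real
      show "2 * indicator {1/4..3/4} x \<le> ennreal (M - A / x - B / (1 - x)) * indicator {0<..<1} x"
      proof (cases "x \<in> {1/4..3/4}")
        case True
        then have "A / x \<le> 4 * A" "B / (1 - x) \<le> 4 * B"
          using A B mult_left_mono[of 1 "4 * x" A] mult_left_mono[of 1 "4 * (1 - x)" B]
          by (auto simp: divide_le_eq algebra_simps)
        then have "2 \<le> M - A / x - B / (1 - x)" by (simp add: M_def)
        then have "2 \<le> ennreal (M - A / x - B / (1 - x))"
          by (metis ennreal_leI ennreal_numeral zero_le_numeral)
        then show ?thesis using True by (auto simp: indicator_def)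
      qed simp
    qed
    finally show ?thesis .
  qed
  define G where "G c = enn2real (F c)" for c
  have FG: "F c = ennreal (G c)" if "0 \<le> c" for c using F_fin[OF that] by (simp add: G_def)
  have G_lip: "G c \<le> G c' \<and> G c' \<le> G c + (c' - c)" if "0 \<le> c" "c \<le> c'" for c c'
  proof -
    have G0: "0 \<le> G c" "0 \<le> G c'" by (auto simp: G_def)
    have "ennreal (G c') \<le> ennreal (G c + (c' - c))"
      using F_lip[OF that(2)] FG[of c] FG[of c'] that G0 by (simp add: ennreal_plus)
    moreover have "ennreal (G c) \<le> ennreal (G c')"
      using F_mono[OF that(2)] FG[of c] FG[of c'] that by simp
    ultimately show ?thesis using G0 that by (simp add: ennreal_le_iff del: ennreal_plus)
  qed
  have "continuous_on {0..M} G"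
  proof (rule continuous_on_iff[THEN iffD2], intro ballI allI impI)
    fix x e :: real assume "x \<in> {0..M}" "0 < e"
    have "dist (G x') (G x) < e" if "x' \<in> {0..M}" "dist x' x < e" for x'
      using G_lip[of x x'] G_lip[of x' x] \<open>x \<in> {0..M}\<close> that
      by (cases "x \<le> x'") (auto simp: dist_real_def)
    then show "\<exists>d>0. \<forall>x'\<in>{0..M}. dist x' x < d \<longrightarrow> dist (G x') (G x) < e"
      using \<open>0 < e\<close> by blast
  qed
  moreover have "G 0 \<le> 1" using F0 by (simp add: G_def)
  moreover have "1 \<le> G M"
  proof -
    have "ennreal 1 \<le> ennreal (G M)" using FM FG[OF M0] by simp
    moreover have "0 \<le> G M" by (simp add: G_def)
    ultimately show ?thesis by (subst (asm) ennreal_le_iff)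
  qed
  ultimately obtain c where c: "0 \<le> c" "c \<le> M" "G c = 1"
    using IVT'[of G 0 1 M] M0 by auto
  then have Fc: "F c = 1" using FG by simp
  then have "c \<noteq> 0" using F0 by auto
  then have cpos: "0 < c" using c by simp
  have "\<exists>x0. 0 < x0 \<and> x0 < 1 \<and> 0 < c - A / x0 - B / (1 - x0)"
  proof (rule ccontr)
    assume "\<not> ?thesis"
    then have "c - A / x - B / (1 - x) \<le> 0" if "x \<in> {0<..<1}" for x
      using that not_less by auto
    then have "ennreal (c - A / x - B / (1 - x)) * indicator {0<..<1} x = 0" for x
      by (cases "x \<in> {0<..<1}") (simp_all add: ennreal_neg)
    then have "F c = 0" unfolding F_def by (simp only: nn_integral_const mult_zero_left)
    then show False using Fc by simp
  qed
  then obtain x0 where x0: "0 < x0" "x0 < 1" "0 < c - A / x0 - B / (1 - x0)" by blast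
  define q where "q x = - c * x\<^sup>2 + (c + A - B) * x - A" for x
  have "q x0 = x0 * (1 - x0) * (c - A / x0 - B / (1 - x0))"
    using x0(1,2) by (simp add: q_def field_simps power2_eq_square)
  then have q0: "0 < q x0" using x0 by simp
  have cont: "continuous_on S q" for S unfolding q_def by (intro continuous_intros)
  obtain a where a: "0 \<le> a" "a \<le> x0" "q a = 0"
    using IVT'[of q 0 0 x0] q0 x0 A cont by (auto simp: q_def)
  obtain b where b: "x0 \<le> b" "b \<le> 1" "q b = 0"
    using IVT2'[of q 1 0 x0] q0 x0 B cont by (auto simp: q_def)
  have "a \<noteq> x0" "b \<noteq> x0" using a(3) b(3) q0 by auto
  then have ab: "a < b" using a(2) b(1) by simp
  then have AB: "A = c * a * b" "B = c * (1 - a) * (1 - b)"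
    using quadratic_two_roots[of a b c A B] a(3) b(3) by (simp_all add: q_def)
  have "optimal_window A B c a b"
    unfolding optimal_window_def
    using a(1) b(2) ab cpos AB Fc[unfolded F_def] by blast
  then show ?thesis by blast
qed

definition window_cost :: "real \<Rightarrow> real \<Rightarrow> real \<Rightarrow> real \<Rightarrow> ennreal" where
  "window_cost A B a b =
     (1 + (\<integral>\<^sup>+x\<in>{a..b}. ennreal (A / x + B / (1 - x)) \<partial>lborel)) / ennreal (b - a)"

text \<open>The cost of an arbitrary window is \<open>c\<close> plus the integral of \<open>\<bar>f - c\<bar>\<close> over the symmetric difference
  with the optimal window, divided by the length: where \<open>f\<close> exceeds \<open>c\<close> it is a loss to accept, and
  elsewhere it is a loss to reject.\<close>

lemma cost_defect:
  assumes opt: "optimal_window A B c a b" and ab: "0 \<le> a'" "a' < b'" "b' \<le> 1"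
  shows "1 + (\<integral>\<^sup>+x\<in>{a'..b'}. ennreal (A / x + B / (1 - x)) \<partial>lborel) = ennreal c * ennreal (b' - a')
    + (\<integral>\<^sup>+x\<in>{a'..b'}. ennreal (A / x + B / (1 - x) - c) \<partial>lborel)
    + (\<integral>\<^sup>+x\<in>{0<..<1} - {a'..b'}. ennreal (c - A / x - B / (1 - x)) \<partial>lborel)"
proof -
  have c: "0 < c" using opt by (simp add: optimal_window_def)
  let ?d = "\<lambda>x. ennreal (c - A / x - B / (1 - x))"
  let ?E = "\<integral>\<^sup>+x\<in>{a'..b'}. ?d x \<partial>lborel"
  let ?R = "\<integral>\<^sup>+x\<in>{0<..<1} - {a'..b'}. ?d x \<partial>lborel"
  let ?K = "\<integral>\<^sup>+x\<in>{a'..b'}. ennreal (A / x + B / (1 - x)) \<partial>lborel"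
  let ?S = "\<integral>\<^sup>+x\<in>{a'..b'}. ennreal (A / x + B / (1 - x) - c) \<partial>lborel"
  have "(\<integral>\<^sup>+x\<in>{0<..<1}. ?d x \<partial>lborel) = 1" using opt unfolding optimal_window_def by blast
  then have "1 = (\<integral>\<^sup>+x\<in>{0<..<1}. ?d x \<partial>lborel)" ..
  also have "\<dots> = (\<integral>\<^sup>+x. ?d x * indicator {a'..b'} x + ?d x * indicator ({0<..<1} - {a'..b'}) x \<partial>lborel)"
  proof (rule nn_integral_cong_AE)
    have "AE x::real in lborel. x \<noteq> 0 \<and> x \<noteq> 1" by (simp add: AE_lborel_singleton)
    then show "AE x in lborel. ?d x * indicator {0<..<1} x =
        ?d x * indicator {a'..b'} x + ?d x * indicator ({0<..<1} - {a'..b'}) x"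
      by eventually_elim (use ab in \<open>auto simp: indicator_def\<close>)
  qed
  also have "\<dots> = (\<integral>\<^sup>+x\<in>{a'..b'}. ?d x \<partial>lborel) + (\<integral>\<^sup>+x\<in>{0<..<1} - {a'..b'}. ?d x \<partial>lborel)"
    by (rule nn_integral_add) auto
  finally have one: "1 = (\<integral>\<^sup>+x\<in>{a'..b'}. ?d x \<partial>lborel) + (\<integral>\<^sup>+x\<in>{0<..<1} - {a'..b'}. ?d x \<partial>lborel)" .
  have "(\<integral>\<^sup>+x\<in>{a'..b'}. ?d x \<partial>lborel) + (\<integral>\<^sup>+x\<in>{a'..b'}. ennreal (A / x + B / (1 - x)) \<partial>lborel) =
      (\<integral>\<^sup>+x. ?d x * indicator {a'..b'} x + ennreal (A / x + B / (1 - x)) * indicator {a'..b'} x \<partial>lborel)"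
    by (rule nn_integral_add[symmetric]) auto
  also have "\<dots> = (\<integral>\<^sup>+x. ennreal c * indicator {a'..b'} x + ennreal (A / x + B / (1 - x) - c) * indicator {a'..b'} x \<partial>lborel)"
  proof (intro nn_integral_cong)
    fix x :: real
    have "?d x + ennreal (A / x + B / (1 - x)) = ennreal c + ennreal (A / x + B / (1 - x) - c)"
      if "x \<in> {a'..b'}"
    proof -
      have "0 \<le> A / x + B / (1 - x)"
        using optimal_window_nonneg[OF opt] ab that by (auto intro!: add_nonneg_nonneg)
      then show ?thesis
      proof (cases "A / x + B / (1 - x) \<le> c")
        case True
        then have "?d x + ennreal (A / x + B / (1 - x)) = ennreal c"
          using \<open>0 \<le> A / x + B / (1 - x)\<close> by (subst ennreal_plus[symmetric]) auto
        then show ?thesis using True by (simp only: ennreal_neg diff_le_0_iff_le add_0_right)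
      next
        case False
        then have "ennreal c + ennreal (A / x + B / (1 - x) - c) = ennreal (A / x + B / (1 - x))"
          using c by (subst ennreal_plus[symmetric]) auto
        moreover have "?d x = 0" using False by (intro ennreal_neg) simp
        ultimately show ?thesis by simp
      qed
    qed
    then show "?d x * indicator {a'..b'} x + ennreal (A / x + B / (1 - x)) * indicator {a'..b'} x =
        ennreal c * indicator {a'..b'} x + ennreal (A / x + B / (1 - x) - c) * indicator {a'..b'} x"
      by (auto simp: indicator_def)
  qed
  also have "\<dots> = ennreal c * ennreal (b' - a') + (\<integral>\<^sup>+x\<in>{a'..b'}. ennreal (A / x + B / (1 - x) - c) \<partial>lborel)"
    using ab by (subst nn_integral_add) (auto simp: nn_integral_cmult_indicator)
  finally have two: "?E + ?K = ennreal c * ennreal (b' - a') + ?S" .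
  have "1 + ?K = (?E + ?R) + ?K" by (rule arg_cong2[OF one refl])
  also have "\<dots> = (?E + ?K) + ?R" by (simp only: ac_simps)
  finally show ?thesis unfolding two .
qed

text \<open>Used to compare end points of two intervals whose symmetric difference is a null set.\<close>

lemma no_interval:
  fixes p q :: real
  assumes "AE x in lborel. \<not> (p < x \<and> x < q)"
  shows "q \<le> p"
proof (rule ccontr)
  assume "\<not> q \<le> p"
  have "emeasure lborel {p<..<q} = 0"
    using assms by (intro AE_iff_measurable[THEN iffD1, rotated 2]) auto
  then show False using \<open>\<not> q \<le> p\<close> by simp
qed

lemma window_cost_minimal:
  assumes opt: "optimal_window A B c a b"
  shows "window_cost A B a b = ennreal c"
    and "0 \<le> a' \<Longrightarrow> a' < b' \<Longrightarrow> b' \<le> 1 \<Longrightarrow> ennreal c \<le> window_cost A B a' b'"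
    and "0 \<le> a' \<Longrightarrow> a' < b' \<Longrightarrow> b' \<le> 1 \<Longrightarrow> window_cost A B a' b' \<le> ennreal c \<Longrightarrow> a' = a \<and> b' = b"
proof -
  define S where "S a' b' = (\<integral>\<^sup>+x\<in>{a'..b'}. ennreal (A / x + B / (1 - x) - c) \<partial>lborel)" for a' b'
  define R where "R a' b' = (\<integral>\<^sup>+x\<in>{0<..<1} - {a'..b'}. ennreal (c - A / x - B / (1 - x)) \<partial>lborel)" for a' b'
  have ab: "0 \<le> a" "a < b" "b \<le> 1" "0 < c" using opt by (auto simp: optimal_window_def)
  have cost: "window_cost A B a' b' = (ennreal c * ennreal (b' - a') + (S a' b' + R a' b')) / ennreal (b' - a')"
    if "0 \<le> a'" "a' < b'" "b' \<le> 1" for a' b'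
    unfolding window_cost_def cost_defect[OF opt that] S_def R_def by (simp add: add.assoc)
  have cancel: "ennreal c * ennreal w / ennreal w = ennreal c" if "0 < w" for w
    using that ab by (simp add: ennreal_mult[symmetric] divide_ennreal)
  show "window_cost A B a b = ennreal c"
  proof -
    have AE: "AE x::real in lborel. x \<noteq> 0 \<and> x \<noteq> 1" by (simp add: AE_lborel_singleton)
    have "S a b = nn_integral lborel (\<lambda>x::real. 0)"
      unfolding S_def
    proof (rule nn_integral_cong_AE)
      show "AE x in lborel. ennreal (A / x + B / (1 - x) - c) * indicator {a..b} x = 0"
        using AE
      proof eventually_elim
        case (elim x)
        show ?case
          using excess_sign(2)[OF opt, of x] ab elim
          by (cases "x \<in> {a..b}") (auto simp: ennreal_neg not_less)
      qed
    qed
    moreover have "R a b = nn_integral lborel (\<lambda>x::real. 0)"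
      unfolding R_def
    proof (rule nn_integral_cong)
      fix x :: real
      show "ennreal (c - A / x - B / (1 - x)) * indicator ({0<..<1} - {a..b}) x = 0"
        using excess_sign(1)[OF opt, of x] by (auto simp: ennreal_neg not_less indicator_def)
    qed
    ultimately show ?thesis using cost[of a b] ab cancel[of "b - a"] by simp
  qed
  assume ab': "0 \<le> a'" "a' < b'" "b' \<le> 1"
  have "ennreal c = ennreal c * ennreal (b' - a') / ennreal (b' - a')" using cancel ab' by simp
  also have "\<dots> \<le> window_cost A B a' b'"
    unfolding cost[OF ab'] by (intro divide_right_mono_ennreal) simp
  finally show "ennreal c \<le> window_cost A B a' b'" .
  assume le: "window_cost A B a' b' \<le> ennreal c"
  have "(ennreal c * ennreal (b' - a') + (S a' b' + R a' b')) / ennreal (b' - a') * ennreal (b' - a')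
      \<le> ennreal c * ennreal (b' - a')"
    using le unfolding cost[OF ab'] by (rule mult_right_mono) simp
  then have "ennreal c * ennreal (b' - a') + (S a' b' + R a' b') \<le> ennreal c * ennreal (b' - a')"
    using ab' by (simp add: ennreal_divide_times ennreal_times_divide ennreal_divide_self mult_divide_eq_ennreal)
  then have SR: "S a' b' = 0" "R a' b' = 0"
    using ab' ab by (auto simp: ennreal_mult[symmetric] ennreal_add_left_cancel_le[of _ _ 0, simplified])
  have AES: "AE x in lborel. ennreal (A / x + B / (1 - x) - c) * indicator {a'..b'} x = 0"
    using SR(1) unfolding S_def by (subst (asm) nn_integral_0_iff_AE) auto
  have AER: "AE x in lborel. ennreal (c - A / x - B / (1 - x)) * indicator ({0<..<1} - {a'..b'}) x = 0"
    using SR(2) unfolding R_def by (subst (asm) nn_integral_0_iff_AE) auto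
  have S1: "AE x in lborel. \<not> (0 < x \<and> x < 1 \<and> a' \<le> x \<and> x \<le> b' \<and> (x < a \<or> b < x))"
    using AES
  proof eventually_elim
    case (elim x)
    then show ?case using excess_sign(2)[OF opt, of x] by (auto simp: indicator_def ennreal_eq_0_iff)
  qed
  have R1: "AE x in lborel. \<not> (0 < x \<and> x < 1 \<and> a < x \<and> x < b \<and> (x < a' \<or> b' < x))"
    using AER
  proof eventually_elim
    case (elim x)
    then show ?case using excess_sign(1)[OF opt, of x] by (auto simp: indicator_def ennreal_eq_0_iff)
  qed
  have "min a b' \<le> a'"
    by (rule no_interval, use S1 in eventually_elim) (use ab ab' in auto)
  moreover have "b' \<le> max b a'"
    by (rule no_interval, use S1 in eventually_elim) (use ab ab' in auto)
  moreover have "min a' b \<le> a"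
    by (rule no_interval, use R1 in eventually_elim) (use ab ab' in auto)
  moreover have "b \<le> max b' a"
    by (rule no_interval, use R1 in eventually_elim) (use ab ab' in auto)
  ultimately show "a' = a \<and> b' = b" using ab ab' by auto
qed

text \<open>The squared Hellinger distance between the Bernoulli distributions with parameters \<open>a\<close> and \<open>b\<close>. It
  measures at once how far \<open>c - f\<close> rises above 0 and by how much the power \<open>3/2\<close> of the value exceeds
  the average of the corresponding sum over the children.\<close>

definition gap :: "real \<Rightarrow> real \<Rightarrow> real" where
  "gap a b = 1 - sqrt (a * b) - sqrt ((1 - a) * (1 - b))"

lemma gap_bounds:
  assumes "0 \<le> a" "a \<le> b" "b \<le> 1"
  shows "0 \<le> gap a b" and "gap a b \<le> b - a"
proof -
  have "sqrt (a * b) \<le> (a + b) / 2" "sqrt ((1 - a) * (1 - b)) \<le> ((1 - a) + (1 - b)) / 2"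
    using assms by (intro arith_geo_mean_sqrt; simp)+
  then show "0 \<le> gap a b" unfolding gap_def by argo
  have "a \<le> sqrt (a * b)"
    using assms by (intro real_le_rsqrt) (simp add: power2_eq_square mult_left_mono)
  moreover have "1 - b \<le> sqrt ((1 - a) * (1 - b))"
    using assms by (intro real_le_rsqrt) (simp add: power2_eq_square mult_right_mono)
  ultimately show "gap a b \<le> b - a" by (simp add: gap_def)
qed

definition excess :: "real \<Rightarrow> real \<Rightarrow> real \<Rightarrow> real \<Rightarrow> real \<Rightarrow> real \<Rightarrow> real" where
  "excess A B c a b x = (if a < x \<and> x < b then c - A / x - B / (1 - x) else 0)"

lemma measurable_excess [measurable]: "excess A B c a b \<in> borel_measurable borel"
  unfolding excess_def[abs_def] by measurable

text \<open>By the Cauchy-Schwarz inequality \<open>s\<^sup>2/x + t\<^sup>2/(1 - x) \<ge> (s + t)\<^sup>2\<close> with \<open>s = \<surd>(a b)\<close> and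
  \<open>t = \<surd>((1 - a) (1 - b))\<close>, the minimum of \<open>f\<close> is at least \<open>c (1 - gap a b)\<^sup>2\<close>.\<close>

lemma excess_bounds:
  assumes opt: "optimal_window A B c a b"
  shows "0 \<le> excess A B c a b x" and "excess A B c a b x \<le> 2 * c * gap a b"
proof -
  have ab: "0 \<le> a" "a < b" "b \<le> 1" "0 < c" and AB: "A = c * a * b" "B = c * (1 - a) * (1 - b)"
    using opt by (auto simp: optimal_window_def)
  have q0: "0 \<le> gap a b" using gap_bounds ab by simp
  have "0 \<le> c - A / x - B / (1 - x) \<and> c - A / x - B / (1 - x) \<le> 2 * c * gap a b"
    if x: "a < x" "x < b"
  proof -
    have x01: "0 < x" "x < 1" using x ab by auto
    define s t where "s = sqrt (a * b)" and "t = sqrt ((1 - a) * (1 - b))"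
    have s2: "a * b = s\<^sup>2" and t2: "(1 - a) * (1 - b) = t\<^sup>2" using ab by (auto simp: s_def t_def)
    have "s\<^sup>2 / x + t\<^sup>2 / (1 - x) - (s + t)\<^sup>2 = (s * (1 - x) - t * x)\<^sup>2 / (x * (1 - x))"
      using x01 by (simp add: field_simps power2_eq_square)
    moreover have "0 \<le> (s * (1 - x) - t * x)\<^sup>2 / (x * (1 - x))" using x01 by simp
    ultimately have "(s + t)\<^sup>2 \<le> s\<^sup>2 / x + t\<^sup>2 / (1 - x)" by simp
    then have "c * (s + t)\<^sup>2 \<le> c * (s\<^sup>2 / x + t\<^sup>2 / (1 - x))" using ab by simp
    also have "\<dots> = A / x + B / (1 - x)"
      unfolding AB mult.assoc s2 t2 by (simp add: algebra_simps)
    finally have "c - A / x - B / (1 - x) \<le> c * (1 - (s + t)\<^sup>2)" by (simp add: algebra_simps)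
    also have "1 - (s + t)\<^sup>2 \<le> 2 * gap a b"
      using zero_le_power2[of "gap a b"] unfolding gap_def s_def[symmetric] t_def[symmetric]
      by (simp add: power2_eq_square algebra_simps)
    finally have "c - A / x - B / (1 - x) \<le> c * (2 * gap a b)" using ab by simp
    then show ?thesis using excess_sign(1)[OF opt x01] x by simp
  qed
  then show "0 \<le> excess A B c a b x" "excess A B c a b x \<le> 2 * c * gap a b"
    using ab q0 by (auto simp: excess_def)
qed

lemma has_bochner_integral_excess:
  assumes opt: "optimal_window A B c a b"
  shows "has_bochner_integral lborel (excess A B c a b) 1"
proof (rule has_bochner_integral_nn_integral)
  have "(\<integral>\<^sup>+x. ennreal (excess A B c a b x) \<partial>lborel) =
      (\<integral>\<^sup>+x\<in>{0<..<1}. ennreal (c - A / x - B / (1 - x)) \<partial>lborel)"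
  proof (rule nn_integral_cong)
    fix x :: real
    have "0 \<le> a" "b \<le> 1" using opt by (auto simp: optimal_window_def)
    show "ennreal (excess A B c a b x) = ennreal (c - A / x - B / (1 - x)) * indicator {0<..<1} x"
    proof (cases "x \<in> {0<..<1}")
      case True
      show ?thesis
      proof (cases "a < x \<and> x < b")
        case False
        then have "c - A / x - B / (1 - x) \<le> 0" using excess_sign(1)[OF opt, of x] True by auto
        then show ?thesis using False by (auto simp: excess_def ennreal_neg)
      qed (use True in \<open>simp add: excess_def\<close>)
    qed (use \<open>0 \<le> a\<close> \<open>b \<le> 1\<close> in \<open>auto simp: excess_def\<close>)
  qed
  also have "\<dots> = 1" using opt unfolding optimal_window_def by blast
  finally show "(\<integral>\<^sup>+x. ennreal (excess A B c a b x) \<partial>lborel) = ennreal 1" by simp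
qed (use excess_bounds[OF opt] in auto)

text \<open>A function of integral 1 that is bounded by \<open>2 c gap a b\<close> and lives on \<open>(a, b)\<close> forces this window to
  be wide; the second bound combines this with \<open>gap a b \<le> b - a\<close>.\<close>

lemma window_width:
  assumes opt: "optimal_window A B c a b"
  shows "1 \<le> 2 * c * gap a b * (b - a)" and "1 \<le> sqrt (2 * c) * (b - a)"
proof -
  have ab: "0 \<le> a" "a < b" "b \<le> 1" "0 < c" using opt by (auto simp: optimal_window_def)
  have i: "has_bochner_integral lborel (\<lambda>x. 2 * c * gap a b * indicator {a<..<b} x) (2 * c * gap a b * (b - a))"
    using has_bochner_integral_real_indicator[of "{a<..<b}" lborel] ab
    by (intro has_bochner_integral_mult_right) auto
  show *: "1 \<le> 2 * c * gap a b * (b - a)"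
  proof -
    have "integral\<^sup>L lborel (excess A B c a b) \<le> (\<integral>x. 2 * c * gap a b * indicator {a<..<b} x \<partial>lborel)"
    proof (rule integral_mono)
      show "excess A B c a b x \<le> 2 * c * gap a b * indicator {a<..<b} x" for x
        using excess_bounds(2)[OF opt, of x] by (auto simp: excess_def indicator_def)
    qed (use i has_bochner_integral_excess[OF opt] in \<open>simp_all add: has_bochner_integral_iff\<close>)
    then show ?thesis
      unfolding has_bochner_integral_integral_eq[OF i]
        has_bochner_integral_integral_eq[OF has_bochner_integral_excess[OF opt]] .
  qed
  also have "\<dots> \<le> 2 * c * (b - a) * (b - a)"
    using gap_bounds(2)[of a b] ab by (intro mult_right_mono mult_left_mono) auto
  finally have "1 \<le> (sqrt (2 * c) * (b - a))\<^sup>2"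
    using ab by (simp add: power_mult_distrib power2_eq_square[of "b - a"])
  then show "1 \<le> sqrt (2 * c) * (b - a)"
    using ab by (metis abs_le_square_iff abs_of_nonneg abs_one mult_nonneg_nonneg one_power2 real_sqrt_ge_zero
      less_imp_le diff_ge_0_iff_ge mult_nonneg_nonneg zero_le_numeral)
qed

text \<open>The end point \<open>a = 0\<close> can only occur together with \<open>K = 0\<close>; then both sides are 0.\<close>

lemma has_bochner_integral_inverse_square:
  fixes K :: real
  assumes "0 \<le> K" "0 \<le> a" "a < b" "K = 0 \<or> 0 < a"
  shows "has_bochner_integral lborel (\<lambda>x. if a < x \<and> x < b then K / x\<^sup>2 else 0) (K * (b - a) / (a * b))"
proof (cases "K = 0")
  case False
  then have a: "0 < a" using assms by auto
  have "has_bochner_integral lborel (\<lambda>x. K / x\<^sup>2 * indicator {a..b} x) (- K / b - (- K / a))"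
  proof (rule has_bochner_integral_FTC_Icc_nonneg)
    show "DERIV (\<lambda>x. - K / x) x :> K / x\<^sup>2" if "x \<in> {a..b}" for x
      using a that by (auto intro!: derivative_eq_intros simp: power2_eq_square)
  qed (use assms in auto)
  also have "- K / b - (- K / a) = K * (b - a) / (a * b)"
    using a assms by (simp add: field_simps)
  finally have i: "has_bochner_integral lborel (\<lambda>x. K / x\<^sup>2 * indicator {a..b} x) (K * (b - a) / (a * b))" .
  have "AE x::real in lborel. x \<noteq> a \<and> x \<noteq> b" by (simp add: AE_lborel_singleton)
  then have "AE x in lborel. K / x\<^sup>2 * indicator {a..b} x = (if a < x \<and> x < b then K / x\<^sup>2 else 0)"
    by eventually_elim (auto simp: indicator_def)
  with i show ?thesis by (subst (asm) has_bochner_integral_cong_AE) auto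
next
  case True
  then have "(\<lambda>x. if a < x \<and> x < b then K / x\<^sup>2 else 0) = (\<lambda>x. 0)" by auto
  then show ?thesis using True by (simp add: has_bochner_integral_iff)
qed

text \<open>The change of the sum of the powers \<open>3/2\<close> when a node of value \<open>c\<close> on the unit interval is replaced,
  upon acceptance of \<open>x\<close>, by its children on \<open>(0, x)\<close> and \<open>(x, 1)\<close>.\<close>

definition curvature :: "real \<Rightarrow> real \<Rightarrow> real \<Rightarrow> real \<Rightarrow> real \<Rightarrow> real \<Rightarrow> real" where
  "curvature A B c a b x =
     (if a < x \<and> x < b then A * sqrt A / x\<^sup>2 + B * sqrt B / (1 - x)\<^sup>2 - c * sqrt c else 0)"

text \<open>With \<open>A = c a b\<close>, the integral \<open>A \<surd>A (b - a) / (a b)\<close> of \<open>A \<surd>A / x\<^sup>2\<close> is \<open>c \<surd>c \<surd>(a b) (b - a)\<close>, and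
  symmetrically for \<open>B\<close>; this is where the exponent \<open>3/2\<close> meets the gap.\<close>

lemma has_bochner_integral_curvature:
  assumes opt: "optimal_window A B c a b"
  shows "has_bochner_integral lborel (curvature A B c a b) (- (c * sqrt c * gap a b * (b - a)))"
proof -
  have ab: "0 \<le> a" "a < b" "b \<le> 1" "0 < c" and AB: "A = c * a * b" "B = c * (1 - a) * (1 - b)"
    using opt by (auto simp: optimal_window_def)
  have val: "c * a * b * sqrt (c * a * b) * w / (a * b) = c * sqrt c * sqrt (a * b) * w" for a b w
    by (cases "a * b = 0") (auto simp: real_sqrt_mult)
  have L: "has_bochner_integral lborel (\<lambda>x. if a < x \<and> x < b then A * sqrt A / x\<^sup>2 else 0)
      (c * sqrt c * sqrt (a * b) * (b - a))"
    using has_bochner_integral_inverse_square[of "A * sqrt A" a b] ab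
    unfolding AB val by (auto simp: order_le_less)
  have "has_bochner_integral lborel (\<lambda>x. if 1 - b < x \<and> x < 1 - a then B * sqrt B / x\<^sup>2 else 0)
      (B * sqrt B * ((1 - a) - (1 - b)) / ((1 - b) * (1 - a)))"
    by (rule has_bochner_integral_inverse_square) (use ab AB in \<open>auto simp: order_le_less\<close>)
  also have "B * sqrt B * ((1 - a) - (1 - b)) / ((1 - b) * (1 - a)) = c * sqrt c * sqrt ((1 - a) * (1 - b)) * (b - a)"
    unfolding AB using val[of "1 - a" "1 - b" "b - a"] by (simp add: mult.commute)
  finally have "has_bochner_integral lborel
      (\<lambda>x. if 1 - b < 1 + - 1 * x \<and> 1 + - 1 * x < 1 - a then B * sqrt B / (1 + - 1 * x)\<^sup>2 else 0)
      (c * sqrt c * sqrt ((1 - a) * (1 - b)) * (b - a) /\<^sub>R \<bar>-1\<bar>)"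
    by (subst (asm) lborel_has_bochner_integral_real_affine_iff[of "-1" _ _ 1]) simp_all
  then have R: "has_bochner_integral lborel (\<lambda>x. if a < x \<and> x < b then B * sqrt B / (1 - x)\<^sup>2 else 0)
      (c * sqrt c * sqrt ((1 - a) * (1 - b)) * (b - a))"
    by (simp add: conj_commute cong: if_cong)
  have I: "has_bochner_integral lborel (\<lambda>x. c * sqrt c * indicator {a<..<b} x) (c * sqrt c * (b - a))"
    using has_bochner_integral_real_indicator[of "{a<..<b}" lborel] ab
    by (intro has_bochner_integral_mult_right) auto
  have "has_bochner_integral lborel (\<lambda>x. (if a < x \<and> x < b then A * sqrt A / x\<^sup>2 else 0)
      + (if a < x \<and> x < b then B * sqrt B / (1 - x)\<^sup>2 else 0) - c * sqrt c * indicator {a<..<b} x)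
      (c * sqrt c * sqrt (a * b) * (b - a) + c * sqrt c * sqrt ((1 - a) * (1 - b)) * (b - a) - c * sqrt c * (b - a))"
    by (intro has_bochner_integral_diff has_bochner_integral_add L R I)
  then show ?thesis
    by (rule has_bochner_integral_cong[THEN iffD1, rotated 3])
      (auto simp: curvature_def indicator_def gap_def algebra_simps)
qed

text \<open>The square of the excess is at most \<open>2 c gap a b\<close> times the excess, which has integral 1. The factor
  \<open>2 \<surd>2\<close> is chosen so that the width bound \<open>\<surd>(2 c) (b - a) \<ge> 1\<close> makes the negative integral of the
  curvature pay for this.\<close>

lemma variance_budget:
  assumes opt: "optimal_window A B c a b"
  shows "\<exists>I\<le>0. has_bochner_integral lborel
    (\<lambda>x. (excess A B c a b x)\<^sup>2 + 2 * sqrt 2 * curvature A B c a b x) I"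
proof -
  have ab: "0 \<le> a" "a < b" "b \<le> 1" "0 < c" using opt by (auto simp: optimal_window_def)
  let ?D = "excess A B c a b" and ?m = "2 * c * gap a b"
  have sq: "(?D x)\<^sup>2 \<le> ?m * ?D x" for x
    using excess_bounds[OF opt, of x] by (simp add: power2_eq_square mult_right_mono)
  have iD: "integrable lborel (\<lambda>x. ?m * ?D x)"
    using has_bochner_integral_excess[OF opt] by (auto simp: has_bochner_integral_iff)
  have i2: "integrable lborel (\<lambda>x. (?D x)\<^sup>2)"
    by (rule Bochner_Integration.integrable_bound[OF iD])
      (use sq excess_bounds[OF opt] in \<open>auto intro!: AE_I2 order_trans[OF sq]\<close>)
  have "(\<integral>x. (?D x)\<^sup>2 \<partial>lborel) \<le> (\<integral>x. ?m * ?D x \<partial>lborel)"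
    by (rule integral_mono[OF i2 iD]) (rule sq)
  also have "\<dots> = ?m"
    using has_bochner_integral_excess[OF opt] by (auto simp: has_bochner_integral_iff)
  finally have le: "(\<integral>x. (?D x)\<^sup>2 \<partial>lborel) \<le> ?m" .
  have "?m * 1 \<le> ?m * (sqrt (2 * c) * (b - a))"
    using window_width(2)[OF opt] gap_bounds(1)[of a b] ab by (intro mult_left_mono) auto
  also have "\<dots> = 2 * sqrt 2 * (c * sqrt c * gap a b * (b - a))"
    by (simp add: real_sqrt_mult)
  finally have le2: "?m \<le> 2 * sqrt 2 * (c * sqrt c * gap a b * (b - a))" by simp
  have "has_bochner_integral lborel (\<lambda>x. (?D x)\<^sup>2 + 2 * sqrt 2 * curvature A B c a b x)
      ((\<integral>x. (?D x)\<^sup>2 \<partial>lborel) + 2 * sqrt 2 * (- (c * sqrt c * gap a b * (b - a))))"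
    by (intro has_bochner_integral_add has_bochner_integral_mult_right has_bochner_integral_curvature[OF opt]
        has_bochner_integral_integrable i2)
  then show ?thesis using le le2 by (intro exI conjI) auto
qed

abbreviation unif :: "real measure" where "unif \<equiv> uniform_measure lborel {0..1}"

lemma prob_space_unif: "prob_space unif"
  by (rule prob_space_uniform_measure) auto

lemma has_bochner_integral_unif:
  fixes g :: "real \<Rightarrow> real"
  assumes "has_bochner_integral lborel g I" and "\<And>x. x \<notin> {0..1} \<Longrightarrow> g x = 0"
  shows "has_bochner_integral unif g I"
proof -
  have [measurable]: "g \<in> borel_measurable borel"
    using assms(1) by (auto simp: has_bochner_integral_iff)
  have "unif = density lborel (\<lambda>x. ennreal (indicator {0..1} x))"
    unfolding uniform_measure_def by (rule density_cong) (auto simp: indicator_def)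
  moreover have "has_bochner_integral (density lborel (\<lambda>x. ennreal (indicator {0..1} x))) g I"
  proof (rule has_bochner_integral_density)
    have "(\<lambda>x. indicator {0..1} x *\<^sub>R g x) = g" using assms(2) by (auto simp: fun_eq_iff indicator_def)
    then show "has_bochner_integral lborel (\<lambda>x. indicator {0..1} x *\<^sub>R g x) I" using assms(1) by simp
  qed auto
  ultimately show ?thesis by simp
qed

lemma has_bochner_integral_rescale:
  fixes g :: "real \<Rightarrow> real"
  assumes "has_bochner_integral lborel g I" and "l < u"
  shows "has_bochner_integral lborel (\<lambda>x. g ((x - l) / (u - l))) ((u - l) * I)"
proof -
  have "has_bochner_integral lborel (\<lambda>x. g (- l / (u - l) + 1 / (u - l) * x)) (I /\<^sub>R \<bar>1 / (u - l)\<bar>)"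
    using assms by (subst lborel_has_bochner_integral_real_affine_iff[symmetric]) auto
  moreover have "(\<lambda>x. g (- l / (u - l) + 1 / (u - l) * x)) = (\<lambda>x. g ((x - l) / (u - l)))"
  proof (intro ext arg_cong[where f=g])
    show "- l / (u - l) + 1 / (u - l) * x = (x - l) / (u - l)" for x
      by (simp add: diff_divide_distrib)
  qed
  ultimately show ?thesis using assms(2) by simp
qed

lemma has_bochner_integral_unif_rescale:
  fixes g :: "real \<Rightarrow> real"
  assumes "has_bochner_integral lborel g I" and "0 \<le> l" "l < u" "u \<le> 1"
    and "\<And>z. z \<notin> {0<..<1} \<Longrightarrow> g z = 0"
  shows "has_bochner_integral unif (\<lambda>x. g ((x - l) / (u - l))) ((u - l) * I)"
proof (rule has_bochner_integral_unif[OF has_bochner_integral_rescale[OF assms(1,3)]])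
  fix x assume "x \<notin> {0..1::real}"
  then have "(x - l) / (u - l) \<notin> {0<..<1}" using assms(2-4) by (auto simp: field_simps)
  then show "g ((x - l) / (u - l)) = 0" by (rule assms(5))
qed

text \<open>The excess transported from the unit interval to \<open>(l, u)\<close>: the amount by which the potential drops
  when \<open>x\<close> is accepted, if this is positive, and 0 otherwise.\<close>

definition reward :: "real \<Rightarrow> real \<Rightarrow> real \<Rightarrow> real \<Rightarrow> real \<Rightarrow> real \<Rightarrow> real \<Rightarrow> real \<Rightarrow> real" where
  "reward A B c a b l u x = excess A B c a b ((x - l) / (u - l)) / (u - l)"

lemma has_bochner_integral_reward:
  assumes opt: "optimal_window A B c a b" and lu: "0 \<le> l" "l < u" "u \<le> 1"
  shows "has_bochner_integral unif (reward A B c a b l u) 1"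
proof -
  have ab: "0 \<le> a" "b \<le> 1" using opt by (auto simp: optimal_window_def)
  have "has_bochner_integral unif (\<lambda>x. excess A B c a b ((x - l) / (u - l))) ((u - l) * 1)"
    by (rule has_bochner_integral_unif_rescale[OF has_bochner_integral_excess[OF opt] lu])
      (use ab in \<open>auto simp: excess_def\<close>)
  then have "has_bochner_integral unif (\<lambda>x. excess A B c a b ((x - l) / (u - l)) / (u - l)) ((u - l) * 1 / (u - l))"
    by (rule has_bochner_integral_divide_zero)
  then show ?thesis using lu by (simp add: reward_def[abs_def])
qed

lemma rescaled_excess:
  fixes l u x :: real
  assumes "l < u"
  shows "(c - A / ((x - l) / (u - l)) - B / (1 - (x - l) / (u - l))) / (u - l)
    = c / (u - l) - A / (x - l) - B / (u - x)"
proof -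
  have 1: "1 - (x - l) / (u - l) = (u - x) / (u - l)" using assms by (simp add: field_simps)
  have 2: "(c - P - Q) / (u - l) = c / (u - l) - P / (u - l) - Q / (u - l)" for P Q
    by (simp add: diff_divide_distrib)
  have 3: "K / (y / (u - l)) / (u - l) = K / y" for K y using assms by simp
  show ?thesis unfolding 1 2 3 ..
qed

lemma reward_dominates:
  assumes opt: "optimal_window A B c a b" and "l < x" "x < u"
  shows "c / (u - l) - A / (x - l) - B / (u - x) \<le> reward A B c a b l u x"
proof -
  let ?z = "(x - l) / (u - l)"
  have w: "0 < u - l" using assms by simp
  have z: "0 < ?z" "?z < 1" using assms by (auto simp: field_simps)
  have "c / (u - l) - A / (x - l) - B / (u - x) = (c - A / ?z - B / (1 - ?z)) / (u - l)"
    using w by (simp only: rescaled_excess diff_gt_0_iff_gt)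
  also have "\<dots> \<le> reward A B c a b l u x"
    unfolding reward_def using excess_sign(1)[OF opt z] w
    by (intro divide_right_mono) (auto simp: excess_def)
  finally show ?thesis .
qed

lemma reward_in_window:
  assumes "l < u" and "0 \<le> a" "b \<le> 1"
  shows "reward A B c a b l u x =
    (if l + (u - l) * a < x \<and> x < l + (u - l) * b then c / (u - l) - A / (x - l) - B / (u - x) else 0)"
proof -
  let ?z = "(x - l) / (u - l)"
  have w: "0 < u - l" using assms by simp
  have iff: "a < ?z \<and> ?z < b \<longleftrightarrow> l + (u - l) * a < x \<and> x < l + (u - l) * b"
    using w by (auto simp: field_simps)
  have "excess A B c a b ?z / (u - l) = c / (u - l) - A / (x - l) - B / (u - x)" if z: "a < ?z" "?z < b"
  proof -
    have "excess A B c a b ?z = c - A / ?z - B / (1 - ?z)" using z by (simp add: excess_def)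
    then show ?thesis using assms(1) by (simp only: rescaled_excess)
  qed
  then show ?thesis unfolding iff[symmetric] reward_def by (auto simp: excess_def)
qed

text \<open>One observation used optimally lowers the potential by 1 on average, which compensates the unit of
  time that it takes.\<close>

lemma mean_step:
  assumes opt: "optimal_window A B c a b" and lu: "0 \<le> l" "l < u" "u \<le> 1"
    and nonneg: "\<And>x. 0 \<le> V - reward A B c a b l u x"
  shows "(\<integral>\<^sup>+x. ennreal (1 + (V - reward A B c a b l u x)) \<partial>unif) = ennreal V"
proof -
  interpret prob_space unif by (rule prob_space_unif)
  have cst: "has_bochner_integral unif (\<lambda>_. k) k" for k :: real
    by (simp add: has_bochner_integral_iff prob_space)
  have "has_bochner_integral unif (\<lambda>x. (1 + V) - reward A B c a b l u x) ((1 + V) - 1)"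
    by (intro has_bochner_integral_diff has_bochner_integral_reward[OF opt lu] cst)
  then have "has_bochner_integral unif (\<lambda>x. 1 + (V - reward A B c a b l u x)) V"
    by (simp add: prob_space add_diff_eq)
  then show ?thesis
    by (subst nn_integral_eq_integral) (use nonneg in \<open>auto simp: has_bochner_integral_iff intro!: AE_I2 add_nonneg_nonneg\<close>)
qed

text \<open>Expanding the square, the terms linear in the reward contribute \<open>- 2 (1 + V)\<close> because the reward has
  mean 1, and the remaining terms are the rescaled integrand of \<open>variance_budget\<close>.\<close>

lemma second_moment_step:
  assumes opt: "optimal_window A B c a b" and lu: "0 \<le> l" "l < u" "u \<le> 1"
    and nonneg: "\<And>x. 0 \<le> W + 2 * sqrt 2 * curvature A B c a b ((x - l) / (u - l)) / (u - l)\<^sup>2"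
  shows "(\<integral>\<^sup>+x. ennreal ((1 + (V - reward A B c a b l u x))\<^sup>2
      + (W + 2 * sqrt 2 * curvature A B c a b ((x - l) / (u - l)) / (u - l)\<^sup>2)) \<partial>unif) \<le> ennreal (V\<^sup>2 + W)"
proof -
  interpret prob_space unif by (rule prob_space_unif)
  have cst: "has_bochner_integral unif (\<lambda>_. k) k" for k :: real
    by (simp add: has_bochner_integral_iff prob_space)
  have ab: "0 \<le> a" "b \<le> 1" using opt by (auto simp: optimal_window_def)
  let ?h = "\<lambda>x. (excess A B c a b x)\<^sup>2 + 2 * sqrt 2 * curvature A B c a b x"
  obtain I where I: "I \<le> 0" "has_bochner_integral lborel ?h I" using variance_budget[OF opt] by blast
  have "has_bochner_integral unif (\<lambda>x. ?h ((x - l) / (u - l))) ((u - l) * I)"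
    by (rule has_bochner_integral_unif_rescale[OF I(2) lu]) (use ab in \<open>auto simp: excess_def curvature_def\<close>)
  then have h: "has_bochner_integral unif (\<lambda>x. ?h ((x - l) / (u - l)) / (u - l)\<^sup>2) ((u - l) * I / (u - l)\<^sup>2)"
    by (rule has_bochner_integral_divide_zero)
  have "has_bochner_integral unif (\<lambda>x. ((1 + V)\<^sup>2 + W) - 2 * (1 + V) * reward A B c a b l u x + ?h ((x - l) / (u - l)) / (u - l)\<^sup>2)
     (((1 + V)\<^sup>2 + W) - 2 * (1 + V) * 1 + (u - l) * I / (u - l)\<^sup>2)"
    by (intro has_bochner_integral_add h has_bochner_integral_diff has_bochner_integral_mult_right
       has_bochner_integral_reward[OF opt lu] cst)
  moreover have "(\<lambda>x. ((1 + V)\<^sup>2 + W) - 2 * (1 + V) * reward A B c a b l u x + ?h ((x - l) / (u - l)) / (u - l)\<^sup>2) =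
    (\<lambda>x. (1 + (V - reward A B c a b l u x))\<^sup>2
      + (W + 2 * sqrt 2 * curvature A B c a b ((x - l) / (u - l)) / (u - l)\<^sup>2))"
    by (intro ext) (simp add: reward_def power_divide add_divide_distrib power2_eq_square algebra_simps)
  ultimately have J: "has_bochner_integral unif (\<lambda>x. (1 + (V - reward A B c a b l u x))\<^sup>2
      + (W + 2 * sqrt 2 * curvature A B c a b ((x - l) / (u - l)) / (u - l)\<^sup>2))
      ((1 + V)\<^sup>2 + W - 2 * (1 + V) + (u - l) * I / (u - l)\<^sup>2)"
    by (simp add: prob_space)
  have "(u - l) * I / (u - l)\<^sup>2 \<le> 0"
    using I(1) lu by (intro divide_nonpos_nonneg mult_nonneg_nonpos) auto
  then have "(1 + V)\<^sup>2 + W - 2 * (1 + V) + (u - l) * I / (u - l)\<^sup>2 \<le> V\<^sup>2 + W"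
    by (simp add: power2_eq_square algebra_simps)
  then show ?thesis
    using J nonneg
    by (subst nn_integral_eq_integral) (auto simp: has_bochner_integral_iff intro!: AE_I2 add_nonneg_nonneg ennreal_leI)
qed

section \<open>Search trees, subpermutations and potentials\<close>

lemma set_tree_bst_insert: "set_tree (bst_insert \<pi> i t) = insert i (set_tree t)"
  by (induction t) auto

text \<open>Insertion times increase along paths from the root because later keys are inserted further down; this
  makes the root of a subtree its first key, which is what the recursion on permutations needs.\<close>

fun heap_bst :: "nat list \<Rightarrow> nat tree \<Rightarrow> bool" where
  "heap_bst \<pi> Leaf = True"
| "heap_bst \<pi> (Node l j r) =
     ((\<forall>i\<in>set_tree l. j < i \<and> entry \<pi> i < entry \<pi> j) \<and>
      (\<forall>i\<in>set_tree r. j < i \<and> entry \<pi> j < entry \<pi> i) \<and> heap_bst \<pi> l \<and> heap_bst \<pi> r)"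

lemma heap_bst_insert:
  "heap_bst \<pi> t \<Longrightarrow> \<forall>j\<in>set_tree t. j < i \<and> entry \<pi> j \<noteq> entry \<pi> i \<Longrightarrow> heap_bst \<pi> (bst_insert \<pi> i t)"
  by (induction t) (auto simp: set_tree_bst_insert)

lemma search_tree_heap_bst:
  assumes "distinct \<pi>"
  shows "set_tree (search_tree \<pi>) = {1..length \<pi>}" and "heap_bst \<pi> (search_tree \<pi>)"
proof -
  have "n \<le> length \<pi> \<Longrightarrow> set_tree (fold (bst_insert \<pi>) [1..<n + 1] Leaf) = {1..n} \<and>
      heap_bst \<pi> (fold (bst_insert \<pi>) [1..<n + 1] Leaf)" for n
  proof (induction n)
    case 0
    then show ?case by simp
  next
    case (Suc n)
    let ?t = "fold (bst_insert \<pi>) [1..<n + 1] Leaf"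
    have IH: "set_tree ?t = {1..n}" "heap_bst \<pi> ?t" using Suc by auto
    have eq: "fold (bst_insert \<pi>) [1..<Suc n + 1] Leaf = bst_insert \<pi> (Suc n) ?t"
      by simp
    have "\<forall>j\<in>set_tree ?t. j < Suc n \<and> entry \<pi> j \<noteq> entry \<pi> (Suc n)"
      unfolding IH using assms Suc.prems by (auto simp: entry_def nth_eq_iff_index_eq)
    from heap_bst_insert[OF IH(2) this] show ?case
      unfolding eq set_tree_bst_insert IH(1) by auto
  qed
  from this[of "length \<pi>"] show "set_tree (search_tree \<pi>) = {1..length \<pi>}" "heap_bst \<pi> (search_tree \<pi>)"
    by (simp_all add: search_tree_def)
qed

text \<open>Ranks only depend on the relative order. So passing to a subsequence and then to ranks gives the same
  permutation whether or not ranks were already taken before.\<close>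

lemma standardize_map_mono:
  assumes "strict_mono_on (set xs) h"
  shows "standardize (map h xs) = standardize xs"
proof -
  have inj: "inj_on h (set xs)" using assms by (rule strict_mono_on_imp_inj_on)
  have "card {y \<in> h ` set xs. y \<le> h x} = card {y \<in> set xs. y \<le> x}" if "x \<in> set xs" for x
  proof -
    have "{y \<in> h ` set xs. y \<le> h x} = h ` {y \<in> set xs. y \<le> x}"
      using assms that by (auto simp: strict_mono_on_leD dest: strict_mono_on_less_eq[THEN iffD1, rotated 2])
    then show ?thesis
      using inj by (simp add: card_image inj_on_subset)
  qed
  then show ?thesis by (auto simp: standardize_def)
qed

lemma rank_strict_mono:
  "finite S \<Longrightarrow> strict_mono_on S (\<lambda>x::nat. card {y \<in> S. y \<le> x})"
proof (rule strict_mono_onI)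
  fix r s assume "finite S" "r \<in> S" "s \<in> S" "r < s"
  then have "s \<in> {y \<in> S. y \<le> s}" "s \<notin> {y \<in> S. y \<le> r}" by auto
  then have "{y \<in> S. y \<le> r} \<subset> {y \<in> S. y \<le> s}"
  proof (intro psubsetI)
    show "{y \<in> S. y \<le> r} \<subseteq> {y \<in> S. y \<le> s}" using \<open>r < s\<close> by auto
  qed blast
  then show "card {y \<in> S. y \<le> r} < card {y \<in> S. y \<le> s}"
    using \<open>finite S\<close> by (intro psubset_card_mono) auto
qed

lemma filter_hd_standardize:
  fixes ys :: "nat list"
  assumes "ys \<noteq> []"
  shows "left_perm (standardize ys) = standardize (filter (\<lambda>x. x < hd ys) ys)"
    and "right_perm (standardize ys) = standardize (filter (\<lambda>x. x > hd ys) ys)"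
proof -
  let ?h = "\<lambda>x. card {y \<in> set ys. y \<le> x}"
  have sm: "strict_mono_on (set ys) ?h" by (rule rank_strict_mono) simp
  have e: "entry (standardize ys) 1 = ?h (hd ys)"
    using assms by (simp add: entry_def standardize_def hd_conv_nth)
  have less: "?h x < ?h y \<longleftrightarrow> x < y" if "x \<in> set ys" "y \<in> set ys" for x y
    using strict_mono_on_less[OF sm that] .
  have h: "hd ys \<in> set ys" using assms by simp
  have f: "filter (\<lambda>x. x < ?h (hd ys)) (map ?h ys) = map ?h (filter (\<lambda>x. x < hd ys) ys)"
    unfolding filter_map o_def by (intro arg_cong[where f="map ?h"] filter_cong refl less h)
  have g: "filter (\<lambda>x. x > ?h (hd ys)) (map ?h ys) = map ?h (filter (\<lambda>x. x > hd ys) ys)"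
    unfolding filter_map o_def by (intro arg_cong[where f="map ?h"] filter_cong refl less h)
  have s: "standardize ys = map ?h ys" by (simp add: standardize_def)
  show "left_perm (standardize ys) = standardize (filter (\<lambda>x. x < hd ys) ys)"
    unfolding left_perm_def e unfolding s f
    by (rule standardize_map_mono) (rule monotone_on_subset[OF sm], auto)
  show "right_perm (standardize ys) = standardize (filter (\<lambda>x. x > hd ys) ys)"
    unfolding right_perm_def e unfolding s g
    by (rule standardize_map_mono) (rule monotone_on_subset[OF sm], auto)
qed

lemma length_standardize [simp]: "length (standardize xs) = length xs"
  by (simp add: standardize_def)

lemma standardize_Nil [simp]: "standardize [] = []"
  by (simp add: standardize_def)

lemma standardize_Perms:
  assumes "distinct xs"
  shows "standardize xs \<in> Perms (length xs)"
proof -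
  let ?h = "\<lambda>x. card {y \<in> set xs. y \<le> x}"
  have inj: "inj_on ?h (set xs)"
    by (rule strict_mono_on_imp_inj_on[OF rank_strict_mono]) simp
  have d: "distinct (standardize xs)"
    using assms inj by (simp add: standardize_def distinct_map)
  have sub: "?h ` set xs \<subseteq> {1..length xs}"
  proof clarsimp
    fix x assume "x \<in> set xs"
    then have "0 < ?h x" by (auto simp: card_gt_0_iff)
    moreover have "?h x \<le> card (set xs)" by (rule card_mono) auto
    ultimately show "Suc 0 \<le> ?h x \<and> ?h x \<le> length xs" using card_length[of xs] by linarith
  qed
  have "?h ` set xs = {1..length xs}"
    by (rule card_subset_eq[OF _ sub]) (use assms inj in \<open>auto simp: card_image distinct_card\<close>)
  then show ?thesis
    using d by (auto simp: Perms_def permutations_of_set_def standardize_def)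
qed

lemma standardize_Perm_id:
  assumes "\<pi> \<in> Perms k"
  shows "standardize \<pi> = \<pi>"
proof -
  have s: "set \<pi> = {1..k}" using assms by (auto simp: Perms_def permutations_of_set_def)
  have "card {y \<in> {1..k}. y \<le> x} = x" if "x \<in> {1..k}" for x
  proof -
    have "{y \<in> {1..k}. y \<le> x} = {1..x}" using that by auto
    then show ?thesis by simp
  qed
  then show ?thesis unfolding standardize_def s by (intro map_idI) (simp add: s)
qed

text \<open>The permutation formed by the keys of a subtree, in order of insertion. It extends \<open>subtree_perm\<close> from
  nodes to subtrees, so that an empty child has the empty permutation.\<close>

definition tree_perm :: "nat list \<Rightarrow> nat tree \<Rightarrow> nat list" where
  "tree_perm \<pi> t = standardize (map (entry \<pi>) (sorted_list_of_set (set_tree t)))"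

lemma tree_perm_Leaf [simp]: "tree_perm \<pi> Leaf = []"
  by (simp add: tree_perm_def)

text \<open>The first key of a subtree is that of its root, and the later ones go to the left or to the right
  child according to their comparison with it.\<close>

lemma tree_perm_children:
  assumes "heap_bst \<pi> (Node l j r)"
  shows "left_perm (tree_perm \<pi> (Node l j r)) = tree_perm \<pi> l"
    and "right_perm (tree_perm \<pi> (Node l j r)) = tree_perm \<pi> r"
proof -
  let ?S = "set_tree (Node l j r)"
  let ?xs = "sorted_list_of_set ?S"
  have fin: "finite ?S" by simp
  have "Min ?S = j" using assms by (intro Min_eqI) (auto dest: less_imp_le)
  then have xs: "?xs = j # sorted_list_of_set (?S - {j})"
    using sorted_list_of_set_nonempty[OF fin] by simp
  have filt: "filter P ?xs = sorted_list_of_set {x \<in> ?S. P x}" for P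
    by (rule sorted_distinct_set_unique)
      (simp_all only: sorted_wrt_filter distinct_filter sorted_list_of_set.sorted_sorted_key_list_of_set
         sorted_list_of_set.distinct_sorted_key_list_of_set set_filter set_sorted_list_of_set[OF fin]
         set_sorted_list_of_set[OF finite_subset[OF Collect_restrict fin]] mem_Collect_eq)
  have l: "{i \<in> ?S. entry \<pi> i < entry \<pi> j} = set_tree l"
    and r: "{i \<in> ?S. entry \<pi> j < entry \<pi> i} = set_tree r"
    using assms by (auto dest: less_asym)
  have ne: "map (entry \<pi>) ?xs \<noteq> []" and hd: "hd (map (entry \<pi>) ?xs) = entry \<pi> j"
    unfolding xs by auto
  show "left_perm (tree_perm \<pi> (Node l j r)) = tree_perm \<pi> l"
    unfolding tree_perm_def filter_hd_standardize(1)[OF ne] hd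
    by (simp only: filter_map o_def filt l)
  show "right_perm (tree_perm \<pi> (Node l j r)) = tree_perm \<pi> r"
    unfolding tree_perm_def filter_hd_standardize(2)[OF ne] hd
    by (simp only: filter_map o_def filt r)
qed

lemma Perms_length: "\<pi> \<in> Perms k \<Longrightarrow> length \<pi> = k"
  by (auto simp: Perms_def permutations_of_set_def dest: distinct_card)

lemma Perms_distinct: "\<pi> \<in> Perms k \<Longrightarrow> distinct \<pi>"
  by (auto simp: Perms_def permutations_of_set_def)

lemma tree_perm_search_tree:
  assumes "\<pi> \<in> Perms k"
  shows "tree_perm \<pi> (search_tree \<pi>) = \<pi>"
proof -
  have "map (entry \<pi>) [1..<Suc (length \<pi>)] = \<pi>"
    by (rule nth_equalityI) (auto simp: entry_def simp del: upt_Suc)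
  moreover have "sorted_list_of_set {1..length \<pi>} = [1..<Suc (length \<pi>)]"
    by (metis atLeastLessThanSuc_atLeastAtMost sorted_list_of_set_range)
  ultimately show ?thesis
    unfolding tree_perm_def search_tree_heap_bst(1)[OF Perms_distinct[OF assms]]
    using standardize_Perm_id[OF assms] by simp
qed

lemma tree_perm_Perms:
  assumes "distinct \<pi>" "set_tree t \<subseteq> {1..length \<pi>}"
  shows "tree_perm \<pi> t \<in> Perms (card (set_tree t))"
proof -
  have "inj_on (entry \<pi>) {1..length \<pi>}"
    using assms(1) by (auto simp: inj_on_def entry_def nth_eq_iff_index_eq)
  then have "distinct (map (entry \<pi>) (sorted_list_of_set (set_tree t)))"
    using assms(2) by (simp add: distinct_map inj_on_subset)
  from standardize_Perms[OF this] show ?thesis by (simp add: tree_perm_def)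
qed

lemma set_subtree_at: "set_tree (subtree_at i t) \<subseteq> set_tree t"
  by (induction t) auto

lemma subtree_at_Node:
  "heap_bst \<pi> t \<Longrightarrow> i \<in> set_tree t \<Longrightarrow>
    \<exists>l r. subtree_at i t = Node l i r \<and> heap_bst \<pi> (Node l i r)"
  by (induction t) auto

text \<open>The update of the interval assignment when \<open>x\<close> is accepted as the value of node \<open>i\<close>.\<close>

definition advance :: "nat tree \<Rightarrow> nat \<Rightarrow> real \<Rightarrow> (nat \<Rightarrow> real \<times> real) \<Rightarrow> nat \<Rightarrow> real \<times> real" where
  "advance t i x iv = (case subtree_at i t of
     Leaf \<Rightarrow> iv
   | Node lt _ rt \<Rightarrow> set_root lt (fst (iv i), x) (set_root rt (x, snd (iv i)) iv))"

lemma set_root_other: "m \<notin> set_tree t \<Longrightarrow> set_root t p iv m = iv m"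
  by (cases t) auto

lemma advance_other: "m \<notin> set_tree t \<Longrightarrow> advance t i x iv m = iv m"
  using set_subtree_at[of i t]
  by (cases "subtree_at i t") (auto simp: advance_def intro!: set_root_other trans[OF set_root_other])

lemma advance_left:
  "i \<noteq> j \<Longrightarrow> i \<in> set_tree l \<Longrightarrow> advance (Node l j r) i x iv = advance l i x iv"
  by (simp add: advance_def)

lemma advance_right:
  "i \<noteq> j \<Longrightarrow> i \<notin> set_tree l \<Longrightarrow> advance (Node l j r) i x iv = advance r i x iv"
  by (simp add: advance_def)

lemma advance_root:
  assumes "heap_bst \<pi> (Node l i r)"
  shows "l = Node ll a lr \<Longrightarrow> advance (Node l i r) i x iv a = (fst (iv i), x)"
    and "r = Node rl b rr \<Longrightarrow> advance (Node l i r) i x iv b = (x, snd (iv i))"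
proof -
  show "l = Node ll a lr \<Longrightarrow> advance (Node l i r) i x iv a = (fst (iv i), x)"
    by (simp add: advance_def)
  assume r: "r = Node rl b rr"
  then have "b \<notin> set_tree l" using assms by (auto dest: less_asym)
  then show "advance (Node l i r) i x iv b = (x, snd (iv i))"
    by (simp add: advance_def set_root_other r)
qed

text \<open>The sum over the topmost nodes with label larger than \<open>n\<close>, that is, over the subtrees that remain
  after \<open>n\<close> nodes have been processed. The weight \<open>g\<close> and the exponent \<open>e\<close> are parameters because the
  first and the second moment use two different potentials.\<close>

fun pot :: "(nat list \<Rightarrow> real) \<Rightarrow> nat \<Rightarrow> nat list \<Rightarrow> nat \<Rightarrow> (nat \<Rightarrow> real \<times> real) \<Rightarrow> nat tree \<Rightarrow> real" where
  "pot g e \<pi> n iv Leaf = 0"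
| "pot g e \<pi> n iv (Node l j r) =
     (if j \<le> n then pot g e \<pi> n iv l + pot g e \<pi> n iv r
      else g (tree_perm \<pi> (Node l j r)) / (snd (iv j) - fst (iv j)) ^ e)"

lemma pot_cong:
  "Suc n \<notin> set_tree t \<Longrightarrow> (\<And>m. m \<in> set_tree t \<Longrightarrow> iv' m = iv m) \<Longrightarrow>
    pot g e \<pi> (Suc n) iv' t = pot g e \<pi> n iv t"
  by (induction t) (auto simp: le_Suc_eq)

lemma pot_fresh:
  assumes "\<And>m. m \<in> set_tree t \<Longrightarrow> n < m" and "g [] = 0"
    and "\<And>l j r. t = Node l j r \<Longrightarrow> iv j = (a, b)"
  shows "pot g e \<pi> n iv t = g (tree_perm \<pi> t) / (b - a) ^ e"
proof (cases t)
  case (Node lt j rt)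
  then show ?thesis using assms(1)[of j] assms(3)[OF Node] by simp
qed (simp add: assms(2))

text \<open>Only the summand of the processed node changes: it is replaced by those of its two children. The
  induction locates this node; by the order on the labels all its ancestors have been processed, and
  the intervals assigned outside of its subtree stay the same.\<close>

lemma pot_advance:
  assumes "heap_bst \<pi> t" and "Suc n \<in> set_tree t" and "g [] = 0"
    and "subtree_at (Suc n) t = Node lt (Suc n) rt" and "iv (Suc n) = (a, b)"
  shows "pot g e \<pi> (Suc n) (advance t (Suc n) x iv) t = pot g e \<pi> n iv t
     - g (tree_perm \<pi> (Node lt (Suc n) rt)) / (b - a) ^ e
     + g (tree_perm \<pi> lt) / (x - a) ^ e + g (tree_perm \<pi> rt) / (b - x) ^ e"
  using assms(1,2,4)
proof (induction t)
  case Leaf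
  then show ?case by simp
next
  case (Node l j r)
  consider "j = Suc n" | "j \<noteq> Suc n" "Suc n \<in> set_tree l" | "j \<noteq> Suc n" "Suc n \<notin> set_tree l" "Suc n \<in> set_tree r"
    using Node.prems by auto
  then show ?case
  proof cases
    case 1
    then have eq: "lt = l" "rt = r" using Node.prems by auto
    have h: "heap_bst \<pi> (Node l (Suc n) r)" using Node.prems 1 by simp
    let ?iv = "advance (Node l (Suc n) r) (Suc n) x iv"
    have "pot g e \<pi> (Suc n) ?iv l = g (tree_perm \<pi> l) / (x - a) ^ e"
    proof (rule pot_fresh)
      show "?iv m = (a, x)" if "l = Node a' m b'" for a' m b'
        using advance_root(1)[OF h that] assms(5) by simp
    qed (use h assms(3) in auto)
    moreover have "pot g e \<pi> (Suc n) ?iv r = g (tree_perm \<pi> r) / (b - x) ^ e"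
    proof (rule pot_fresh)
      show "?iv m = (x, b)" if "r = Node a' m b'" for a' m b'
        using advance_root(2)[OF h that] assms(5) by simp
    qed (use h assms(3) in auto)
    ultimately show ?thesis using 1 eq assms(5) by simp
  next
    case 2
    then have j: "j \<le> n" using Node.prems by auto
    have nr: "m \<notin> set_tree l" if "m \<in> set_tree r" for m
      using Node.prems that by (auto dest: less_asym)
    have nr': "Suc n \<notin> set_tree r" using nr 2 by blast
    have "pot g e \<pi> (Suc n) (advance l (Suc n) x iv) r = pot g e \<pi> n iv r"
      by (rule pot_cong[OF nr']) (simp add: nr advance_other)
    moreover have "subtree_at (Suc n) l = Node lt (Suc n) rt" using Node.prems 2 by auto
    ultimately show ?thesis
      using Node.IH(1) Node.prems 2 j by (simp add: advance_left fun_upd_def)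
  next
    case 3
    then have j: "j \<le> n" using Node.prems by auto
    have nr: "m \<notin> set_tree r" if "m \<in> set_tree l" for m
      using Node.prems that by (auto dest: less_asym)
    have "pot g e \<pi> (Suc n) (advance r (Suc n) x iv) l = pot g e \<pi> n iv l"
      by (rule pot_cong[OF 3(2)]) (simp add: nr advance_other)
    moreover have "subtree_at (Suc n) r = Node lt (Suc n) rt" using Node.prems 3 by auto
    ultimately show ?thesis
      using Node.IH(2) Node.prems 3 j by (simp add: advance_right fun_upd_def)
  qed
qed

lemma pot_done: "set_tree t \<subseteq> {..n} \<Longrightarrow> pot g e \<pi> n iv t = 0"
  by (induction t) auto

text \<open>The intervals held by the topmost unprocessed nodes are those determined by the accepted values \<open>y\<close> of
  the nodes above them, and these values lie strictly inside their own intervals.\<close>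

fun placed :: "nat \<Rightarrow> (nat \<Rightarrow> real \<times> real) \<Rightarrow> (nat \<Rightarrow> real) \<Rightarrow> real \<Rightarrow> real \<Rightarrow> nat tree \<Rightarrow> bool" where
  "placed n iv y l u Leaf = True"
| "placed n iv y l u (Node lt j rt) =
     (if j \<le> n then l < y j \<and> y j < u \<and> placed n iv y l (y j) lt \<and> placed n iv y (y j) u rt
      else iv j = (l, u))"

lemma placed_cong:
  "Suc n \<notin> set_tree t \<Longrightarrow> (\<And>m. m \<in> set_tree t \<Longrightarrow> iv' m = iv m) \<Longrightarrow>
    placed (Suc n) iv' (y(Suc n := x)) l u t = placed n iv y l u t"
  by (induction t arbitrary: l u) (auto simp: le_Suc_eq)

lemma placed_fresh:
  assumes "\<And>m. m \<in> set_tree t \<Longrightarrow> n < m" and "\<And>l j r. t = Node l j r \<Longrightarrow> iv j = (a, b)"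
  shows "placed n iv y a b t"
proof (cases t)
  case (Node lt j rt)
  then show ?thesis using assms(1)[of j] assms(2)[OF Node] by simp
qed simp

lemma placed_advance:
  assumes "heap_bst \<pi> t" and "Suc n \<in> set_tree t" and "placed n iv y l u t"
    and "fst (iv (Suc n)) < x" "x < snd (iv (Suc n))"
  shows "placed (Suc n) (advance t (Suc n) x iv) (y(Suc n := x)) l u t"
  using assms(1-3)
proof (induction t arbitrary: l u)
  case Leaf
  then show ?case by simp
next
  case (Node lt j rt)
  consider "j = Suc n" | "j \<noteq> Suc n" "Suc n \<in> set_tree lt" | "j \<noteq> Suc n" "Suc n \<notin> set_tree lt" "Suc n \<in> set_tree rt"
    using Node.prems by auto
  then show ?case
  proof cases
    case 1
    have h: "heap_bst \<pi> (Node lt (Suc n) rt)" using Node.prems 1 by simp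
    let ?iv = "advance (Node lt (Suc n) rt) (Suc n) x iv"
    have iv: "iv (Suc n) = (l, u)" using Node.prems 1 by simp
    have "placed (Suc n) ?iv (y(Suc n := x)) l x lt"
    proof (rule placed_fresh)
      show "?iv m = (l, x)" if "lt = Node a' m b'" for a' m b'
        using advance_root(1)[OF h that] iv by simp
    qed (use h in auto)
    moreover have "placed (Suc n) ?iv (y(Suc n := x)) x u rt"
    proof (rule placed_fresh)
      show "?iv m = (x, u)" if "rt = Node a' m b'" for a' m b'
        using advance_root(2)[OF h that] iv by simp
    qed (use h in auto)
    ultimately show ?thesis using 1 assms(4,5) iv by (simp add: fun_upd_def)
  next
    case 2
    then have j: "j \<le> n" using Node.prems by auto
    have nr: "m \<notin> set_tree lt" if "m \<in> set_tree rt" for m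
      using Node.prems that by (auto dest: less_asym)
    have nr': "Suc n \<notin> set_tree rt" using nr 2 by blast
    have "placed (Suc n) (advance lt (Suc n) x iv) (y(Suc n := x)) (y j) u rt = placed n iv y (y j) u rt"
      by (rule placed_cong[OF nr']) (simp add: nr advance_other)
    then show ?thesis
      using Node.IH(1) Node.prems 2 j by (simp add: advance_left fun_upd_def)
  next
    case 3
    then have j: "j \<le> n" using Node.prems by auto
    have nr: "m \<notin> set_tree rt" if "m \<in> set_tree lt" for m
      using Node.prems that by (auto dest: less_asym)
    have "placed (Suc n) (advance rt (Suc n) x iv) (y(Suc n := x)) l (y j) lt = placed n iv y l (y j) lt"
      by (rule placed_cong[OF 3(2)]) (simp add: nr advance_other)
    then show ?thesis
      using Node.IH(2) Node.prems 3 j by (simp add: advance_right fun_upd_def)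
  qed
qed

lemma placed_bounds:
  assumes "heap_bst \<pi> t" and "Suc n \<in> set_tree t" and "placed n iv y l u t" and "l < u"
  shows "l \<le> fst (iv (Suc n)) \<and> fst (iv (Suc n)) < snd (iv (Suc n)) \<and> snd (iv (Suc n)) \<le> u"
  using assms
proof (induction t arbitrary: l u)
  case (Node lt j rt)
  show ?case
  proof (cases "j = Suc n")
    case True
    then show ?thesis using Node.prems by simp
  next
    case False
    then have j: "j \<le> n" using Node.prems by auto
    show ?thesis
    proof (cases "Suc n \<in> set_tree lt")
      case True
      then show ?thesis using Node.IH(1)[of l "y j"] Node.prems j by auto
    next
      case 2: False
      then have "Suc n \<in> set_tree rt" using Node.prems False by auto
      then show ?thesis using Node.IH(2)[of "y j" u] Node.prems j by auto
    qed
  qed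
qed simp

text \<open>If \<open>y\<close> respects the order of the keys then the value of the next node lies in its interval; this is
  the form in which an arbitrary algorithm is confronted with the intervals of the search tree.\<close>

lemma placed_room:
  assumes "heap_bst \<pi> t" and "Suc n \<in> set_tree t" and "placed n iv y l u t"
    and "\<And>i. i \<in> set_tree t \<Longrightarrow> l < y i \<and> y i < u"
    and "\<And>i j. i \<in> set_tree t \<Longrightarrow> j \<in> set_tree t \<Longrightarrow> entry \<pi> i < entry \<pi> j \<Longrightarrow> y i < y j"
  shows "fst (iv (Suc n)) < y (Suc n) \<and> y (Suc n) < snd (iv (Suc n))"
  using assms
proof (induction t arbitrary: l u)
  case (Node lt j rt)
  show ?case
  proof (cases "j = Suc n")
    case True
    then show ?thesis using Node.prems by simp
  next
    case False
    then have j: "j \<le> n" using Node.prems by auto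
    show ?thesis
    proof (cases "Suc n \<in> set_tree lt")
      case True
      show ?thesis by (rule Node.IH(1)[of l "y j"]) (use Node.prems j True in auto)
    next
      case 2: False
      then have r: "Suc n \<in> set_tree rt" using Node.prems False by auto
      show ?thesis by (rule Node.IH(2)[of "y j" u]) (use Node.prems j r in auto)
    qed
  qed
qed simp

text \<open>The converse direction, for the canonical algorithm: values chosen inside their intervals are in the
  order of the keys, because the value of a node separates its two subtrees.\<close>

lemma placed_done:
  assumes "heap_bst \<pi> t" and "set_tree t \<subseteq> {..n}" and "placed n iv y l u t"
  shows "(\<forall>i\<in>set_tree t. l < y i \<and> y i < u) \<and>
    (\<forall>i\<in>set_tree t. \<forall>j\<in>set_tree t. entry \<pi> i < entry \<pi> j \<longrightarrow> y i < y j)"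
  using assms
proof (induction t arbitrary: l u)
  case (Node lt m rt)
  then have y: "l < y m" "y m < u" "placed n iv y l (y m) lt" "placed n iv y (y m) u rt" by auto
  have L: "(\<forall>i\<in>set_tree lt. l < y i \<and> y i < y m) \<and>
    (\<forall>i\<in>set_tree lt. \<forall>j\<in>set_tree lt. entry \<pi> i < entry \<pi> j \<longrightarrow> y i < y j)"
    using Node.IH(1)[of l "y m"] Node.prems y by auto
  have R: "(\<forall>i\<in>set_tree rt. y m < y i \<and> y i < u) \<and>
    (\<forall>i\<in>set_tree rt. \<forall>j\<in>set_tree rt. entry \<pi> i < entry \<pi> j \<longrightarrow> y i < y j)"
    using Node.IH(2)[of "y m" u] Node.prems y by auto
  have H: "\<forall>i\<in>set_tree lt. entry \<pi> i < entry \<pi> m" "\<forall>i\<in>set_tree rt. entry \<pi> m < entry \<pi> i"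
    using Node.prems by auto
  have sep: "y i < y m" if "i \<in> set_tree lt" for i using L that by blast
  have sep': "y m < y i" if "i \<in> set_tree rt" for i using R that by blast
  have "y i < y j" if ij: "i \<in> set_tree (Node lt m rt)" "j \<in> set_tree (Node lt m rt)"
    and less: "entry \<pi> i < entry \<pi> j" for i j
  proof -
    have i: "i \<in> set_tree lt \<or> i = m \<or> i \<in> set_tree rt" using ij by auto
    have j: "j \<in> set_tree lt \<or> j = m \<or> j \<in> set_tree rt" using ij by auto
    from i j show ?thesis
    proof (elim disjE)
      assume "i \<in> set_tree lt" "j \<in> set_tree rt"
      then show ?thesis using sep sep' less_trans by blast
    next
      assume "i \<in> set_tree rt" "j \<in> set_tree lt"
      then have "entry \<pi> j < entry \<pi> i" using H less_trans by blast
      then show ?thesis using less by simp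
    next
      assume "i \<in> set_tree rt" "j = m"
      then have "entry \<pi> j < entry \<pi> i" using H by blast
      then show ?thesis using less by simp
    next
      assume "i = m" "j \<in> set_tree lt"
      then have "entry \<pi> j < entry \<pi> i" using H by blast
      then show ?thesis using less by simp
    qed (use L R sep sep' less in auto)
  qed
  moreover have "l < y i \<and> y i < u" if "i \<in> set_tree (Node lt m rt)" for i
    using that L R y(1,2) by force
  ultimately show ?case by blast
qed simp

lemma pot_nonneg:
  "placed n iv y l u t \<Longrightarrow> l < u \<Longrightarrow> (\<And>\<sigma>. 0 \<le> g \<sigma>) \<Longrightarrow> 0 \<le> pot g e \<pi> n iv t"
  by (induction t arbitrary: l u) auto

section \<open>Resampling one coordinate of the stream\<close>

lemma space_stream_law [simp]: "space stream_law = UNIV"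
  by (simp add: stream_law_def space_stream_space)

lemma space_nat_filtration [simp]: "space (nat_filtration t) = UNIV"
  by (simp add: nat_filtration_def space_measure_of_conv)

lemma prob_space_stream_law: "prob_space stream_law"
  unfolding stream_law_def by (rule prob_space.prob_space_stream_space[OF prob_space_unif])

lemma measurable_snth_stream_law [measurable]: "(\<lambda>\<omega>. \<omega> !! n) \<in> borel_measurable stream_law"
proof -
  have "(\<lambda>\<omega>. \<omega> !! n) \<in> measurable (stream_space unif) unif" by (rule measurable_snth)
  then show ?thesis unfolding stream_law_def by (simp cong: measurable_cong_sets)
qed

lemma measurable_X [measurable]: "X t \<in> borel_measurable stream_law"
  unfolding X_def[abs_def] by (rule measurable_snth_stream_law)

lemma measurable_into_stream_law:
  assumes "\<And>n. (\<lambda>\<omega>. f \<omega> !! n) \<in> borel_measurable N"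
  shows "f \<in> measurable N stream_law"
  unfolding stream_law_def
proof (rule measurable_stream_space2)
  show "(\<lambda>\<omega>. f \<omega> !! n) \<in> measurable N unif" for n
    using assms[of n] by (simp cong: measurable_cong_sets)
qed

lemma nn_integral_stream_law:
  assumes "f \<in> borel_measurable stream_law"
  shows "(\<integral>\<^sup>+\<omega>. f \<omega> \<partial>stream_law) = (\<integral>\<^sup>+x. \<integral>\<^sup>+\<omega>. f (x ## \<omega>) \<partial>stream_law \<partial>unif)"
  using prob_space.nn_integral_stream_space[OF prob_space_unif, of f] assms
  unfolding stream_law_def by blast

text \<open>Replacement of the observation with index \<open>n\<close> (the one at time \<open>n + 1\<close>) by \<open>x\<close>.\<close>

primrec resample :: "nat \<Rightarrow> real \<Rightarrow> real stream \<Rightarrow> real stream" where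
  "resample 0 x \<omega> = x ## stl \<omega>"
| "resample (Suc n) x \<omega> = shd \<omega> ## resample n x (stl \<omega>)"

lemma snth_resample: "resample n x \<omega> !! m = (if m = n then x else \<omega> !! m)"
proof (induction n arbitrary: m \<omega>)
  case 0
  then show ?case by (cases m) auto
next
  case (Suc n)
  then show ?case by (cases m) auto
qed

lemma measurable_Stream_stream_law [measurable]:
  "(\<lambda>(x, \<omega>). x ## \<omega>) \<in> measurable (unif \<Otimes>\<^sub>M stream_law) stream_law"
proof (rule measurable_into_stream_law)
  fix n
  show "(\<lambda>p. (case p of (x, \<omega>) \<Rightarrow> x ## \<omega>) !! n) \<in> borel_measurable (unif \<Otimes>\<^sub>M stream_law)"
  proof (cases n)
    case 0
    have "fst \<in> measurable (unif \<Otimes>\<^sub>M stream_law) unif" by simp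
    then have "fst \<in> borel_measurable (unif \<Otimes>\<^sub>M stream_law)" by (simp cong: measurable_cong_sets)
    then show ?thesis by (simp add: 0 case_prod_beta)
  next
    case (Suc m)
    show ?thesis by (simp add: Suc case_prod_beta)
  qed
qed

lemma measurable_resample [measurable]:
  "(\<lambda>(\<omega>, x). resample n x \<omega>) \<in> measurable (stream_law \<Otimes>\<^sub>M unif) stream_law"
proof (rule measurable_into_stream_law)
  fix m
  have "snd \<in> measurable (stream_law \<Otimes>\<^sub>M unif) unif" by simp
  then have "snd \<in> borel_measurable (stream_law \<Otimes>\<^sub>M unif)" by (simp cong: measurable_cong_sets)
  then show "(\<lambda>p. (case p of (\<omega>, x) \<Rightarrow> resample n x \<omega>) !! m) \<in> borel_measurable (stream_law \<Otimes>\<^sub>M unif)"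
    by (cases "m = n") (simp_all add: snth_resample case_prod_beta)
qed

text \<open>The law of the stream is invariant under the replacement of one observation by an independent one.
  This takes the place of conditioning on the past.\<close>

lemma nn_integral_resample:
  assumes "f \<in> borel_measurable stream_law"
  shows "(\<integral>\<^sup>+\<omega>. f \<omega> \<partial>stream_law) = (\<integral>\<^sup>+\<omega>. \<integral>\<^sup>+x. f (resample n x \<omega>) \<partial>unif \<partial>stream_law)"
  using assms
proof (induction n arbitrary: f)
  case 0
  note [measurable] = 0
  interpret S: prob_space stream_law by (rule prob_space_stream_law)
  interpret U: prob_space unif by (rule prob_space_unif)
  interpret P: pair_sigma_finite unif stream_law ..
  have [measurable]: "(\<lambda>p. f (fst p ## snd p)) \<in> borel_measurable (unif \<Otimes>\<^sub>M stream_law)"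
    using measurable_compose[OF measurable_Stream_stream_law 0] by (simp add: case_prod_beta)
  have m: "(\<lambda>\<omega>. \<integral>\<^sup>+x. f (resample 0 x \<omega>) \<partial>unif) \<in> borel_measurable stream_law"
  proof (rule U.borel_measurable_nn_integral)
    show "(\<lambda>(\<omega>, x). f (resample 0 x \<omega>)) \<in> borel_measurable (stream_law \<Otimes>\<^sub>M unif)"
      using measurable_compose[OF measurable_resample[of 0] 0] by (simp only: split_beta')
  qed
  have "(\<integral>\<^sup>+\<omega>. \<integral>\<^sup>+x. f (resample 0 x \<omega>) \<partial>unif \<partial>stream_law) =
      (\<integral>\<^sup>+y. \<integral>\<^sup>+\<omega>. \<integral>\<^sup>+x. f (x ## \<omega>) \<partial>unif \<partial>stream_law \<partial>unif)"
    by (subst nn_integral_stream_law[OF m]) simp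
  also have "\<dots> = (\<integral>\<^sup>+\<omega>. \<integral>\<^sup>+x. f (x ## \<omega>) \<partial>unif \<partial>stream_law)"
    using U.emeasure_space_1 by simp
  also have "\<dots> = (\<integral>\<^sup>+x. \<integral>\<^sup>+\<omega>. f (x ## \<omega>) \<partial>stream_law \<partial>unif)"
    using P.Fubini[of "\<lambda>p. f (fst p ## snd p)"] by simp
  also have "\<dots> = (\<integral>\<^sup>+\<omega>. f \<omega> \<partial>stream_law)"
    by (rule nn_integral_stream_law[symmetric]) (rule 0)
  finally show ?case ..
next
  case (Suc n)
  interpret S: prob_space stream_law by (rule prob_space_stream_law)
  interpret U: prob_space unif by (rule prob_space_unif)
  have fy: "(\<lambda>\<omega>. f (y ## \<omega>)) \<in> borel_measurable stream_law" for y
  proof (rule measurable_compose[OF _ Suc.prems], rule measurable_into_stream_law)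
    show "(\<lambda>\<omega>. (y ## \<omega>) !! n) \<in> borel_measurable stream_law" for n by (cases n) auto
  qed
  have m: "(\<lambda>\<omega>. \<integral>\<^sup>+x. f (resample (Suc n) x \<omega>) \<partial>unif) \<in> borel_measurable stream_law"
  proof (rule U.borel_measurable_nn_integral)
    show "(\<lambda>(\<omega>, x). f (resample (Suc n) x \<omega>)) \<in> borel_measurable (stream_law \<Otimes>\<^sub>M unif)"
      using measurable_compose[OF measurable_resample[of "Suc n"] Suc.prems] by (simp only: split_beta')
  qed
  have "(\<integral>\<^sup>+\<omega>. \<integral>\<^sup>+x. f (resample (Suc n) x \<omega>) \<partial>unif \<partial>stream_law) =
     (\<integral>\<^sup>+y. \<integral>\<^sup>+\<omega>. \<integral>\<^sup>+x. f (resample (Suc n) x (y ## \<omega>)) \<partial>unif \<partial>stream_law \<partial>unif)"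
    by (rule nn_integral_stream_law[OF m])
  also have "\<dots> = (\<integral>\<^sup>+y. \<integral>\<^sup>+\<omega>. f (y ## \<omega>) \<partial>stream_law \<partial>unif)"
  proof (rule nn_integral_cong)
    fix y :: real
    show "(\<integral>\<^sup>+\<omega>. \<integral>\<^sup>+x. f (resample (Suc n) x (y ## \<omega>)) \<partial>unif \<partial>stream_law) = (\<integral>\<^sup>+\<omega>. f (y ## \<omega>) \<partial>stream_law)"
      unfolding Suc.IH[OF fy, of y] resample.simps stream.sel ..
  qed
  also have "\<dots> = (\<integral>\<^sup>+\<omega>. f \<omega> \<partial>stream_law)"
    by (rule nn_integral_stream_law[symmetric]) (rule Suc.prems)
  finally show ?case ..
qed

lemma sets_nat_filtration_eq:
  "sets (nat_filtration t) = sigma_sets UNIV {X s -` B | s B. 1 \<le> s \<and> enat s \<le> t \<and> B \<in> sets borel}"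
  unfolding nat_filtration_def space_stream_law Int_UNIV_right
  by (rule sets_measure_of) simp

lemma sets_nat_filtration_subset: "sets (nat_filtration t) \<subseteq> sets stream_law"
proof -
  have "X s -` B \<in> sets stream_law" if "B \<in> sets borel" for s B
    using measurable_sets[OF measurable_X that, of s] by simp
  then have "sigma_sets (space stream_law) {X s -` B | s B. 1 \<le> s \<and> enat s \<le> t \<and> B \<in> sets borel} \<subseteq> sets stream_law"
    by (intro sets.sigma_sets_subset) auto
  then show ?thesis unfolding sets_nat_filtration_eq by simp
qed

lemma nat_filtration_resample:
  assumes "A \<in> sets (nat_filtration (enat n))"
  shows "resample n x \<omega> \<in> A \<longleftrightarrow> \<omega> \<in> A"
  using assms unfolding sets_nat_filtration_eq
proof (induction rule: sigma_sets.induct)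
  case (Basic A)
  then obtain s B where A: "A = X s -` B" "1 \<le> s" "s \<le> n" by auto
  then have "s - 1 \<noteq> n" by simp
  then have "X s (resample n x \<omega>) = X s \<omega>" by (simp add: X_def snth_resample)
  then show ?case using A by simp
qed auto

text \<open>Such an event is its own preimage under the map that sets all observations after time \<open>n\<close> to 0, and
  this map is measurable with respect to the first \<open>n\<close> observations.\<close>

lemma nat_filtrationI:
  assumes A: "A \<in> sets stream_law"
    and det: "\<And>\<omega> \<omega>'. (\<And>s. s < n \<Longrightarrow> \<omega> !! s = \<omega>' !! s) \<Longrightarrow> \<omega> \<in> A \<longleftrightarrow> \<omega>' \<in> A"
  shows "A \<in> sets (nat_filtration (enat n))"
proof -
  define g where "g \<omega> = to_stream (\<lambda>s. if s < n then \<omega> !! s else 0)" for \<omega> :: "real stream"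
  have g: "g \<omega> !! s = (if s < n then \<omega> !! s else 0)" for \<omega> s by (simp add: g_def to_stream_def)
  have "g \<in> measurable (nat_filtration (enat n)) stream_law"
  proof (rule measurable_into_stream_law)
    fix s
    show "(\<lambda>\<omega>. g \<omega> !! s) \<in> borel_measurable (nat_filtration (enat n))"
    proof (cases "s < n")
      case True
      have "X (Suc s) \<in> borel_measurable (nat_filtration (enat n))"
      proof (rule measurableI)
        fix B :: "real set" assume "B \<in> sets borel"
        then have "\<exists>s' B'. X (Suc s) -` B = X s' -` B' \<and> 1 \<le> s' \<and> enat s' \<le> enat n \<and> B' \<in> sets borel"
          using True by (intro exI[of _ "Suc s"] exI[of _ B]) simp
        then have "X (Suc s) -` B \<in> sets (nat_filtration (enat n))"
          unfolding sets_nat_filtration_eq by (intro sigma_sets.Basic) blast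
        then show "X (Suc s) -` B \<inter> space (nat_filtration (enat n)) \<in> sets (nat_filtration (enat n))" by simp
      qed simp
      moreover have "(\<lambda>\<omega>. g \<omega> !! s) = X (Suc s)" using True by (simp add: g X_def fun_eq_iff)
      ultimately show ?thesis by simp
    qed (simp add: g)
  qed
  from measurable_sets[OF this A] have "g -` A \<in> sets (nat_filtration (enat n))" by simp
  moreover have "g -` A = A" using det[of "g _"] by (auto simp: g)
  ultimately show ?thesis by simp
qed

lemma stopping_time_le:
  assumes "stopping_time nat_filtration \<sigma>"
  shows "{\<omega>. \<sigma> \<omega> \<le> t} \<in> sets (nat_filtration t)" and "{\<omega>. \<sigma> \<omega> \<le> t} \<in> sets stream_law"
proof -
  have "Measurable.pred (nat_filtration t) (\<lambda>\<omega>. \<sigma> \<omega> \<le> t)" by (rule stopping_timeD[OF assms])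
  then show "{\<omega>. \<sigma> \<omega> \<le> t} \<in> sets (nat_filtration t)" by (simp add: pred_def)
  then show "{\<omega>. \<sigma> \<omega> \<le> t} \<in> sets stream_law" using sets_nat_filtration_subset by blast
qed

lemma measurable_enatI:
  fixes f :: "real stream \<Rightarrow> enat"
  assumes le: "\<And>n. {\<omega>. f \<omega> \<le> enat n} \<in> sets stream_law"
  shows "f \<in> measurable stream_law (count_space UNIV)"
proof (subst measurable_count_space_eq2_countable, safe)
  fix t
  show "f -` {t} \<inter> space stream_law \<in> sets stream_law"
  proof (cases t)
    case (enat n)
    have "f -` {t} = {\<omega>. f \<omega> \<le> enat n} - (\<Union>m<n. {\<omega>. f \<omega> \<le> enat m})"
    proof (intro set_eqI)
      fix \<omega>
      show "\<omega> \<in> f -` {t} \<longleftrightarrow> \<omega> \<in> {\<omega>. f \<omega> \<le> enat n} - (\<Union>m<n. {\<omega>. f \<omega> \<le> enat m})"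
        by (cases "f \<omega>") (auto simp: enat not_le intro: antisym)
    qed
    then show ?thesis using le by (auto intro!: sets.Diff sets.finite_UN)
  next
    case infinity
    have "f -` {t} = UNIV - (\<Union>m. {\<omega>. f \<omega> \<le> enat m})"
    proof (intro set_eqI)
      fix \<omega>
      show "\<omega> \<in> f -` {t} \<longleftrightarrow> \<omega> \<in> UNIV - (\<Union>m. {\<omega>. f \<omega> \<le> enat m})"
        by (cases "f \<omega>") (auto simp: infinity)
    qed
    moreover have "UNIV \<in> sets stream_law" using sets.top[of stream_law] by simp
    ultimately show ?thesis using le by (auto intro!: sets.Diff sets.countable_UN)
  qed
qed auto

lemma measurable_X_at [measurable (raw)]:
  assumes "f \<in> measurable stream_law (count_space UNIV)"
  shows "(\<lambda>\<omega>. X (f \<omega>) \<omega>) \<in> borel_measurable stream_law"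
  by (rule measurable_compose_countable[where f="\<lambda>i. X i" and g=f, OF measurable_X assms])

lemma stopping_time_measurable:
  "stopping_time nat_filtration \<sigma> \<Longrightarrow> \<sigma> \<in> measurable stream_law (count_space UNIV)"
  by (rule measurable_enatI) (rule stopping_time_le(2))

lemma stopping_time_resample:
  assumes "stopping_time nat_filtration \<sigma>" and "m \<le> n"
  shows "\<sigma> (resample n x \<omega>) \<le> enat m \<longleftrightarrow> \<sigma> \<omega> \<le> enat m"
proof -
  have "sets (nat_filtration (enat m)) \<subseteq> sets (nat_filtration (enat n))"
    unfolding sets_nat_filtration_eq
  proof (intro sigma_sets_mono' subsetI, clarify)
    fix s and B :: "real set" assume "1 \<le> s" "enat s \<le> enat m" "B \<in> sets borel"
    then show "\<exists>s' B'. X s -` B = X s' -` B' \<and> 1 \<le> s' \<and> enat s' \<le> enat n \<and> B' \<in> sets borel"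
      using assms(2) by (intro exI[of _ s] exI[of _ B]) auto
  qed
  then have "{\<omega>. \<sigma> \<omega> \<le> enat m} \<in> sets (nat_filtration (enat n))"
    using stopping_time_le(1)[OF assms(1), of "enat m"] by blast
  from nat_filtration_resample[OF this] show ?thesis by simp
qed

lemma stopping_time_resample_eq:
  assumes st: "stopping_time nat_filtration \<sigma>" and le: "\<sigma> \<omega> \<le> enat n"
  shows "\<sigma> (resample n x \<omega>) = \<sigma> \<omega>"
proof -
  obtain m where m: "\<sigma> \<omega> = enat m" "m \<le> n" using le by (cases "\<sigma> \<omega>") auto
  have "\<sigma> (resample n x \<omega>) \<le> enat m" using stopping_time_resample[OF st m(2)] m(1) by simp
  then obtain m' where m': "\<sigma> (resample n x \<omega>) = enat m'" "m' \<le> m" by (cases "\<sigma> (resample n x \<omega>)") auto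
  have "\<sigma> \<omega> \<le> enat m'" using stopping_time_resample[OF st, of m' n x \<omega>] m' m by simp
  then show ?thesis using m m' by simp
qed

section \<open>The value of a permutation\<close>

lemma length_child_perm:
  assumes "\<pi> \<noteq> []"
  shows "length (left_perm \<pi>) < length \<pi>" and "length (right_perm \<pi>) < length \<pi>"
proof -
  have "entry \<pi> 1 \<in> set \<pi>" using assms by (simp add: entry_def)
  then show "length (left_perm \<pi>) < length \<pi>" "length (right_perm \<pi>) < length \<pi>"
    unfolding left_perm_def right_perm_def length_standardize by (rule length_filter_less; simp)+
qed

text \<open>The candidate for \<open>beta\<close>, defined without reference to algorithms. The choice selects the level of
  \<open>optimal_window_exists\<close>.\<close>

function val :: "nat list \<Rightarrow> real" where
  "val \<pi> = (if \<pi> = [] then 0 else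
     SOME c. \<exists>a b. optimal_window (val (left_perm \<pi>)) (val (right_perm \<pi>)) c a b)"
  by auto
termination
  by (relation "Wellfounded.measure length") (auto simp: length_child_perm)

declare val.simps [simp del]

lemma val_Nil [simp]: "val [] = 0" by (simp add: val.simps)

lemma val_window_nonneg:
  "0 \<le> val \<pi> \<and> (\<pi> \<noteq> [] \<longrightarrow> (\<exists>a b. optimal_window (val (left_perm \<pi>)) (val (right_perm \<pi>)) (val \<pi>) a b))"
proof (induction \<pi> rule: measure_induct_rule[of length])
  case (less \<pi>)
  show ?case
  proof (cases "\<pi> = []")
    case False
    have "0 \<le> val (left_perm \<pi>)" "0 \<le> val (right_perm \<pi>)"
      using less.IH length_child_perm[OF False] by blast+
    then have "\<exists>c a b. optimal_window (val (left_perm \<pi>)) (val (right_perm \<pi>)) c a b"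
      by (rule optimal_window_exists)
    from someI_ex[OF this]
    have "\<exists>a b. optimal_window (val (left_perm \<pi>)) (val (right_perm \<pi>)) (val \<pi>) a b"
      using val.simps[of \<pi>] False by simp
    then show ?thesis by (auto simp: optimal_window_def)
  qed simp
qed

lemma val_nonneg: "0 \<le> val \<pi>"
  using val_window_nonneg by blast

lemma val_window:
  "\<pi> \<noteq> [] \<Longrightarrow> \<exists>a b. optimal_window (val (left_perm \<pi>)) (val (right_perm \<pi>)) (val \<pi>) a b"
  using val_window_nonneg by blast

lemma val_pos: "\<pi> \<noteq> [] \<Longrightarrow> 0 < val \<pi>"
  using val_window[of \<pi>] by (auto simp: optimal_window_def)

definition optimal_windows :: "(nat list \<Rightarrow> real) \<Rightarrow> (nat list \<Rightarrow> real) \<Rightarrow> bool" where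
  "optimal_windows a b \<longleftrightarrow> (\<forall>k\<ge>1. \<forall>\<sigma>\<in>Perms k.
     optimal_window (val (left_perm \<sigma>)) (val (right_perm \<sigma>)) (val \<sigma>) (a \<sigma>) (b \<sigma>))"

lemma optimal_windows_exist: "\<exists>a b. optimal_windows a b"
proof -
  have "\<forall>\<sigma>. \<exists>a b. \<sigma> \<noteq> [] \<longrightarrow> optimal_window (val (left_perm \<sigma>)) (val (right_perm \<sigma>)) (val \<sigma>) a b"
    using val_window by blast
  then obtain a b where ab: "\<And>\<sigma>. \<sigma> \<noteq> [] \<Longrightarrow>
      optimal_window (val (left_perm \<sigma>)) (val (right_perm \<sigma>)) (val \<sigma>) (a \<sigma>) (b \<sigma>)" by metis
  have "\<sigma> \<noteq> []" if "1 \<le> k" "\<sigma> \<in> Perms k" for k \<sigma> using Perms_length[OF that(2)] that(1) by auto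
  then show ?thesis using ab unfolding optimal_windows_def by blast
qed

lemma node_facts:
  assumes \<pi>: "\<pi> \<in> Perms k" and i: "1 \<le> i" "i \<le> k"
  obtains lt rt m where "subtree_at i (search_tree \<pi>) = Node lt i rt"
    and "subtree_perm \<pi> i = tree_perm \<pi> (Node lt i rt)"
    and "left_perm (subtree_perm \<pi> i) = tree_perm \<pi> lt"
    and "right_perm (subtree_perm \<pi> i) = tree_perm \<pi> rt"
    and "1 \<le> m" and "subtree_perm \<pi> i \<in> Perms m"
proof -
  let ?T = "search_tree \<pi>"
  note T = search_tree_heap_bst[OF Perms_distinct[OF \<pi>]]
  have "i \<in> set_tree ?T" using T(1) Perms_length[OF \<pi>] i by simp
  from subtree_at_Node[OF T(2) this] obtain lt rt
    where s: "subtree_at i ?T = Node lt i rt" and h: "heap_bst \<pi> (Node lt i rt)" by blast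
  have p: "subtree_perm \<pi> i = tree_perm \<pi> (Node lt i rt)"
    by (simp only: subtree_perm_def tree_perm_def s)
  have "set_tree (Node lt i rt) \<subseteq> {1..length \<pi>}" using set_subtree_at[of i ?T] s T(1) by simp
  then have P: "tree_perm \<pi> (Node lt i rt) \<in> Perms (card (set_tree (Node lt i rt)))"
    by (rule tree_perm_Perms[OF Perms_distinct[OF \<pi>]])
  have "1 \<le> card (set_tree (Node lt i rt))"
    by (simp add: Suc_leI card_gt_0_iff)
  then show ?thesis
    using that[OF s p _ _ _ P[folded p]] tree_perm_children[OF h] p by presburger
qed

definition gain :: "(nat list \<Rightarrow> real) \<Rightarrow> (nat list \<Rightarrow> real) \<Rightarrow> nat list \<Rightarrow> nat \<Rightarrow> (nat \<Rightarrow> real \<times> real) \<Rightarrow> real \<Rightarrow> real" where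
  "gain a b \<pi> i iv x = (let \<sigma> = subtree_perm \<pi> i in
     reward (val (left_perm \<sigma>)) (val (right_perm \<sigma>)) (val \<sigma>) (a \<sigma>) (b \<sigma>) (fst (iv i)) (snd (iv i)) x)"

lemma node_window:
  assumes "optimal_windows a b" and "\<pi> \<in> Perms k" "1 \<le> i" "i \<le> k"
  shows "optimal_window (val (left_perm (subtree_perm \<pi> i))) (val (right_perm (subtree_perm \<pi> i)))
    (val (subtree_perm \<pi> i)) (a (subtree_perm \<pi> i)) (b (subtree_perm \<pi> i))"
  by (rule node_facts[OF assms(2-4)]) (use assms(1) in \<open>unfold optimal_windows_def, blast\<close>)

lemma pot_step:
  assumes \<pi>: "\<pi> \<in> Perms k" and n: "n < k" and "g [] = 0" and iv: "iv (Suc n) = (l, u)"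
    and \<sigma>: "\<sigma> = subtree_perm \<pi> (Suc n)"
  shows "pot g e \<pi> (Suc n) (advance (search_tree \<pi>) (Suc n) x iv) (search_tree \<pi>) =
    pot g e \<pi> n iv (search_tree \<pi>) - g \<sigma> / (u - l) ^ e
      + g (left_perm \<sigma>) / (x - l) ^ e + g (right_perm \<sigma>) / (u - x) ^ e"
proof -
  note T = search_tree_heap_bst[OF Perms_distinct[OF \<pi>]]
  have i: "1 \<le> Suc n" "Suc n \<le> k" using n by auto
  obtain lt rt m where N: "subtree_at (Suc n) (search_tree \<pi>) = Node lt (Suc n) rt"
    "subtree_perm \<pi> (Suc n) = tree_perm \<pi> (Node lt (Suc n) rt)"
    "left_perm (subtree_perm \<pi> (Suc n)) = tree_perm \<pi> lt"
    "right_perm (subtree_perm \<pi> (Suc n)) = tree_perm \<pi> rt"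
    by (rule node_facts[OF \<pi> i])
  have mem: "Suc n \<in> set_tree (search_tree \<pi>)" using T(1) Perms_length[OF \<pi>] n by simp
  show ?thesis unfolding \<sigma> N(2) N(3,4)[unfolded N(2)]
    by (rule pot_advance[where g=g and iv=iv, OF T(2) mem assms(3) N(1) iv])
qed

lemma pot_start:
  assumes \<pi>: "\<pi> \<in> Perms k" and "g [] = 0"
  shows "pot g e \<pi> 0 (\<lambda>_. (0, 1)) (search_tree \<pi>) = g \<pi>"
proof -
  note T = search_tree_heap_bst[OF Perms_distinct[OF \<pi>]]
  have "pot g e \<pi> 0 (\<lambda>_. (0, 1)) (search_tree \<pi>) = g (tree_perm \<pi> (search_tree \<pi>)) / (1 - 0) ^ e"
    by (rule pot_fresh) (use T assms(2) in auto)
  then show ?thesis by (simp add: tree_perm_search_tree[OF \<pi>])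
qed

lemma placed_start:
  assumes \<pi>: "\<pi> \<in> Perms k"
  shows "placed 0 (\<lambda>_. (0, 1)) y 0 1 (search_tree \<pi>)"
  by (rule placed_fresh) (use search_tree_heap_bst[OF Perms_distinct[OF \<pi>]] in auto)

primrec intervals :: "nat list \<Rightarrow> (nat \<Rightarrow> real) \<Rightarrow> nat \<Rightarrow> nat \<Rightarrow> real \<times> real" where
  "intervals \<pi> y 0 = (\<lambda>_. (0, 1))"
| "intervals \<pi> y (Suc n) = advance (search_tree \<pi>) (Suc n) (y (Suc n)) (intervals \<pi> y n)"

lemma intervals_cong:
  "(\<And>i. 1 \<le> i \<Longrightarrow> i \<le> n \<Longrightarrow> y i = y' i) \<Longrightarrow> intervals \<pi> y n = intervals \<pi> y' n"
  by (induction n) auto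

lemma placed_intervals:
  assumes \<pi>: "\<pi> \<in> Perms k"
    and y01: "\<And>i. 1 \<le> i \<Longrightarrow> i \<le> k \<Longrightarrow> 0 < y i \<and> y i < 1"
    and ord: "\<And>i j. 1 \<le> i \<Longrightarrow> i \<le> k \<Longrightarrow> 1 \<le> j \<Longrightarrow> j \<le> k \<Longrightarrow> entry \<pi> i < entry \<pi> j \<Longrightarrow> y i < y j"
    and n: "n < k"
  shows "placed n (intervals \<pi> y n) y 0 1 (search_tree \<pi>)"
    and "fst (intervals \<pi> y n (Suc n)) < y (Suc n)" and "y (Suc n) < snd (intervals \<pi> y n (Suc n))"
proof -
  note T = search_tree_heap_bst[OF Perms_distinct[OF \<pi>]]
  have S: "set_tree (search_tree \<pi>) = {1..k}" using T(1) Perms_length[OF \<pi>] by simp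
  have room: "fst (intervals \<pi> y n (Suc n)) < y (Suc n) \<and> y (Suc n) < snd (intervals \<pi> y n (Suc n))"
    if "placed n (intervals \<pi> y n) y 0 1 (search_tree \<pi>)" "n < k" for n
    by (rule placed_room[OF T(2) _ that(1)]) (use S that(2) y01 ord in auto)
  have "placed n (intervals \<pi> y n) y 0 1 (search_tree \<pi>)" if "n < k" for n
    using that
  proof (induction n)
    case 0
    then show ?case using placed_start[OF \<pi>] by simp
  next
    case (Suc n)
    then have pl: "placed n (intervals \<pi> y n) y 0 1 (search_tree \<pi>)" by simp
    have mem: "Suc n \<in> set_tree (search_tree \<pi>)" using S Suc.prems by simp
    have lt: "n < k" using Suc.prems by simp
    have r1: "fst (intervals \<pi> y n (Suc n)) < y (Suc n)" and r2: "y (Suc n) < snd (intervals \<pi> y n (Suc n))"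
      using room[OF pl lt] by auto
    show ?case using placed_advance[OF T(2) mem pl r1 r2] by simp
  qed
  then show "placed n (intervals \<pi> y n) y 0 1 (search_tree \<pi>)" using n .
  from room[OF this n] show "fst (intervals \<pi> y n (Suc n)) < y (Suc n)"
    "y (Suc n) < snd (intervals \<pi> y n (Suc n))" by auto
qed

text \<open>The potential falls from \<open>val \<pi>\<close> to 0 while the \<open>k\<close> keys are accepted, and every drop is at most the
  gain of the accepted value.\<close>

lemma val_le_gains:
  assumes opt: "optimal_windows a b" and \<pi>: "\<pi> \<in> Perms k"
    and y01: "\<And>i. 1 \<le> i \<Longrightarrow> i \<le> k \<Longrightarrow> 0 < y i \<and> y i < 1"
    and ord: "\<And>i j. 1 \<le> i \<Longrightarrow> i \<le> k \<Longrightarrow> 1 \<le> j \<Longrightarrow> j \<le> k \<Longrightarrow> entry \<pi> i < entry \<pi> j \<Longrightarrow> y i < y j"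
  shows "val \<pi> \<le> (\<Sum>i = 1..k. gain a b \<pi> i (intervals \<pi> y (i - 1)) (y i))"
proof -
  note T = search_tree_heap_bst[OF Perms_distinct[OF \<pi>]]
  have "n \<le> k \<Longrightarrow> val \<pi> \<le> pot val 1 \<pi> n (intervals \<pi> y n) (search_tree \<pi>)
     + (\<Sum>i = 1..n. gain a b \<pi> i (intervals \<pi> y (i - 1)) (y i))" for n
  proof (induction n)
    case 0
    then show ?case using pot_start[OF \<pi>, of val 1] by simp
  next
    case (Suc n)
    then have n: "n < k" by simp
    let ?iv = "intervals \<pi> y n" and ?\<sigma> = "subtree_perm \<pi> (Suc n)"
    obtain l u where iv: "?iv (Suc n) = (l, u)" by fastforce
    note room = placed_intervals(2,3)[where y=y, OF \<pi> y01 ord n]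
    have "val ?\<sigma> / (u - l) - val (left_perm ?\<sigma>) / (y (Suc n) - l) - val (right_perm ?\<sigma>) / (u - y (Suc n))
       \<le> gain a b \<pi> (Suc n) ?iv (y (Suc n))"
      unfolding gain_def Let_def iv fst_conv snd_conv
      by (rule reward_dominates[OF node_window[OF opt \<pi>]]) (use n room iv in auto)
    moreover note pot_step[where e=1 and g=val and iv="?iv", OF \<pi> n val_Nil iv refl, of "y (Suc n)"]
    ultimately show ?case using Suc.IH n by simp
  qed
  from this[of k] show ?thesis
    using pot_done[of "search_tree \<pi>" k val 1 \<pi>] T(1) Perms_length[OF \<pi>] by auto
qed

section \<open>The lower bound for arbitrary algorithms\<close>

definition measurable_ivs :: "'a measure \<Rightarrow> ('a \<Rightarrow> nat \<Rightarrow> real \<times> real) \<Rightarrow> bool" where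
  "measurable_ivs M iv \<longleftrightarrow> (\<forall>j. (\<lambda>\<omega>. fst (iv \<omega> j)) \<in> borel_measurable M \<and>
     (\<lambda>\<omega>. snd (iv \<omega> j)) \<in> borel_measurable M)"

lemma measurable_ivs_set_root:
  assumes "p \<in> borel_measurable M" "q \<in> borel_measurable M" and "measurable_ivs M iv"
  shows "measurable_ivs M (\<lambda>\<omega>. set_root t (p \<omega>, q \<omega>) (iv \<omega>))"
proof (cases t)
  case Leaf
  then show ?thesis using assms(3) by simp
next
  case (Node lt i rt)
  show ?thesis
    unfolding measurable_ivs_def
  proof
    fix j
    show "(\<lambda>\<omega>. fst (set_root t (p \<omega>, q \<omega>) (iv \<omega>) j)) \<in> borel_measurable M \<and>
        (\<lambda>\<omega>. snd (set_root t (p \<omega>, q \<omega>) (iv \<omega>) j)) \<in> borel_measurable M"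
      using assms unfolding Node by (cases "j = i") (simp_all add: measurable_ivs_def)
  qed
qed

lemma measurable_ivs_advance:
  assumes x: "x \<in> borel_measurable M" and iv: "measurable_ivs M iv"
  shows "measurable_ivs M (\<lambda>\<omega>. advance t i (x \<omega>) (iv \<omega>))"
proof (cases "subtree_at i t")
  case Leaf
  then show ?thesis using iv by (simp add: advance_def)
next
  case (Node lt j rt)
  have p: "(\<lambda>\<omega>. fst (iv \<omega> i)) \<in> borel_measurable M" and q: "(\<lambda>\<omega>. snd (iv \<omega> i)) \<in> borel_measurable M"
    using iv by (auto simp: measurable_ivs_def)
  have "measurable_ivs M (\<lambda>\<omega>. set_root lt (fst (iv \<omega> i), x \<omega>) (set_root rt (x \<omega>, snd (iv \<omega> i)) (iv \<omega>)))"
    by (rule measurable_ivs_set_root[OF p x measurable_ivs_set_root[OF x q iv]])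
  then show ?thesis by (simp add: advance_def Node)
qed

lemma measurable_ivs_intervals:
  assumes Y: "\<And>i. (\<lambda>\<omega>. Y \<omega> i) \<in> borel_measurable M"
  shows "measurable_ivs M (\<lambda>\<omega>. intervals \<pi> (Y \<omega>) n)"
proof (induction n)
  case 0
  then show ?case by (simp add: measurable_ivs_def)
next
  case (Suc n)
  then show ?case unfolding intervals.simps by (rule measurable_ivs_advance[OF Y])
qed

lemma measurable_gain:
  assumes iv: "measurable_ivs M iv" and x: "x \<in> borel_measurable M"
  shows "(\<lambda>\<omega>. gain a b \<pi> i (iv \<omega>) (x \<omega>)) \<in> borel_measurable M"
proof -
  have p: "(\<lambda>\<omega>. fst (iv \<omega> i)) \<in> borel_measurable M" and q: "(\<lambda>\<omega>. snd (iv \<omega> i)) \<in> borel_measurable M"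
    using iv by (auto simp: measurable_ivs_def)
  have w: "(\<lambda>\<omega>. snd (iv \<omega> i) - fst (iv \<omega> i)) \<in> borel_measurable M"
    by (rule borel_measurable_diff[OF q p])
  have z: "(\<lambda>\<omega>. (x \<omega> - fst (iv \<omega> i)) / (snd (iv \<omega> i) - fst (iv \<omega> i))) \<in> borel_measurable M"
    by (rule borel_measurable_divide[OF borel_measurable_diff[OF x p] w])
  show ?thesis
    unfolding gain_def Let_def reward_def
    by (rule borel_measurable_divide[OF measurable_compose[OF z measurable_excess] w])
qed

definition valid_interval :: "real \<times> real \<Rightarrow> bool" where
  "valid_interval p \<longleftrightarrow> 0 \<le> fst p \<and> fst p < snd p \<and> snd p \<le> 1"

lemma gain_nonneg:
  assumes "optimal_windows a b" and "\<pi> \<in> Perms k" "1 \<le> i" "i \<le> k" and "valid_interval (iv i)"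
  shows "0 \<le> gain a b \<pi> i iv x"
  unfolding gain_def Let_def reward_def
  using excess_bounds(1)[OF node_window[OF assms(1-4)]] assms(5)
  by (auto simp: valid_interval_def intro!: divide_nonneg_pos)

lemma has_bochner_integral_gain:
  assumes "optimal_windows a b" and "\<pi> \<in> Perms k" "1 \<le> i" "i \<le> k" and "valid_interval (iv i)"
  shows "has_bochner_integral unif (gain a b \<pi> i iv) 1"
  unfolding gain_def[abs_def] Let_def
  using has_bochner_integral_reward[OF node_window[OF assms(1-4)]] assms(5)
  by (simp add: valid_interval_def)

lemma nn_integral_gain:
  assumes "optimal_windows a b" and "\<pi> \<in> Perms k" "1 \<le> i" "i \<le> k" and "valid_interval (iv i)"
  shows "(\<integral>\<^sup>+x. ennreal (gain a b \<pi> i iv x) \<partial>unif) = 1"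
  using has_bochner_integral_gain[of a b \<pi> k i iv, OF assms] gain_nonneg[of a b \<pi> k i iv, OF assms]
  by (subst nn_integral_eq_integral) (auto simp: has_bochner_integral_iff)

lemma AE_unit_interval: "AE \<omega> in stream_law. \<forall>t. 0 < X t \<omega> \<and> X t \<omega> < 1"
proof -
  have AE: "AE x::real in lborel. x \<noteq> 0 \<and> x \<noteq> 1" by (simp add: AE_lborel_singleton)
  have "AE x in unif. 0 < x \<and> x < 1"
  proof (rule AE_uniform_measureI)
    show "AE x::real in lborel. x \<in> {0..1} \<longrightarrow> 0 < x \<and> x < 1"
      using AE by eventually_elim auto
  qed simp
  then have "AE \<omega> in stream_space unif. stream_all (\<lambda>x. 0 < x \<and> x < 1) \<omega>"
    by (intro prob_space.AE_stream_all[OF prob_space_unif]) auto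
  then show ?thesis
    unfolding stream_law_def[symmetric] by eventually_elim (auto simp: X_def stream_all_def)
qed

definition accepted :: "(nat \<Rightarrow> real stream \<Rightarrow> enat) \<Rightarrow> real stream \<Rightarrow> nat \<Rightarrow> real" where
  "accepted \<tau> \<omega> i = X (the_enat (\<tau> i \<omega>)) \<omega>"

text \<open>The event that node \<open>i\<close> is the next one to be filled after \<open>n\<close> observations. It is determined by these
  observations, and for fixed \<open>n\<close> it excludes the same event for any other node. The condition
  \<open>1 \<le> \<tau> j \<omega>\<close> matters because \<open>X 0\<close> is an alias of the first observation.\<close>

definition awaiting :: "(nat \<Rightarrow> real stream \<Rightarrow> enat) \<Rightarrow> nat \<Rightarrow> nat \<Rightarrow> real stream set" where
  "awaiting \<tau> i n = {\<omega>. (\<forall>j\<in>{1..<i}. 1 \<le> \<tau> j \<omega> \<and> \<tau> j \<omega> \<le> enat n) \<and> \<not> \<tau> i \<omega> \<le> enat n}"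

text \<open>The gain that the observation \<open>x\<close> would bring for node \<open>i\<close>, whether or not the algorithm takes it. On
  the null set where the accepted values do not leave a proper interval, the payoff is 0.\<close>

definition payoff ::
  "(nat list \<Rightarrow> real) \<Rightarrow> (nat list \<Rightarrow> real) \<Rightarrow> nat list \<Rightarrow> (nat \<Rightarrow> real stream \<Rightarrow> enat) \<Rightarrow> nat \<Rightarrow>
    real stream \<Rightarrow> real \<Rightarrow> ennreal" where
  "payoff a b \<pi> \<tau> i \<omega> x = (let iv = intervals \<pi> (accepted \<tau> \<omega>) (i - 1) in
     if valid_interval (iv i) then ennreal (gain a b \<pi> i iv x) else 0)"

context
  fixes a b :: "nat list \<Rightarrow> real" and \<pi> :: "nat list" and k :: nat and \<tau> :: "nat \<Rightarrow> real stream \<Rightarrow> enat"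
  assumes opt: "optimal_windows a b" and \<pi>: "\<pi> \<in> Perms k" and k: "1 \<le> k" and OA: "\<tau> \<in> OA \<pi>"
begin

lemma OA_stopping: "1 \<le> i \<Longrightarrow> i \<le> k \<Longrightarrow> stopping_time nat_filtration (\<tau> i)"
proof -
  have "\<forall>i\<in>{1..length \<pi>}. stopping_time nat_filtration (\<tau> i)"
    using OA unfolding OA_def mem_Collect_eq by (rule conjunct1)
  then show "1 \<le> i \<Longrightarrow> i \<le> k \<Longrightarrow> stopping_time nat_filtration (\<tau> i)"
    using Perms_length[OF \<pi>] by simp
qed

lemma OA_measurable: "1 \<le> i \<Longrightarrow> i \<le> k \<Longrightarrow> \<tau> i \<in> measurable stream_law (count_space UNIV)"
  by (intro stopping_time_measurable OA_stopping)

lemma awaiting_sets: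
  assumes "1 \<le> i" "i \<le> k"
  shows "awaiting \<tau> i n \<in> sets stream_law"
proof -
  have *: "{\<omega>. P (\<tau> j \<omega>)} \<in> sets stream_law" if "1 \<le> j" "j \<le> k" for j and P :: "enat \<Rightarrow> bool"
    using measurable_sets[OF OA_measurable[OF that], of "Collect P"] by (simp add: vimage_def)
  have "awaiting \<tau> i n = (UNIV \<inter> (\<Inter>j\<in>{1..<i}. {\<omega>. 1 \<le> \<tau> j \<omega> \<and> \<tau> j \<omega> \<le> enat n})) \<inter> {\<omega>. \<not> \<tau> i \<omega> \<le> enat n}"
    by (auto simp: awaiting_def)
  moreover have "UNIV \<inter> (\<Inter>j\<in>{1..<i}. {\<omega>. 1 \<le> \<tau> j \<omega> \<and> \<tau> j \<omega> \<le> enat n}) \<in> sets stream_law"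
  proof (cases "{1..<i} = {}")
    case True
    then show ?thesis using sets.top[of stream_law] by simp
  next
    case False
    have "(\<Inter>j\<in>{1..<i}. {\<omega>. 1 \<le> \<tau> j \<omega> \<and> \<tau> j \<omega> \<le> enat n}) \<in> sets stream_law"
      by (rule sets.finite_INT) (use False assms in \<open>auto intro!: *\<close>)
    then show ?thesis by simp
  qed
  ultimately show ?thesis using *[OF assms] by auto
qed

lemma accepted_measurable: "1 \<le> i \<Longrightarrow> i \<le> k \<Longrightarrow> (\<lambda>\<omega>. accepted \<tau> \<omega> i) \<in> borel_measurable stream_law"
  unfolding accepted_def
  by (intro measurable_X_at measurable_compose[OF OA_measurable]) auto

lemma payoff_measurable:
  assumes "1 \<le> i" "i \<le> k"
  shows "(\<lambda>\<omega>. payoff a b \<pi> \<tau> i \<omega> (\<omega> !! n)) \<in> borel_measurable stream_law"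
proof -
  let ?Y = "\<lambda>\<omega> j. if 1 \<le> j \<and> j \<le> k then accepted \<tau> \<omega> j else 0"
  have Y: "(\<lambda>\<omega>. ?Y \<omega> j) \<in> borel_measurable stream_law" for j
    using accepted_measurable by (cases "1 \<le> j \<and> j \<le> k") (auto simp del: One_nat_def)
  have eq: "intervals \<pi> (accepted \<tau> \<omega>) (i - 1) = intervals \<pi> (?Y \<omega>) (i - 1)" for \<omega>
    using assms by (intro intervals_cong) auto
  have iv: "measurable_ivs stream_law (\<lambda>\<omega>. intervals \<pi> (?Y \<omega>) (i - 1))"
    by (rule measurable_ivs_intervals[where Y="?Y", OF Y])
  note [measurable] = iv[unfolded measurable_ivs_def, rule_format, THEN conjunct1]
    iv[unfolded measurable_ivs_def, rule_format, THEN conjunct2]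
  note [measurable] = measurable_gain[OF iv measurable_snth_stream_law[of n], of a b \<pi> i]
  show ?thesis
    unfolding payoff_def Let_def eq valid_interval_def by measurable
qed

text \<open>On the event that node \<open>i\<close> is awaited, resampling the observation of round \<open>n\<close> changes neither this
  event nor the intervals, so only the gain of the fresh observation is integrated, and its mean is 1.\<close>

lemma expected_payoff:
  assumes i: "1 \<le> i" "i \<le> k"
  shows "(\<integral>\<^sup>+\<omega>. indicator (awaiting \<tau> i n) \<omega> * payoff a b \<pi> \<tau> i \<omega> (\<omega> !! n) \<partial>stream_law)
    \<le> (\<integral>\<^sup>+\<omega>. indicator (awaiting \<tau> i n) \<omega> \<partial>stream_law)"
proof -
  let ?f = "\<lambda>\<omega>. indicator (awaiting \<tau> i n) \<omega> * payoff a b \<pi> \<tau> i \<omega> (\<omega> !! n)"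
  have m: "?f \<in> borel_measurable stream_law"
    by (intro borel_measurable_times_ennreal payoff_measurable i borel_measurable_indicator awaiting_sets)
  have "(\<integral>\<^sup>+x. ?f (resample n x \<omega>) \<partial>unif) \<le> indicator (awaiting \<tau> i n) \<omega>" for \<omega>
  proof (cases "\<omega> \<in> awaiting \<tau> i n")
    case False
    have "\<not> resample n x \<omega> \<in> awaiting \<tau> i n" for x
    proof
      assume r: "resample n x \<omega> \<in> awaiting \<tau> i n"
      have "1 \<le> \<tau> j \<omega> \<and> \<tau> j \<omega> \<le> enat n" if "j \<in> {1..<i}" for j
      proof -
        have st: "stopping_time nat_filtration (\<tau> j)" using that i by (intro OA_stopping) auto
        have le: "\<tau> j \<omega> \<le> enat n"
          using r that stopping_time_resample[OF st order_refl, of n x \<omega>] by (auto simp: awaiting_def)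
        have "1 \<le> \<tau> j (resample n x \<omega>)" using r that unfolding awaiting_def by blast
        then show ?thesis
          using le unfolding stopping_time_resample_eq[OF st le] by blast
      qed
      moreover have "\<not> \<tau> i \<omega> \<le> enat n"
        using r stopping_time_resample[OF OA_stopping[OF i] order_refl, of n x \<omega>] by (auto simp: awaiting_def)
      ultimately show False using False by (auto simp: awaiting_def)
    qed
    then show ?thesis by simp
  next
    case True
    have acc: "accepted \<tau> (resample n x \<omega>) j = accepted \<tau> \<omega> j" if "1 \<le> j" "j \<le> i - 1" for x j
    proof -
      have st: "stopping_time nat_filtration (\<tau> j)" using that i by (intro OA_stopping) auto
      have le: "1 \<le> \<tau> j \<omega>" "\<tau> j \<omega> \<le> enat n" using True that by (auto simp: awaiting_def)
      then obtain t where t: "\<tau> j \<omega> = enat t" "1 \<le> t" "t \<le> n"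
        by (cases "\<tau> j \<omega>") (auto simp: one_enat_def)
      then have "t - 1 \<noteq> n" by simp
      then show ?thesis
        unfolding accepted_def stopping_time_resample_eq[OF st le(2)] t(1) by (simp add: X_def snth_resample)
    qed
    let ?iv = "intervals \<pi> (accepted \<tau> \<omega>) (i - 1)"
    have iv: "intervals \<pi> (accepted \<tau> (resample n x \<omega>)) (i - 1) = ?iv" for x
      by (rule intervals_cong) (use acc in auto)
    have "(\<integral>\<^sup>+x. ?f (resample n x \<omega>) \<partial>unif) \<le> (\<integral>\<^sup>+x. (if valid_interval (?iv i) then ennreal (gain a b \<pi> i ?iv x) else 0) \<partial>unif)"
    proof (rule nn_integral_mono)
      fix x :: real
      have "payoff a b \<pi> \<tau> i (resample n x \<omega>) x = (if valid_interval (?iv i) then ennreal (gain a b \<pi> i ?iv x) else 0)"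
        unfolding payoff_def Let_def iv ..
      then show "?f (resample n x \<omega>) \<le> (if valid_interval (?iv i) then ennreal (gain a b \<pi> i ?iv x) else 0)"
        by (simp add: snth_resample indicator_def)
    qed
    also have "\<dots> \<le> 1"
      using nn_integral_gain[of a b \<pi> k i ?iv, OF opt \<pi> i] by (cases "valid_interval (?iv i)") auto
    finally show ?thesis using True by simp
  qed
  then show ?thesis
    unfolding nn_integral_resample[OF m, of n] by (intro nn_integral_mono) auto
qed

definition round_payoff :: "nat \<Rightarrow> real stream \<Rightarrow> ennreal" where
  "round_payoff n \<omega> = (\<Sum>i = 1..k. indicator (awaiting \<tau> i n) \<omega> * payoff a b \<pi> \<tau> i \<omega> (\<omega> !! n))"

lemma round_payoff_measurable [measurable]: "round_payoff n \<in> borel_measurable stream_law"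
  unfolding round_payoff_def[abs_def]
  by (intro borel_measurable_sum borel_measurable_times_ennreal payoff_measurable borel_measurable_indicator awaiting_sets) auto

lemma OA_AE:
  "AE \<omega> in stream_law. (\<forall>i\<in>{1..k}. 1 \<le> \<tau> i \<omega> \<and> \<tau> i \<omega> < \<infinity>) \<and>
      (\<forall>i\<in>{1..k}. \<forall>j\<in>{1..k}. i < j \<longrightarrow> \<tau> i \<omega> < \<tau> j \<omega>) \<and>
      (\<forall>i\<in>{1..k}. \<forall>j\<in>{1..k}. entry \<pi> i < entry \<pi> j \<longleftrightarrow> accepted \<tau> \<omega> i < accepted \<tau> \<omega> j)"
  using OA unfolding OA_def mem_Collect_eq Perms_length[OF \<pi>] accepted_def by (rule conjunct2)

text \<open>At most one node is awaited in each round, and none after the algorithm has finished.\<close>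

lemma expected_round_payoff:
  "(\<integral>\<^sup>+\<omega>. round_payoff n \<omega> \<partial>stream_law) \<le> emeasure stream_law {\<omega>. enat n < \<tau> k \<omega>}"
proof -
  have meas: "{\<omega>. enat n < \<tau> k \<omega>} \<in> sets stream_law"
    using measurable_sets[OF OA_measurable[OF k order_refl], of "{enat n<..}"] by (simp add: vimage_def)
  have "(\<integral>\<^sup>+\<omega>. round_payoff n \<omega> \<partial>stream_law) =
      (\<Sum>i = 1..k. \<integral>\<^sup>+\<omega>. indicator (awaiting \<tau> i n) \<omega> * payoff a b \<pi> \<tau> i \<omega> (\<omega> !! n) \<partial>stream_law)"
    unfolding round_payoff_def
    by (intro nn_integral_sum borel_measurable_times_ennreal payoff_measurable borel_measurable_indicator awaiting_sets) auto
  also have "\<dots> \<le> (\<Sum>i = 1..k. \<integral>\<^sup>+\<omega>. indicator (awaiting \<tau> i n) \<omega> \<partial>stream_law)"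
    by (intro sum_mono expected_payoff) auto
  also have "\<dots> = (\<integral>\<^sup>+\<omega>. (\<Sum>i = 1..k. indicator (awaiting \<tau> i n) \<omega>) \<partial>stream_law)"
    by (intro nn_integral_sum[symmetric] borel_measurable_indicator awaiting_sets) auto
  also have "\<dots> \<le> (\<integral>\<^sup>+\<omega>. indicator {\<omega>. enat n < \<tau> k \<omega>} \<omega> \<partial>stream_law)"
  proof (rule nn_integral_mono_AE)
    have disj: "disjoint_family_on (\<lambda>i. awaiting \<tau> i n) {1..k}"
      unfolding disjoint_family_on_def
    proof (intro ballI impI)
      fix i j assume ij: "i \<in> {1..k}" "j \<in> {1..k}" "i \<noteq> j"
      show "awaiting \<tau> i n \<inter> awaiting \<tau> j n = {}"
        using ij by (cases i j rule: linorder_cases) (auto simp: awaiting_def)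
    qed
    show "AE \<omega> in stream_law. (\<Sum>i = 1..k. indicator (awaiting \<tau> i n) \<omega>) \<le> (indicator {\<omega>. enat n < \<tau> k \<omega>} \<omega> :: ennreal)"
      using OA_AE
    proof eventually_elim
      case (elim \<omega>)
      have "enat n < \<tau> k \<omega>" if "i \<in> {1..k}" "\<omega> \<in> awaiting \<tau> i n" for i
      proof -
        have "enat n < \<tau> i \<omega>" using that by (auto simp: awaiting_def)
        also have "\<tau> i \<omega> \<le> \<tau> k \<omega>"
          using elim that(1) k by (cases "i = k") (auto intro: less_imp_le)
        finally show ?thesis .
      qed
      then have "(\<Union>i\<in>{1..k}. awaiting \<tau> i n) \<inter> {\<omega>} \<subseteq> {\<omega>. enat n < \<tau> k \<omega>}" by auto
      then have "indicator (\<Union>i\<in>{1..k}. awaiting \<tau> i n) \<omega> \<le> (indicator {\<omega>. enat n < \<tau> k \<omega>} \<omega> :: ennreal)"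
        by (auto simp: indicator_def split: if_splits)
      then show ?case using indicator_UN_disjoint[OF _ disj, of \<omega>] by (metis finite_atLeastAtMost)
    qed
  qed
  also have "\<dots> = emeasure stream_law {\<omega>. enat n < \<tau> k \<omega>}"
    using meas by simp
  finally show ?thesis .
qed

text \<open>The gain of the value accepted at time \<open>\<tau> i\<close> is one of the payoffs of the round with index
  \<open>\<tau> i - 1\<close>, in which node \<open>i\<close> is awaited.\<close>

lemma val_le_round_payoffs:
  "AE \<omega> in stream_law. \<forall>N. \<tau> k \<omega> \<le> enat N \<longrightarrow> ennreal (val \<pi>) \<le> (\<Sum>n<N. round_payoff n \<omega>)"
  using OA_AE AE_unit_interval
proof eventually_elim
  case (elim \<omega>)
  let ?y = "accepted \<tau> \<omega>"
  let ?iv = "\<lambda>i. intervals \<pi> ?y (i - 1)"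
  have fin: "1 \<le> \<tau> i \<omega>" "\<tau> i \<omega> < \<infinity>" if "1 \<le> i" "i \<le> k" for i using elim that by auto
  have y01: "0 < ?y i \<and> ?y i < 1" for i using elim by (simp add: accepted_def)
  have ord: "?y i < ?y j" if "1 \<le> i" "i \<le> k" "1 \<le> j" "j \<le> k" "entry \<pi> i < entry \<pi> j" for i j
    using elim that by auto
  have valid: "valid_interval (?iv i i)" if i: "1 \<le> i" "i \<le> k" for i
  proof -
    obtain n where n: "i = Suc n" "n < k" using i by (cases i) auto
    note T = search_tree_heap_bst[OF Perms_distinct[OF \<pi>]]
    have "placed n (intervals \<pi> ?y n) ?y 0 1 (search_tree \<pi>)"
      by (rule placed_intervals(1)[OF \<pi> _ _ n(2)]) (use y01 ord in auto)
    from placed_bounds[OF T(2) _ this] show ?thesis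
      using T(1) Perms_length[OF \<pi>] n by (auto simp: valid_interval_def)
  qed
  show ?case
  proof (intro allI impI)
    fix N assume N: "\<tau> k \<omega> \<le> enat N"
    have "ennreal (val \<pi>) \<le> ennreal (\<Sum>i = 1..k. gain a b \<pi> i (?iv i) (?y i))"
      by (intro ennreal_leI val_le_gains[OF opt \<pi>]) (use y01 ord in auto)
    also have "\<dots> = (\<Sum>i = 1..k. ennreal (gain a b \<pi> i (?iv i) (?y i)))"
      by (intro sum_ennreal[symmetric]) (use gain_nonneg[OF opt \<pi>] valid in auto)
    also have "\<dots> \<le> (\<Sum>i = 1..k. \<Sum>n<N. indicator (awaiting \<tau> i n) \<omega> * payoff a b \<pi> \<tau> i \<omega> (\<omega> !! n))"
    proof (rule sum_mono)
      fix i assume "i \<in> {1..k}"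
      then have i: "1 \<le> i" "i \<le> k" by auto
      \<comment> \<open>\<open>t\<close> is the index of the round in which node \<open>i\<close> is filled: \<open>X (Suc t) \<omega> = \<omega> !! t\<close>\<close>
      obtain t where t: "\<tau> i \<omega> = enat (Suc t)"
        using fin[OF i] by (cases "\<tau> i \<omega>") (auto simp: one_enat_def dest!: Suc_le_D)
      have "\<tau> i \<omega> \<le> \<tau> k \<omega>" using elim i k by (cases "i = k") (auto intro: less_imp_le)
      with N have tN: "t < N" using t by (metis Suc_le_lessD enat_ord_simps(1) order_trans)
      have "1 \<le> \<tau> j \<omega> \<and> \<tau> j \<omega> \<le> enat t" if "j \<in> {1..<i}" for j
      proof -
        have "\<tau> j \<omega> < \<tau> i \<omega>" using elim that i by auto
        then show ?thesis using fin[of j] that i t by (cases "\<tau> j \<omega>") auto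
      qed
      then have "\<omega> \<in> awaiting \<tau> i t" using t by (auto simp: awaiting_def)
      moreover have "\<omega> !! t = ?y i" by (simp add: accepted_def t X_def)
      ultimately have "ennreal (gain a b \<pi> i (?iv i) (?y i)) =
          indicator (awaiting \<tau> i t) \<omega> * payoff a b \<pi> \<tau> i \<omega> (\<omega> !! t)"
        using valid[OF i] by (simp add: payoff_def Let_def)
      also have "\<dots> \<le> (\<Sum>n<N. indicator (awaiting \<tau> i n) \<omega> * payoff a b \<pi> \<tau> i \<omega> (\<omega> !! n))"
        using tN by (intro member_le_sum) auto
      finally show "ennreal (gain a b \<pi> i (?iv i) (?y i)) \<le> \<dots>" .
    qed
    also have "\<dots> = (\<Sum>n<N. round_payoff n \<omega>)"
      unfolding round_payoff_def by (rule sum.swap)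
    finally show "ennreal (val \<pi>) \<le> (\<Sum>n<N. round_payoff n \<omega>)" .
  qed
qed

theorem val_le_expected_time: "ennreal (val \<pi>) \<le> expected_time \<pi> \<tau>"
proof -
  interpret prob_space stream_law by (rule prob_space_stream_law)
  have "ennreal (val \<pi>) = (\<integral>\<^sup>+\<omega>. ennreal (val \<pi>) \<partial>stream_law)"
    by (simp add: emeasure_space_1[simplified])
  also have "\<dots> \<le> (\<integral>\<^sup>+\<omega>. (\<Sum>n. round_payoff n \<omega>) \<partial>stream_law)"
  proof (rule nn_integral_mono_AE)
    show "AE \<omega> in stream_law. ennreal (val \<pi>) \<le> (\<Sum>n. round_payoff n \<omega>)"
      using val_le_round_payoffs OA_AE
    proof eventually_elim
      case (elim \<omega>)
      then have "\<tau> k \<omega> < \<infinity>" using k by auto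
      then obtain N where "\<tau> k \<omega> = enat N" by (cases "\<tau> k \<omega>") auto
      then have "ennreal (val \<pi>) \<le> (\<Sum>n<N. round_payoff n \<omega>)" using elim by auto
      also have "\<dots> \<le> (\<Sum>n. round_payoff n \<omega>)" by (rule sum_le_suminf) auto
      finally show ?case .
    qed
  qed
  also have "\<dots> = (\<Sum>n. \<integral>\<^sup>+\<omega>. round_payoff n \<omega> \<partial>stream_law)"
    by (rule nn_integral_suminf) simp
  also have "\<dots> \<le> (\<Sum>n. emeasure stream_law {\<omega>. enat n < \<tau> k \<omega>})"
    by (intro suminf_le expected_round_payoff) auto
  also have "\<dots> = expected_time \<pi> \<tau>"
    unfolding expected_time_def final_time_def Perms_length[OF \<pi>]
    using nn_integral_enat_function[OF OA_measurable[OF k order_refl]] by simp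
  finally show ?thesis .
qed

text \<open>The payoffs of the first \<open>N\<close> rounds have expected total at most \<open>N\<close>, and they add up to \<open>val \<pi>\<close> if the
  algorithm finishes by time \<open>N\<close>; this is Markov's inequality.\<close>

theorem early_completion_bound:
  assumes \<delta>: "\<delta> \<in> {0<..<1}"
  shows "measure stream_law {\<omega> \<in> space stream_law.
      ereal_of_enat (final_time \<pi> \<tau> \<omega>) \<le> ereal ((1 - \<delta>) * val \<pi>)} \<le> 1 - \<delta>"
proof -
  interpret prob_space stream_law by (rule prob_space_stream_law)
  have "\<pi> \<noteq> []" using Perms_length[OF \<pi>] k by (cases \<pi>) auto
  then have v: "0 < val \<pi>" by (rule val_pos)
  \<comment> \<open>\<open>\<tau> k\<close> is integer-valued, so it is compared with the integer part of the bound\<close>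
  define N where "N = nat \<lfloor>(1 - \<delta>) * val \<pi>\<rfloor>"
  have r: "0 \<le> (1 - \<delta>) * val \<pi>" using v \<delta> by simp
  have N: "real m \<le> (1 - \<delta>) * val \<pi> \<longleftrightarrow> m \<le> N" for m
    unfolding N_def using r by (simp add: le_nat_iff le_floor_iff)
  define A where "A = {\<omega>. \<tau> k \<omega> \<le> enat N}"
  have A: "A \<in> sets stream_law"
    unfolding A_def by (rule stopping_time_le(2)[OF OA_stopping[OF k order_refl]])
  have eq: "{\<omega> \<in> space stream_law. ereal_of_enat (final_time \<pi> \<tau> \<omega>) \<le> ereal ((1 - \<delta>) * val \<pi>)} = A"
  proof (intro set_eqI)
    fix \<omega>
    show "\<omega> \<in> {\<omega> \<in> space stream_law. ereal_of_enat (final_time \<pi> \<tau> \<omega>) \<le> ereal ((1 - \<delta>) * val \<pi>)} \<longleftrightarrow> \<omega> \<in> A"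
      unfolding A_def final_time_def Perms_length[OF \<pi>] by (cases "\<tau> k \<omega>") (auto simp: N)
  qed
  have "ennreal (val \<pi> * measure stream_law A) = ennreal (val \<pi>) * emeasure stream_law A"
    using v by (simp add: emeasure_eq_measure ennreal_mult)
  also have "\<dots> = (\<integral>\<^sup>+\<omega>. ennreal (val \<pi>) * indicator A \<omega> \<partial>stream_law)"
    using A by (simp add: nn_integral_cmult_indicator)
  also have "\<dots> \<le> (\<integral>\<^sup>+\<omega>. (\<Sum>n<N. round_payoff n \<omega>) \<partial>stream_law)"
  proof (rule nn_integral_mono_AE)
    show "AE \<omega> in stream_law. ennreal (val \<pi>) * indicator A \<omega> \<le> (\<Sum>n<N. round_payoff n \<omega>)"
      using val_le_round_payoffs by eventually_elim (auto simp: A_def indicator_def)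
  qed
  also have "\<dots> = (\<Sum>n<N. \<integral>\<^sup>+\<omega>. round_payoff n \<omega> \<partial>stream_law)"
    by (rule nn_integral_sum) simp
  also have "\<dots> \<le> (\<Sum>n<N. 1)"
    by (intro sum_mono order_trans[OF expected_round_payoff] measure_le_1 emeasure_le_1)
  also have "\<dots> = ennreal (real N)" by (simp add: ennreal_of_nat_eq_real_of_nat)
  finally have "val \<pi> * measure stream_law A \<le> real N"
    by (subst (asm) ennreal_le_iff) auto
  also have "\<dots> \<le> (1 - \<delta>) * val \<pi>" using N[of N] by simp
  finally show ?thesis unfolding eq using v by (simp add: mult.commute[of "val \<pi>"])
qed

end

section \<open>The canonical algorithm\<close>

lemma first_hit_le_iff: "first_hit s I \<omega> \<le> enat t \<longleftrightarrow> (\<exists>r\<le>t. s < enat r \<and> X r \<omega> \<in> I)"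
proof
  let ?A = "{enat t | t. s < enat t \<and> X t \<omega> \<in> I}"
  assume le: "first_hit s I \<omega> \<le> enat t"
  then have ne: "?A \<noteq> {}" by (auto simp: first_hit_def Inf_enat_def split: if_splits)
  then obtain z where "z \<in> ?A" by blast
  then have "(LEAST x. x \<in> ?A) \<in> ?A" by (rule LeastI)
  then have "first_hit s I \<omega> \<in> ?A" using ne by (simp only: first_hit_def Inf_enat_def if_False)
  then show "\<exists>r\<le>t. s < enat r \<and> X r \<omega> \<in> I" using le by auto
next
  assume "\<exists>r\<le>t. s < enat r \<and> X r \<omega> \<in> I"
  then obtain r where r: "r \<le> t" "s < enat r" "X r \<omega> \<in> I" by blast
  then have "first_hit s I \<omega> \<le> enat r" unfolding first_hit_def by (intro Inf_lower) auto
  then show "first_hit s I \<omega> \<le> enat t" using r(1) by (meson enat_ord_simps(1) order_trans)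
qed

lemma enat_eqI:
  fixes p q :: enat
  assumes "\<And>t. p \<le> enat t \<longleftrightarrow> q \<le> enat t"
  shows "p = q"
proof (rule antisym)
  show "p \<le> q" using assms by (cases q) auto
  show "q \<le> p" using assms by (cases p) auto
qed

lemma first_hit_enatD:
  assumes "first_hit s I \<omega> = enat r"
  shows "s < enat r" and "X r \<omega> \<in> I"
proof -
  obtain r' where r': "r' \<le> r" "s < enat r'" "X r' \<omega> \<in> I"
    using first_hit_le_iff[of s I \<omega> r] assms by auto
  then have "first_hit s I \<omega> \<le> enat r'" using first_hit_le_iff by blast
  then have "r' = r" using r'(1) assms by simp
  then show "s < enat r" "X r \<omega> \<in> I" using r' by auto
qed

lemma first_hit_pos:
  assumes "first_hit s I \<omega> = enat r"
  shows "1 \<le> r"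
proof (rule ccontr)
  assume "\<not> 1 \<le> r"
  then have "enat r = 0" by (simp add: zero_enat_def)
  with first_hit_enatD(1)[OF assms] show False by (metis not_less_zero)
qed

lemma first_hit_infinity [simp]: "first_hit \<infinity> I \<omega> = \<infinity>"
  using first_hit_enatD(1)[of \<infinity> I \<omega>] by (cases "first_hit \<infinity> I \<omega>") auto

lemma first_hit_gt: "s < \<infinity> \<Longrightarrow> s < first_hit s I \<omega>"
  using first_hit_enatD(1)[of s I \<omega>] by (cases "first_hit s I \<omega>") auto

lemma first_hit_ge: "s \<le> first_hit s I \<omega>"
  using first_hit_gt[of s I \<omega>] by (cases s) (auto intro: less_imp_le)

lemma eSuc_le_enat_iff: "eSuc z \<le> enat t \<longleftrightarrow> (\<exists>t'. t = Suc t' \<and> z \<le> enat t')"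
  by (cases t; cases z) (auto simp: eSuc_enat zero_enat_def)

lemma X_Stream: "1 \<le> r \<Longrightarrow> X (Suc r) (x ## \<omega>) = X r \<omega>"
  by (cases r) (simp_all add: X_def)

lemma first_hit_Stream: "first_hit (eSuc s) I (x ## \<omega>) = eSuc (first_hit s I \<omega>)"
proof (rule enat_eqI)
  fix t
  have "(\<exists>r\<le>t. eSuc s < enat r \<and> X r (x ## \<omega>) \<in> I) \<longleftrightarrow>
      (\<exists>t'. t = Suc t' \<and> (\<exists>r\<le>t'. s < enat r \<and> X r \<omega> \<in> I))" (is "?L \<longleftrightarrow> ?R")
  proof
    assume ?L
    then obtain r where r: "r \<le> t" "eSuc s < enat r" "X r (x ## \<omega>) \<in> I" by blast
    then obtain r' where r': "r = Suc r'" by (cases r) (auto simp: zero_enat_def[symmetric])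
    have s: "s < enat r'" using r(2) unfolding r' eSuc_enat[symmetric] by simp
    then have "1 \<le> r'" by (cases r') (simp_all flip: zero_enat_def)
    then have "X r' \<omega> \<in> I" using r(3) by (simp add: r' X_Stream del: One_nat_def)
    then show ?R using r(1) s r' by (cases t) auto
  next
    assume ?R
    then obtain t' r where r: "t = Suc t'" "r \<le> t'" "s < enat r" "X r \<omega> \<in> I" by blast
    then have "1 \<le> r" by (cases r) (simp_all flip: zero_enat_def)
    then have "X (Suc r) (x ## \<omega>) \<in> I" using r(4) by (simp add: X_Stream del: One_nat_def)
    moreover have "eSuc s < enat (Suc r)" using r(3) unfolding eSuc_enat[symmetric] by simp
    ultimately show ?L using r by (intro exI[of _ "Suc r"]) auto
  qed
  then show "first_hit (eSuc s) I (x ## \<omega>) \<le> enat t \<longleftrightarrow> eSuc (first_hit s I \<omega>) \<le> enat t"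
    by (simp only: first_hit_le_iff eSuc_le_enat_iff)
qed

lemma first_hit_0_Stream:
  "first_hit 0 I (x ## \<omega>) = (if x \<in> I then 1 else eSuc (first_hit 0 I \<omega>))"
proof (cases "x \<in> I")
  case True
  then have "first_hit 0 I (x ## \<omega>) \<le> enat 1"
    by (subst first_hit_le_iff) (auto intro!: exI[of _ 1] simp: X_def zero_enat_def)
  moreover have "0 < first_hit 0 I (x ## \<omega>)" by (rule first_hit_gt) simp
  ultimately show ?thesis using True
    by (cases "first_hit 0 I (x ## \<omega>)") (auto simp: zero_enat_def one_enat_def)
next
  case False
  have "first_hit 0 I (x ## \<omega>) = first_hit (eSuc 0) I (x ## \<omega>)"
  proof (rule enat_eqI)
    fix t
    have "0 < enat r \<and> X r (x ## \<omega>) \<in> I \<longleftrightarrow> eSuc 0 < enat r \<and> X r (x ## \<omega>) \<in> I" for r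
    proof (cases r)
      case (Suc r')
      then show ?thesis using False by (cases r') (auto simp: X_def zero_enat_def eSuc_enat)
    qed (simp add: zero_enat_def eSuc_enat)
    then show "first_hit 0 I (x ## \<omega>) \<le> enat t \<longleftrightarrow> first_hit (eSuc 0) I (x ## \<omega>) \<le> enat t"
      by (simp only: first_hit_le_iff)
  qed
  then show ?thesis using False by (simp only: first_hit_Stream if_False)
qed

definition window :: "(nat list \<Rightarrow> real) \<Rightarrow> (nat list \<Rightarrow> real) \<Rightarrow> nat list \<Rightarrow> nat \<Rightarrow> (nat \<Rightarrow> real \<times> real) \<Rightarrow> real set" where
  "window a b \<pi> i iv = (let l = fst (iv i); u = snd (iv i); \<sigma> = subtree_perm \<pi> i in
     {l + (u - l) * a \<sigma> <..< l + (u - l) * b \<sigma>})"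

definition hunt ::
  "(nat list \<Rightarrow> real) \<Rightarrow> (nat list \<Rightarrow> real) \<Rightarrow> nat list \<Rightarrow> nat \<Rightarrow> enat \<times> (nat \<Rightarrow> real \<times> real) \<Rightarrow> real stream \<Rightarrow>
    enat \<times> (nat \<Rightarrow> real \<times> real)" where
  "hunt a b \<pi> i p \<omega> = (let \<tau> = first_hit (fst p) (window a b \<pi> i (snd p)) \<omega> in
     (\<tau>, advance (search_tree \<pi>) i (X (the_enat \<tau>) \<omega>) (snd p)))"

text \<open>The canonical algorithm started on a fresh stream with \<open>n\<close> nodes already processed and the intervals
  \<open>iv\<close>. The initial state has to be general since the analysis looks at the first observation and then
  continues from the state it leads to.\<close>

primrec run ::
  "(nat list \<Rightarrow> real) \<Rightarrow> (nat list \<Rightarrow> real) \<Rightarrow> nat list \<Rightarrow> nat \<Rightarrow> (nat \<Rightarrow> real \<times> real) \<Rightarrow> nat \<Rightarrow> real stream \<Rightarrow>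
    enat \<times> (nat \<Rightarrow> real \<times> real)" where
  "run a b \<pi> n iv 0 \<omega> = (0, iv)"
| "run a b \<pi> n iv (Suc m) \<omega> = hunt a b \<pi> (n + Suc m) (run a b \<pi> n iv m \<omega>) \<omega>"

lemma canonical_state_run: "canonical_state a b \<pi> \<omega> n = run a b \<pi> 0 (\<lambda>_. (0, 1)) n \<omega>"
proof (induction n)
  case (Suc n)
  obtain t iv where p: "run a b \<pi> 0 (\<lambda>_. (0, 1)) n \<omega> = (t, iv)" by fastforce
  obtain l u where lu: "iv (Suc n) = (l, u)" by fastforce
  show ?case
    unfolding canonical_state.simps Suc.IH p run.simps
    by (cases "subtree_at (Suc n) (search_tree \<pi>)") (simp_all add: Let_def lu hunt_def window_def advance_def)
qed simp

text \<open>The relation between the states of two runs, the second of which sees the stream without its first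
  observation. After an infinite waiting time the intervals are meaningless and need not agree.\<close>

definition delayed :: "enat \<times> 'a \<Rightarrow> enat \<times> 'a \<Rightarrow> bool" where
  "delayed p q \<longleftrightarrow> fst p = eSuc (fst q) \<and> (fst q \<noteq> \<infinity> \<longrightarrow> snd p = snd q)"

lemma delayed_hunt:
  assumes "delayed p q"
  shows "delayed (hunt a b \<pi> i p (x ## \<omega>)) (hunt a b \<pi> i q \<omega>)"
proof (cases "fst q")
  case infinity
  then show ?thesis using assms by (auto simp: delayed_def hunt_def Let_def)
next
  case (enat s)
  then have p: "fst p = eSuc (fst q)" "snd p = snd q" using assms by (auto simp: delayed_def)
  let ?I = "window a b \<pi> i (snd q)"
  have "X (the_enat (eSuc (first_hit (fst q) ?I \<omega>))) (x ## \<omega>) = X (the_enat (first_hit (fst q) ?I \<omega>)) \<omega>"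
    if fin: "first_hit (fst q) ?I \<omega> \<noteq> \<infinity>"
  proof -
    from fin obtain r where r: "first_hit (fst q) ?I \<omega> = enat r" by auto
    then have "1 \<le> r" by (rule first_hit_pos)
    then show ?thesis unfolding r by (simp add: eSuc_enat X_Stream del: One_nat_def)
  qed
  then show ?thesis unfolding delayed_def hunt_def Let_def p first_hit_Stream by simp
qed

lemma run_reject:
  assumes "x \<notin> window a b \<pi> (Suc n) iv"
  shows "delayed (run a b \<pi> n iv (Suc m) (x ## \<omega>)) (run a b \<pi> n iv (Suc m) \<omega>)"
proof (induction m)
  case 0
  let ?I = "window a b \<pi> (Suc n) iv"
  have "X (the_enat (eSuc (first_hit 0 ?I \<omega>))) (x ## \<omega>) = X (the_enat (first_hit 0 ?I \<omega>)) \<omega>"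
    if fin: "first_hit 0 ?I \<omega> \<noteq> \<infinity>"
  proof -
    from fin obtain r where r: "first_hit 0 ?I \<omega> = enat r" by auto
    then have "1 \<le> r" by (rule first_hit_pos)
    then show ?thesis unfolding r by (simp add: eSuc_enat X_Stream del: One_nat_def)
  qed
  then show ?case using assms by (simp add: delayed_def hunt_def Let_def first_hit_0_Stream)
next
  case (Suc m)
  then show ?case unfolding run.simps(2)[of _ _ _ _ _ "Suc m"] by (rule delayed_hunt)
qed

lemma run_accept:
  assumes "x \<in> window a b \<pi> (Suc n) iv"
  shows "delayed (run a b \<pi> n iv (Suc m) (x ## \<omega>))
    (run a b \<pi> (Suc n) (advance (search_tree \<pi>) (Suc n) x iv) m \<omega>)"
proof (induction m)
  case 0
  have h: "first_hit 0 (window a b \<pi> (Suc n) iv) (x ## \<omega>) = 1"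
    using assms by (simp only: first_hit_0_Stream if_True)
  have "the_enat 1 = 1" by (simp add: one_enat_def)
  then show ?case
    by (simp add: delayed_def hunt_def Let_def h X_def flip: one_eSuc)
next
  case (Suc m)
  have "Suc n + Suc m = n + Suc (Suc m)" by simp
  then show ?case
    using delayed_hunt[OF Suc, of a b \<pi> "n + Suc (Suc m)"]
    unfolding run.simps(2)[of _ _ _ _ _ "Suc m"] run.simps(2)[of _ _ _ "Suc n"] by simp
qed

lemma measurable_first_hit:
  assumes s: "s \<in> measurable stream_law (count_space UNIV)"
    and l: "l \<in> borel_measurable stream_law" and u: "u \<in> borel_measurable stream_law"
  shows "(\<lambda>\<omega>. first_hit (s \<omega>) {l \<omega> <..< u \<omega>} \<omega>) \<in> measurable stream_law (count_space UNIV)"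
proof (rule measurable_enatI)
  fix t
  have "{\<omega>. s \<omega> < enat r} \<in> sets stream_law" for r
    using measurable_sets[OF s, of "{..<enat r}"] by (simp add: vimage_def)
  moreover have "{\<omega>. l \<omega> < X r \<omega> \<and> X r \<omega> < u \<omega>} \<in> sets stream_law" for r
  proof -
    note [measurable] = l u
    have "{\<omega> \<in> space stream_law. l \<omega> < X r \<omega> \<and> X r \<omega> < u \<omega>} \<in> sets stream_law" by measurable
    then show ?thesis by simp
  qed
  ultimately have "(\<Union>r\<in>{..t}. {\<omega>. s \<omega> < enat r} \<inter> {\<omega>. l \<omega> < X r \<omega> \<and> X r \<omega> < u \<omega>}) \<in> sets stream_law"
    by (intro sets.finite_UN sets.Int) auto
  moreover have "{\<omega>. first_hit (s \<omega>) {l \<omega> <..< u \<omega>} \<omega> \<le> enat t} =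
      (\<Union>r\<in>{..t}. {\<omega>. s \<omega> < enat r} \<inter> {\<omega>. l \<omega> < X r \<omega> \<and> X r \<omega> < u \<omega>})"
    by (auto simp: first_hit_le_iff)
  ultimately show "{\<omega>. first_hit (s \<omega>) {l \<omega> <..< u \<omega>} \<omega> \<le> enat t} \<in> sets stream_law" by simp
qed

lemma measurable_run:
  "(\<lambda>\<omega>. fst (run a b \<pi> n iv m \<omega>)) \<in> measurable stream_law (count_space UNIV) \<and>
    measurable_ivs stream_law (\<lambda>\<omega>. snd (run a b \<pi> n iv m \<omega>))"
proof (induction m)
  case 0
  then show ?case by (simp add: measurable_ivs_def)
next
  case (Suc m)
  let ?s = "\<lambda>\<omega>. fst (run a b \<pi> n iv m \<omega>)" and ?iv = "\<lambda>\<omega>. snd (run a b \<pi> n iv m \<omega>)"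
  let ?i = "n + Suc m"
  let ?\<tau> = "\<lambda>\<omega>. first_hit (?s \<omega>) (window a b \<pi> ?i (?iv \<omega>)) \<omega>"
  have p: "(\<lambda>\<omega>. fst (?iv \<omega> ?i)) \<in> borel_measurable stream_law"
    and q: "(\<lambda>\<omega>. snd (?iv \<omega> ?i)) \<in> borel_measurable stream_law"
    using Suc.IH by (auto simp: measurable_ivs_def)
  have e: "(\<lambda>\<omega>. fst (?iv \<omega> ?i) + (snd (?iv \<omega> ?i) - fst (?iv \<omega> ?i)) * c) \<in> borel_measurable stream_law" for c
    by (intro borel_measurable_add borel_measurable_times borel_measurable_diff p q borel_measurable_const)
  have \<tau>: "?\<tau> \<in> measurable stream_law (count_space UNIV)"
    unfolding window_def Let_def by (rule measurable_first_hit[OF conjunct1[OF Suc.IH] e e])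
  have "(\<lambda>\<omega>. X (the_enat (?\<tau> \<omega>)) \<omega>) \<in> borel_measurable stream_law"
    by (rule measurable_X_at[OF measurable_compose[OF \<tau>]]) simp
  from measurable_ivs_advance[OF this conjunct2[OF Suc.IH]] \<tau>
  show ?case by (simp add: hunt_def Let_def)
qed

lemma pot_placed_nonneg:
  "placed n iv y 0 1 t \<Longrightarrow> (\<And>\<sigma>. 0 \<le> g \<sigma>) \<Longrightarrow> 0 \<le> pot g e \<pi> n iv t"
  by (rule pot_nonneg[of _ _ _ 0 1]) auto

text \<open>The bound for the variance contributed by a subtree on an interval of length 1.\<close>

definition spread :: "nat list \<Rightarrow> real" where
  "spread \<sigma> = 2 * sqrt 2 * (val \<sigma> * sqrt (val \<sigma>))"

lemma spread_nonneg: "0 \<le> spread \<sigma>"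
  using val_nonneg by (simp add: spread_def)

lemma spread_Nil [simp]: "spread [] = 0"
  by (simp add: spread_def)

lemma curvature_in_window:
  assumes w: "l < u" and z: "a < (x - l) / (u - l)" "(x - l) / (u - l) < b"
  shows "curvature A B c a b ((x - l) / (u - l)) / (u - l)\<^sup>2 =
    A * sqrt A / (x - l)\<^sup>2 + B * sqrt B / (u - x)\<^sup>2 - c * sqrt c / (u - l)\<^sup>2"
proof -
  have 1: "1 - (x - l) / (u - l) = (u - x) / (u - l)" using w by (simp add: field_simps)
  have 2: "K / (y / (u - l))\<^sup>2 / (u - l)\<^sup>2 = K / y\<^sup>2" for K y :: real
    using w by (simp add: power_divide)
  have "curvature A B c a b ((x - l) / (u - l)) / (u - l)\<^sup>2 =
     A * sqrt A / ((x - l) / (u - l))\<^sup>2 / (u - l)\<^sup>2 + B * sqrt B / ((u - x) / (u - l))\<^sup>2 / (u - l)\<^sup>2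
       - c * sqrt c / (u - l)\<^sup>2"
    using z unfolding curvature_def 1 by (simp add: add_divide_distrib diff_divide_distrib del: times_divide_eq_left times_divide_eq_right)
  then show ?thesis unfolding 2 .
qed

lemma in_window_iff:
  fixes l u x :: real
  assumes "l < u"
  shows "l + (u - l) * a < x \<and> x < l + (u - l) * b \<longleftrightarrow> a < (x - l) / (u - l) \<and> (x - l) / (u - l) < b"
  using assms by (auto simp: field_simps)

context
  fixes a b :: "nat list \<Rightarrow> real" and \<pi> :: "nat list" and k :: nat
  assumes opt: "optimal_windows a b" and \<pi>: "\<pi> \<in> Perms k"
begin

lemma tree_facts: "set_tree (search_tree \<pi>) = {1..k}" "heap_bst \<pi> (search_tree \<pi>)"
  using search_tree_heap_bst[OF Perms_distinct[OF \<pi>]] Perms_length[OF \<pi>] by auto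

lemma window_bounds:
  assumes n: "n < k" and lu: "fst (iv (Suc n)) < snd (iv (Suc n))" and x: "x \<in> window a b \<pi> (Suc n) iv"
  shows "fst (iv (Suc n)) < x" "x < snd (iv (Suc n))"
proof -
  let ?\<sigma> = "subtree_perm \<pi> (Suc n)" and ?l = "fst (iv (Suc n))" and ?u = "snd (iv (Suc n))"
  have ab: "0 \<le> a ?\<sigma>" "b ?\<sigma> \<le> 1"
    using node_window[OF opt \<pi>, of "Suc n"] n by (auto simp: optimal_window_def)
  have "0 \<le> (?u - ?l) * a ?\<sigma>" "(?u - ?l) * b ?\<sigma> \<le> ?u - ?l"
    using ab lu mult_left_mono[of "b ?\<sigma>" 1 "?u - ?l"] by auto
  then show "?l < x" "x < ?u" using x by (auto simp: window_def Let_def)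
qed

lemma placed_accept:
  assumes n: "n < k" and pl: "placed n iv y 0 1 (search_tree \<pi>)" and x: "x \<in> window a b \<pi> (Suc n) iv"
  shows "placed (Suc n) (advance (search_tree \<pi>) (Suc n) x iv) (y(Suc n := x)) 0 1 (search_tree \<pi>)"
proof -
  have mem: "Suc n \<in> set_tree (search_tree \<pi>)" using n tree_facts by simp
  have "fst (iv (Suc n)) < snd (iv (Suc n))"
    using placed_bounds[OF tree_facts(2) mem pl] by simp
  from window_bounds[OF n this x] show ?thesis
    by (rule placed_advance[OF tree_facts(2) mem pl])
qed

lemma pot_val_step:
  assumes n: "n < k" and pl: "placed n iv y 0 1 (search_tree \<pi>)"
  shows "(if x \<in> window a b \<pi> (Suc n) iv then pot val 1 \<pi> (Suc n) (advance (search_tree \<pi>) (Suc n) x iv) (search_tree \<pi>)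
      else pot val 1 \<pi> n iv (search_tree \<pi>)) = pot val 1 \<pi> n iv (search_tree \<pi>) - gain a b \<pi> (Suc n) iv x"
proof -
  let ?\<sigma> = "subtree_perm \<pi> (Suc n)"
  obtain l u where iv: "iv (Suc n) = (l, u)" by fastforce
  have mem: "Suc n \<in> set_tree (search_tree \<pi>)" using n tree_facts by simp
  have lu: "l < u" using placed_bounds[OF tree_facts(2) mem pl] iv by simp
  have ab: "0 \<le> a ?\<sigma>" "b ?\<sigma> \<le> 1"
    using node_window[OF opt \<pi>, of "Suc n"] n by (auto simp: optimal_window_def)
  show ?thesis
    using pot_step[where e=1 and g=val and iv=iv, OF \<pi> n val_Nil iv refl, of x]
    unfolding gain_def Let_def reward_in_window[OF lu ab] window_def iv fst_conv snd_conv
    by simp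
qed

lemma pot_spread_step:
  assumes n: "n < k" and pl: "placed n iv y 0 1 (search_tree \<pi>)" and iv: "iv (Suc n) = (l, u)" and \<sigma>: "\<sigma> = subtree_perm \<pi> (Suc n)"
  shows "(if x \<in> window a b \<pi> (Suc n) iv then pot spread 2 \<pi> (Suc n) (advance (search_tree \<pi>) (Suc n) x iv) (search_tree \<pi>)
      else pot spread 2 \<pi> n iv (search_tree \<pi>)) = pot spread 2 \<pi> n iv (search_tree \<pi>) + 2 * sqrt 2 *
        curvature (val (left_perm \<sigma>)) (val (right_perm \<sigma>)) (val \<sigma>) (a \<sigma>) (b \<sigma>) ((x - l) / (u - l)) / (u - l)\<^sup>2"
proof -
  have mem: "Suc n \<in> set_tree (search_tree \<pi>)" using n tree_facts by simp
  have lu: "l < u" using placed_bounds[OF tree_facts(2) mem pl] iv by simp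
  have win: "x \<in> window a b \<pi> (Suc n) iv \<longleftrightarrow> a \<sigma> < (x - l) / (u - l) \<and> (x - l) / (u - l) < b \<sigma>"
    using in_window_iff[OF lu] by (simp add: window_def Let_def iv \<sigma>)
  show ?thesis
  proof (cases "x \<in> window a b \<pi> (Suc n) iv")
    case True
    then have z: "a \<sigma> < (x - l) / (u - l)" "(x - l) / (u - l) < b \<sigma>" using win by auto
    show ?thesis
      using pot_step[where e=2 and g=spread and iv=iv, OF \<pi> n spread_Nil iv \<sigma>, of x] True
      unfolding times_divide_eq_right[symmetric] curvature_in_window[OF lu z]
      by (simp add: spread_def algebra_simps)
  next
    case False
    then have "curvature (val (left_perm \<sigma>)) (val (right_perm \<sigma>)) (val \<sigma>) (a \<sigma>) (b \<sigma>) ((x - l) / (u - l)) = 0"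
      unfolding win curvature_def by (rule if_not_P)
    then show ?thesis using False by simp
  qed
qed

lemma truncated_run_Stream:
  "min (fst (run a b \<pi> n iv (Suc m) (x ## \<omega>))) (enat (Suc t)) = eSuc (min
     (fst (if x \<in> window a b \<pi> (Suc n) iv then run a b \<pi> (Suc n) (advance (search_tree \<pi>) (Suc n) x iv) m \<omega>
           else run a b \<pi> n iv (Suc m) \<omega>)) (enat t))"
proof -
  have mono: "min (eSuc p) (enat (Suc t)) = eSuc (min p (enat t))" for p
    by (simp add: eSuc_enat[symmetric] min_def)
  show ?thesis
  proof (cases "x \<in> window a b \<pi> (Suc n) iv")
    case True
    have "fst (run a b \<pi> n iv (Suc m) (x ## \<omega>)) = eSuc (fst (run a b \<pi> (Suc n) (advance (search_tree \<pi>) (Suc n) x iv) m \<omega>))"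
      using run_accept[OF True] unfolding delayed_def by (rule conjunct1)
    then show ?thesis using True by (simp only: mono if_True)
  next
    case False
    have "fst (run a b \<pi> n iv (Suc m) (x ## \<omega>)) = eSuc (fst (run a b \<pi> n iv (Suc m) \<omega>))"
      using run_reject[OF False] unfolding delayed_def by (rule conjunct1)
    then show ?thesis using False by (simp only: mono if_False)
  qed
qed

lemma measurable_truncated_run:
  "(\<lambda>\<omega>. ennreal_of_enat (min (fst (run a b \<pi> n iv m \<omega>)) (enat t))) \<in> borel_measurable stream_law"
  by (rule measurable_compose[OF conjunct1[OF measurable_run]]) simp

text \<open>The truncation at time \<open>t\<close> makes an induction on \<open>t\<close> possible without knowing beforehand that the
  waiting times are finite. Writing \<open>R\<close> for the remaining truncated time after the first observation
  \<open>x\<close>, and \<open>V x\<close>, \<open>W x\<close> for the potentials after it, the induction hypothesis bounds the mean of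
  \<open>1 + R\<close> by \<open>1 + V x\<close> and that of \<open>(1 + R)\<^sup>2\<close> by \<open>(1 + V x)\<^sup>2 + W x\<close>; averaging over \<open>x\<close> is the content
  of \<open>mean_step\<close> and \<open>second_moment_step\<close>.\<close>

lemma truncated_moments:
  assumes "n + m = k" and "placed n iv y 0 1 (search_tree \<pi>)"
  shows "(\<integral>\<^sup>+\<omega>. ennreal_of_enat (min (fst (run a b \<pi> n iv m \<omega>)) (enat t)) \<partial>stream_law)
      \<le> ennreal (pot val 1 \<pi> n iv (search_tree \<pi>)) \<and>
    (\<integral>\<^sup>+\<omega>. (ennreal_of_enat (min (fst (run a b \<pi> n iv m \<omega>)) (enat t)))\<^sup>2 \<partial>stream_law)
      \<le> ennreal ((pot val 1 \<pi> n iv (search_tree \<pi>))\<^sup>2 + pot spread 2 \<pi> n iv (search_tree \<pi>))"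
  using assms
proof (induction t arbitrary: n m iv y)
  case 0
  then show ?case by (simp flip: zero_enat_def)
next
  case (Suc t)
  interpret S: prob_space stream_law by (rule prob_space_stream_law)
  show ?case
  proof (cases m)
    case 0
    then show ?thesis by (simp add: zero_enat_def)
  next
    case (Suc m')
    then have n: "n < k" using Suc.prems by simp
    note pl = Suc.prems(2)
    let ?W = "window a b \<pi> (Suc n) iv" and ?iv = "\<lambda>x. advance (search_tree \<pi>) (Suc n) x iv"
    define R where "R x \<omega> = ennreal_of_enat (min (fst (if x \<in> ?W then run a b \<pi> (Suc n) (?iv x) m' \<omega>
        else run a b \<pi> n iv m \<omega>)) (enat t))" for x \<omega>
    define V where "V x = (if x \<in> ?W then pot val 1 \<pi> (Suc n) (?iv x) (search_tree \<pi>) else pot val 1 \<pi> n iv (search_tree \<pi>))" for x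
    define W where "W x = (if x \<in> ?W then pot spread 2 \<pi> (Suc n) (?iv x) (search_tree \<pi>) else pot spread 2 \<pi> n iv (search_tree \<pi>))" for x
    have peel: "ennreal_of_enat (min (fst (run a b \<pi> n iv m (x ## \<omega>))) (enat (Suc t))) = 1 + R x \<omega>" for x \<omega>
      unfolding Suc truncated_run_Stream R_def by simp
    have R_meas: "R x \<in> borel_measurable stream_law" for x
      unfolding R_def using measurable_truncated_run by (cases "x \<in> ?W") auto
    have IH: "(\<integral>\<^sup>+\<omega>. R x \<omega> \<partial>stream_law) \<le> ennreal (V x) \<and>
        (\<integral>\<^sup>+\<omega>. (R x \<omega>)\<^sup>2 \<partial>stream_law) \<le> ennreal ((V x)\<^sup>2 + W x)" for x
    proof (cases "x \<in> ?W")
      case True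
      have "Suc n + m' = k" using Suc Suc.prems by simp
      from Suc.IH[OF this placed_accept[OF n pl True]] show ?thesis
        using True by (simp add: R_def V_def W_def)
    next
      case False
      then show ?thesis using Suc.IH[OF Suc.prems] by (simp add: R_def V_def W_def)
    qed
    have V0: "0 \<le> V x" and W0: "0 \<le> W x" for x
      using pot_placed_nonneg[OF placed_accept[OF n pl]] pot_placed_nonneg[OF pl] val_nonneg spread_nonneg
      by (auto simp: V_def W_def)
    obtain l u where lu: "iv (Suc n) = (l, u)" by fastforce
    have mem: "Suc n \<in> set_tree (search_tree \<pi>)" using n tree_facts by simp
    have lu01: "0 \<le> l" "l < u" "u \<le> 1" using placed_bounds[OF tree_facts(2) mem pl] lu by simp_all
    let ?\<sigma> = "subtree_perm \<pi> (Suc n)"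
    let ?A = "val (left_perm ?\<sigma>)" and ?B = "val (right_perm ?\<sigma>)" and ?c = "val ?\<sigma>"
    have opt\<sigma>: "optimal_window ?A ?B ?c (a ?\<sigma>) (b ?\<sigma>)"
      using node_window[OF opt \<pi>, of "Suc n"] n by simp
    have V: "V x = pot val 1 \<pi> n iv (search_tree \<pi>) - reward ?A ?B ?c (a ?\<sigma>) (b ?\<sigma>) l u x" for x
      unfolding V_def pot_val_step[OF n pl] gain_def Let_def lu by simp
    have W: "W x = pot spread 2 \<pi> n iv (search_tree \<pi>) + 2 * sqrt 2 * curvature ?A ?B ?c (a ?\<sigma>) (b ?\<sigma>) ((x - l) / (u - l)) / (u - l)\<^sup>2" for x
      unfolding W_def by (rule pot_spread_step[OF n pl lu refl])
    have "(\<integral>\<^sup>+\<omega>. ennreal_of_enat (min (fst (run a b \<pi> n iv m \<omega>)) (enat (Suc t))) \<partial>stream_law)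
        = (\<integral>\<^sup>+x. \<integral>\<^sup>+\<omega>. 1 + R x \<omega> \<partial>stream_law \<partial>unif)"
      by (subst nn_integral_stream_law[OF measurable_truncated_run]) (simp only: peel)
    also have "\<dots> \<le> (\<integral>\<^sup>+x. ennreal (1 + V x) \<partial>unif)"
    proof (rule nn_integral_mono)
      fix x
      have "(\<integral>\<^sup>+\<omega>. 1 + R x \<omega> \<partial>stream_law) = 1 + (\<integral>\<^sup>+\<omega>. R x \<omega> \<partial>stream_law)"
        using S.emeasure_space_1 by (subst nn_integral_add) (auto simp: R_meas)
      also have "\<dots> \<le> 1 + ennreal (V x)" using IH[of x] by (intro add_left_mono) auto
      also have "\<dots> = ennreal (1 + V x)" using V0[of x] by (simp add: ennreal_plus)
      finally show "(\<integral>\<^sup>+\<omega>. 1 + R x \<omega> \<partial>stream_law) \<le> ennreal (1 + V x)" .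
    qed
    also have "\<dots> = ennreal (pot val 1 \<pi> n iv (search_tree \<pi>))"
      unfolding V by (rule mean_step[OF opt\<sigma> lu01]) (rule V0[unfolded V])
    finally have first: "(\<integral>\<^sup>+\<omega>. ennreal_of_enat (min (fst (run a b \<pi> n iv m \<omega>)) (enat (Suc t))) \<partial>stream_law)
       \<le> ennreal (pot val 1 \<pi> n iv (search_tree \<pi>))" .
    have meas2: "(\<lambda>\<omega>. (ennreal_of_enat (min (fst (run a b \<pi> n iv m \<omega>)) (enat (Suc t))))\<^sup>2) \<in> borel_measurable stream_law"
      using measurable_truncated_run by (rule borel_measurable_power_ennreal)
    have "(\<integral>\<^sup>+\<omega>. (ennreal_of_enat (min (fst (run a b \<pi> n iv m \<omega>)) (enat (Suc t))))\<^sup>2 \<partial>stream_law)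
        = (\<integral>\<^sup>+x. \<integral>\<^sup>+\<omega>. (1 + R x \<omega>)\<^sup>2 \<partial>stream_law \<partial>unif)"
      by (subst nn_integral_stream_law[OF meas2]) (simp only: peel)
    also have "\<dots> \<le> (\<integral>\<^sup>+x. ennreal ((1 + V x)\<^sup>2 + W x) \<partial>unif)"
    proof (rule nn_integral_mono)
      fix x
      have "(\<integral>\<^sup>+\<omega>. (1 + R x \<omega>)\<^sup>2 \<partial>stream_law) = (\<integral>\<^sup>+\<omega>. 1 + (2 * R x \<omega> + (R x \<omega>)\<^sup>2) \<partial>stream_law)"
        by (intro nn_integral_cong) (simp add: power2_eq_square algebra_simps mult_2)
      also have "\<dots> = 1 + (2 * (\<integral>\<^sup>+\<omega>. R x \<omega> \<partial>stream_law) + (\<integral>\<^sup>+\<omega>. (R x \<omega>)\<^sup>2 \<partial>stream_law))"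
      proof -
        note [measurable] = R_meas[of x]
        have sq: "(\<lambda>\<omega>. (R x \<omega>)\<^sup>2) \<in> borel_measurable stream_law"
          by (rule borel_measurable_power_ennreal[OF R_meas])
        show ?thesis
          using S.emeasure_space_1 sq by (simp add: nn_integral_add nn_integral_cmult)
      qed
      also have "\<dots> \<le> 1 + (2 * ennreal (V x) + ennreal ((V x)\<^sup>2 + W x))"
        using IH[of x] by (intro add_left_mono add_mono mult_left_mono) auto
      also have "\<dots> = ennreal ((1 + V x)\<^sup>2 + W x)"
      proof -
        have "2 * ennreal (V x) = ennreal (2 * V x)" using V0[of x] by (simp add: ennreal_mult)
        then show ?thesis
          using V0[of x] W0[of x]
          by (simp add: ennreal_plus[symmetric] power2_eq_square algebra_simps del: ennreal_plus flip: ennreal_1)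
      qed
      finally show "(\<integral>\<^sup>+\<omega>. (1 + R x \<omega>)\<^sup>2 \<partial>stream_law) \<le> ennreal ((1 + V x)\<^sup>2 + W x)" .
    qed
    also have "\<dots> \<le> ennreal ((pot val 1 \<pi> n iv (search_tree \<pi>))\<^sup>2 + pot spread 2 \<pi> n iv (search_tree \<pi>))"
      unfolding V W by (rule second_moment_step[OF opt\<sigma> lu01]) (rule W0[unfolded W])
    finally show ?thesis using first by blast
  qed
qed

lemma run_moments:
  shows "(\<integral>\<^sup>+\<omega>. ennreal_of_enat (fst (run a b \<pi> 0 (\<lambda>_. (0, 1)) k \<omega>)) \<partial>stream_law) \<le> ennreal (val \<pi>)"
    and "(\<integral>\<^sup>+\<omega>. (ennreal_of_enat (fst (run a b \<pi> 0 (\<lambda>_. (0, 1)) k \<omega>)))\<^sup>2 \<partial>stream_law)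
      \<le> ennreal ((val \<pi>)\<^sup>2 + spread \<pi>)"
proof -
  let ?Z = "\<lambda>\<omega>. fst (run a b \<pi> 0 (\<lambda>_. (0, 1)) k \<omega>)"
  let ?M = "\<lambda>t \<omega>. ennreal_of_enat (min (?Z \<omega>) (enat t))"
  have bound: "(\<integral>\<^sup>+\<omega>. ?M t \<omega> \<partial>stream_law) \<le> ennreal (val \<pi>)"
    "(\<integral>\<^sup>+\<omega>. (?M t \<omega>)\<^sup>2 \<partial>stream_law) \<le> ennreal ((val \<pi>)\<^sup>2 + spread \<pi>)" for t
    using truncated_moments[of 0 k "\<lambda>_. (0, 1)" undefined t, OF _ placed_start[OF \<pi>]]
      pot_start[OF \<pi>, of val 1] pot_start[OF \<pi>, of spread 2] by simp_all
  have inc: "incseq ?M"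
    by (intro incseq_SucI le_funI) (simp only: ennreal_of_enat_le_iff, intro min.mono, simp_all)
  have inc2: "incseq (\<lambda>t \<omega>. (?M t \<omega>)\<^sup>2)"
    by (intro incseq_SucI le_funI power_mono) (use incseq_SucD[OF inc] in \<open>auto simp: le_fun_def\<close>)
  have sup: "f (ennreal_of_enat z) \<le> (SUP t. f (ennreal_of_enat (min z (enat t))))" if fin: "z < \<infinity>" for z and f :: "ennreal \<Rightarrow> ennreal"
  proof -
    from fin obtain r where "z = enat r" by (cases z) auto
    then show ?thesis by (intro SUP_upper2[of r]) auto
  qed
  show first: "(\<integral>\<^sup>+\<omega>. ennreal_of_enat (?Z \<omega>) \<partial>stream_law) \<le> ennreal (val \<pi>)"
  proof -
    have "ennreal_of_enat z \<le> (SUP t. ennreal_of_enat (min z (enat t)))" for z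
    proof (cases z)
      case infinity
      then show ?thesis by (simp add: ennreal_SUP_of_nat_eq_top)
    qed (use sup[of z "\<lambda>x. x"] in simp)
    then have "(\<integral>\<^sup>+\<omega>. ennreal_of_enat (?Z \<omega>) \<partial>stream_law) \<le> (\<integral>\<^sup>+\<omega>. (SUP t. ?M t \<omega>) \<partial>stream_law)"
      by (intro nn_integral_mono)
    also have "\<dots> = (SUP t. \<integral>\<^sup>+\<omega>. ?M t \<omega> \<partial>stream_law)"
      by (rule nn_integral_monotone_convergence_SUP[OF inc measurable_truncated_run])
    also have "\<dots> \<le> ennreal (val \<pi>)" by (intro SUP_least bound)
    finally show ?thesis .
  qed
  have "(\<lambda>\<omega>. ennreal_of_enat (?Z \<omega>)) \<in> borel_measurable stream_law"
    by (rule measurable_compose[OF conjunct1[OF measurable_run]]) simp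
  then have "AE \<omega> in stream_law. ennreal_of_enat (?Z \<omega>) \<noteq> \<infinity>"
    using first by (intro nn_integral_PInf_AE) (auto simp: top_unique)
  then have "AE \<omega> in stream_law. (ennreal_of_enat (?Z \<omega>))\<^sup>2 \<le> (SUP t. (?M t \<omega>)\<^sup>2)"
  proof eventually_elim
    case (elim \<omega>)
    then have "?Z \<omega> < \<infinity>" by (cases "?Z \<omega>") auto
    then show ?case by (rule sup)
  qed
  then have "(\<integral>\<^sup>+\<omega>. (ennreal_of_enat (?Z \<omega>))\<^sup>2 \<partial>stream_law) \<le> (\<integral>\<^sup>+\<omega>. (SUP t. (?M t \<omega>)\<^sup>2) \<partial>stream_law)"
    by (rule nn_integral_mono_AE)
  also have "\<dots> = (SUP t. \<integral>\<^sup>+\<omega>. (?M t \<omega>)\<^sup>2 \<partial>stream_law)"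
    by (rule nn_integral_monotone_convergence_SUP[OF inc2 borel_measurable_power_ennreal[OF measurable_truncated_run]])
  also have "\<dots> \<le> ennreal ((val \<pi>)\<^sup>2 + spread \<pi>)" by (intro SUP_least bound)
  finally show "(\<integral>\<^sup>+\<omega>. (ennreal_of_enat (?Z \<omega>))\<^sup>2 \<partial>stream_law) \<le> ennreal ((val \<pi>)\<^sup>2 + spread \<pi>)" .
qed

end

lemma run_mono: "m \<le> m' \<Longrightarrow> fst (run a b \<pi> n iv m \<omega>) \<le> fst (run a b \<pi> n iv m' \<omega>)"
proof (induction m' rule: dec_induct)
  case (step m')
  then show ?case by (auto simp: hunt_def Let_def intro: order_trans first_hit_ge)
qed simp

text \<open>A stage that ends by time \<open>N\<close> has only looked at the first \<open>N\<close> observations.\<close>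

lemma run_agree:
  assumes agree: "\<And>s. s < N \<Longrightarrow> \<omega> !! s = \<omega>' !! s"
    and "fst (run a b \<pi> n iv m \<omega>) \<le> enat N"
  shows "run a b \<pi> n iv m \<omega>' = run a b \<pi> n iv m \<omega>"
  using assms(2)
proof (induction m)
  case (Suc m)
  let ?p = "run a b \<pi> n iv m \<omega>"
  let ?W = "window a b \<pi> (n + Suc m) (snd ?p)"
  have hit: "first_hit (fst ?p) ?W \<omega> \<le> enat N" using Suc.prems by (simp add: hunt_def Let_def)
  have p: "run a b \<pi> n iv m \<omega>' = ?p"
    by (rule Suc.IH) (rule order_trans[OF first_hit_ge hit])
  from hit obtain r where r: "first_hit (fst ?p) ?W \<omega> = enat r" "r \<le> N"
    by (cases "first_hit (fst ?p) ?W \<omega>") auto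
  have Xeq: "X q \<omega>' = X q \<omega>" if "1 \<le> q" "q \<le> N" for q
    using agree[of "q - 1"] that by (simp add: X_def)
  have le: "first_hit (fst ?p) ?W \<omega>' \<le> enat t \<longleftrightarrow> first_hit (fst ?p) ?W \<omega> \<le> enat t" if "t \<le> N" for t
  proof -
    have "X q \<omega>' \<in> ?W \<longleftrightarrow> X q \<omega> \<in> ?W" if "q \<le> t" "fst ?p < enat q" for q
    proof -
      have "1 \<le> q" using that(2) by (cases q) (simp_all flip: zero_enat_def)
      then show ?thesis using Xeq[of q] that(1) \<open>t \<le> N\<close> by simp
    qed
    then show ?thesis unfolding first_hit_le_iff by blast
  qed
  have "first_hit (fst ?p) ?W \<omega>' \<le> enat r" using le[OF r(2)] r(1) by simp
  then obtain r' where r': "first_hit (fst ?p) ?W \<omega>' = enat r'" "r' \<le> r"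
    by (cases "first_hit (fst ?p) ?W \<omega>'") auto
  have "enat r \<le> enat r'" using le[of r'] r r' by simp
  then have hit': "first_hit (fst ?p) ?W \<omega>' = enat r" using r' by simp
  have "X r \<omega>' = X r \<omega>" by (rule Xeq[OF first_hit_pos[OF r(1)] r(2)])
  then show ?case unfolding run.simps p hunt_def Let_def r(1) hit' by simp
qed simp

lemma canonical_run: "canonical a b \<pi> i \<omega> = fst (run a b \<pi> 0 (\<lambda>_. (0, 1)) i \<omega>)"
  by (simp add: canonical_def canonical_state_run)

lemma canonical_stopping_time: "stopping_time nat_filtration (canonical a b \<pi> i)"
proof (rule stopping_timeI)
  fix t
  show "Measurable.pred (nat_filtration t) (\<lambda>\<omega>. canonical a b \<pi> i \<omega> \<le> t)"
  proof (cases t)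
    case (enat N)
    have "{\<omega>. fst (run a b \<pi> 0 (\<lambda>_. (0, 1)) i \<omega>) \<le> enat N} \<in> sets (nat_filtration (enat N))"
    proof (rule nat_filtrationI)
      show "{\<omega>. fst (run a b \<pi> 0 (\<lambda>_. (0, 1)) i \<omega>) \<le> enat N} \<in> sets stream_law"
        using measurable_sets[OF conjunct1[OF measurable_run], of "{..enat N}"] by (simp add: vimage_def)
      fix \<omega> \<omega>' :: "real stream" assume eq: "\<And>s. s < N \<Longrightarrow> \<omega> !! s = \<omega>' !! s"
      show "\<omega> \<in> {\<omega>. fst (run a b \<pi> 0 (\<lambda>_. (0, 1)) i \<omega>) \<le> enat N} \<longleftrightarrow>
          \<omega>' \<in> {\<omega>. fst (run a b \<pi> 0 (\<lambda>_. (0, 1)) i \<omega>) \<le> enat N}"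
        using run_agree[of N \<omega> \<omega>' a b \<pi> 0 "\<lambda>_. (0, 1)" i, OF eq]
          run_agree[of N \<omega>' \<omega> a b \<pi> 0 "\<lambda>_. (0, 1)" i, OF eq[symmetric]] by auto
    qed
    then show ?thesis by (simp add: enat pred_def canonical_run)
  qed simp
qed

text \<open>By the moment bound the last time is almost surely finite, and so are all earlier ones; on this event
  every accepted value lies in its window, hence in its interval, and the order of the values follows
  from \<open>placed_done\<close>.\<close>

lemma canonical_OA:
  assumes opt: "optimal_windows a b" and \<pi>: "\<pi> \<in> Perms k" and k: "1 \<le> k"
  shows "canonical a b \<pi> \<in> OA \<pi>"
proof -
  let ?run = "\<lambda>m \<omega>. run a b \<pi> 0 (\<lambda>_. (0, 1)) m \<omega>" and ?\<tau> = "canonical a b \<pi>" and ?T = "search_tree \<pi>"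
  note T = search_tree_heap_bst[OF Perms_distinct[OF \<pi>]]
  have S: "set_tree ?T = {1..k}" using T(1) Perms_length[OF \<pi>] by simp
  have good: "(\<forall>i\<in>{1..k}. 1 \<le> ?\<tau> i \<omega> \<and> ?\<tau> i \<omega> < \<infinity>) \<and>
      (\<forall>i\<in>{1..k}. \<forall>j\<in>{1..k}. i < j \<longrightarrow> ?\<tau> i \<omega> < ?\<tau> j \<omega>) \<and>
      (\<forall>i\<in>{1..k}. \<forall>j\<in>{1..k}. entry \<pi> i < entry \<pi> j \<longleftrightarrow>
         X (the_enat (?\<tau> i \<omega>)) \<omega> < X (the_enat (?\<tau> j \<omega>)) \<omega>)"
    if "?\<tau> k \<omega> < \<infinity>" for \<omega>
  proof -
    define y where "y i = X (the_enat (?\<tau> i \<omega>)) \<omega>" for i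
    have fin: "?\<tau> i \<omega> < \<infinity>" if "i \<le> k" for i
      using run_mono[OF that, of a b \<pi> 0 "\<lambda>_. (0, 1)" \<omega>] \<open>?\<tau> k \<omega> < \<infinity>\<close>
      unfolding canonical_run by (rule le_less_trans)
    have step: "?\<tau> (Suc n) \<omega> = first_hit (?\<tau> n \<omega>) (window a b \<pi> (Suc n) (snd (?run n \<omega>))) \<omega>"
      "snd (?run (Suc n) \<omega>) = advance ?T (Suc n) (y (Suc n)) (snd (?run n \<omega>))" for n
      unfolding y_def canonical_run by (simp_all add: hunt_def Let_def)
    have inc: "?\<tau> n \<omega> < ?\<tau> (Suc n) \<omega>" if "n < k" for n
      unfolding step(1) using fin[of n] that by (intro first_hit_gt) simp
    have strict: "i < j \<Longrightarrow> j \<le> k \<Longrightarrow> ?\<tau> i \<omega> < ?\<tau> j \<omega>" for i j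
    proof (induction j)
      case (Suc j)
      then show ?case using inc[of j] by (cases "i = j") (auto intro: less_trans)
    qed simp
    have win: "y (Suc n) \<in> window a b \<pi> (Suc n) (snd (?run n \<omega>))" if n: "n < k" for n
    proof -
      obtain r where r: "?\<tau> (Suc n) \<omega> = enat r" using fin[of "Suc n"] n by (cases "?\<tau> (Suc n) \<omega>") auto
      then show ?thesis using first_hit_enatD(2) unfolding y_def r step(1) by simp
    qed
    have pl: "n \<le> k \<Longrightarrow> placed n (snd (?run n \<omega>)) y 0 1 ?T" for n
    proof (induction n)
      case 0
      then show ?case using placed_start[OF \<pi>] by simp
    next
      case (Suc n)
      then have n: "n < k" and p: "placed n (snd (?run n \<omega>)) y 0 1 ?T" by auto
      show ?case using placed_accept[OF opt \<pi> n p win[OF n]] unfolding step(2) by simp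
    qed
    have ord: "y i < y j" if "i \<in> {1..k}" "j \<in> {1..k}" "entry \<pi> i < entry \<pi> j" for i j
      using placed_done[OF T(2) _ pl[OF order_refl]] that S by auto
    have "entry \<pi> i < entry \<pi> j \<longleftrightarrow> y i < y j" if ij: "i \<in> {1..k}" "j \<in> {1..k}" for i j
    proof
      assume y: "y i < y j"
      show "entry \<pi> i < entry \<pi> j"
      proof (rule ccontr)
        assume "\<not> entry \<pi> i < entry \<pi> j"
        then consider "entry \<pi> j < entry \<pi> i" | "entry \<pi> i = entry \<pi> j" by linarith
        then show False
        proof cases
          case 1
          then show False using ord[OF ij(2,1)] y by simp
        next
          case 2
          then have "i = j"
            using ij Perms_distinct[OF \<pi>] Perms_length[OF \<pi>]
            by (auto simp: entry_def nth_eq_iff_index_eq)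
          then show False using y by simp
        qed
      qed
    qed (rule ord[OF ij])
    moreover have "1 \<le> ?\<tau> i \<omega>" if "i \<in> {1..k}" for i
    proof -
      have "?\<tau> 0 \<omega> < ?\<tau> i \<omega>" using strict[of 0 i] that by simp
      then have "0 < ?\<tau> i \<omega>" by (simp add: canonical_run)
      then show ?thesis by (cases "?\<tau> i \<omega>") (auto simp: zero_enat_def one_enat_def)
    qed
    ultimately show ?thesis using fin strict unfolding y_def by auto
  qed
  have "(\<lambda>\<omega>. ennreal_of_enat (?\<tau> k \<omega>)) \<in> borel_measurable stream_law"
    unfolding canonical_run by (rule measurable_compose[OF conjunct1[OF measurable_run]]) simp
  then have "AE \<omega> in stream_law. ennreal_of_enat (?\<tau> k \<omega>) \<noteq> \<infinity>"
    using run_moments(1)[OF opt \<pi>] unfolding canonical_run[symmetric]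
    by (intro nn_integral_PInf_AE) (auto simp: top_unique)
  then have "AE \<omega> in stream_law. ?\<tau> k \<omega> < \<infinity>"
  proof eventually_elim
    case (elim \<omega>)
    then show ?case by (cases "?\<tau> k \<omega>") auto
  qed
  then have AE: "AE \<omega> in stream_law. (\<forall>i\<in>{1..k}. 1 \<le> ?\<tau> i \<omega> \<and> ?\<tau> i \<omega> < \<infinity>) \<and>
      (\<forall>i\<in>{1..k}. \<forall>j\<in>{1..k}. i < j \<longrightarrow> ?\<tau> i \<omega> < ?\<tau> j \<omega>) \<and>
      (\<forall>i\<in>{1..k}. \<forall>j\<in>{1..k}. entry \<pi> i < entry \<pi> j \<longleftrightarrow>
         X (the_enat (?\<tau> i \<omega>)) \<omega> < X (the_enat (?\<tau> j \<omega>)) \<omega>)"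
    by eventually_elim (rule good)
  show ?thesis
    unfolding OA_def Perms_length[OF \<pi>] using canonical_stopping_time AE by blast
qed

section \<open>Identification of the optimal expected time\<close>

lemma objective_window_cost: "objective \<pi> a b = window_cost (beta (left_perm \<pi>)) (beta (right_perm \<pi>)) a b"
  by (simp add: objective_def window_cost_def)

lemma expected_time_canonical_le:
  assumes "optimal_windows a b" and \<pi>: "\<pi> \<in> Perms k"
  shows "expected_time \<pi> (canonical a b \<pi>) \<le> ennreal (val \<pi>)"
  using run_moments(1)[OF assms]
  unfolding expected_time_def final_time_def Perms_length[OF \<pi>] canonical_run .

text \<open>The lower bound holds for all algorithms and the canonical one attains it.\<close>

lemma beta_eq_val:
  assumes \<pi>: "\<pi> \<in> Perms k"
  shows "beta \<pi> = val \<pi>"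
proof (cases "\<pi> = []")
  case False
  then have k: "1 \<le> k" using Perms_length[OF \<pi>] by (cases k) auto
  obtain a b where opt: "optimal_windows a b" using optimal_windows_exist by blast
  have "(INF \<tau>\<in>OA \<pi>. expected_time \<pi> \<tau>) = ennreal (val \<pi>)"
  proof (rule antisym)
    show "(INF \<tau>\<in>OA \<pi>. expected_time \<pi> \<tau>) \<le> ennreal (val \<pi>)"
      using INF_lower[OF canonical_OA[OF opt \<pi> k], of "expected_time \<pi>"]
        expected_time_canonical_le[OF opt \<pi>] by (rule order_trans)
    show "ennreal (val \<pi>) \<le> (INF \<tau>\<in>OA \<pi>. expected_time \<pi> \<tau>)"
      by (rule INF_greatest) (rule val_le_expected_time[OF opt \<pi> k])
  qed
  then show ?thesis using False val_nonneg[of \<pi>] by (simp add: beta_def)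
qed (simp add: beta_def)

lemma child_perm_Perms:
  assumes "\<pi> \<in> Perms k"
  shows "\<exists>m. left_perm \<pi> \<in> Perms m" and "\<exists>m. right_perm \<pi> \<in> Perms m"
  unfolding left_perm_def right_perm_def
  using standardize_Perms[OF distinct_filter[OF Perms_distinct[OF assms]]] by blast+

text \<open>The minimizer is unique, so every admissible choice of minimizers leads to the same canonical
  algorithm, the one analysed above.\<close>

lemma is_minimizer_iff:
  assumes \<sigma>: "\<sigma> \<in> Perms k" and opt: "optimal_window (val (left_perm \<sigma>)) (val (right_perm \<sigma>)) c a b"
  shows "is_minimizer \<sigma> a' b' \<longleftrightarrow> a' = a \<and> b' = b"
proof -
  have obj: "objective \<sigma> p q = window_cost (val (left_perm \<sigma>)) (val (right_perm \<sigma>)) p q" for p q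
    using child_perm_Perms[OF \<sigma>] beta_eq_val unfolding objective_window_cost by metis
  have ab: "0 \<le> a" "a < b" "b \<le> 1" using opt by (auto simp: optimal_window_def)
  show ?thesis
  proof
    assume m: "is_minimizer \<sigma> a' b'"
    then have "0 \<le> a'" "a' < b'" "b' \<le> 1" "objective \<sigma> a' b' \<le> objective \<sigma> a b"
      using ab by (auto simp: is_minimizer_def)
    then show "a' = a \<and> b' = b"
      using window_cost_minimal(3)[OF opt] unfolding obj window_cost_minimal(1)[OF opt] by blast
  next
    assume "a' = a \<and> b' = b"
    then show "is_minimizer \<sigma> a' b'"
      using ab window_cost_minimal(2)[OF opt] unfolding is_minimizer_def obj
      by (auto simp: window_cost_minimal(1)[OF opt])
  qed
qed

lemma minimizer_choice_iff: "minimizer_choice a b \<longleftrightarrow> optimal_windows a b"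
proof
  assume m: "minimizer_choice a b"
  show "optimal_windows a b"
    unfolding optimal_windows_def
  proof (intro allI ballI impI)
    fix k :: nat and \<sigma> assume k: "1 \<le> k" and \<sigma>: "\<sigma> \<in> Perms k"
    have "\<sigma> \<noteq> []" using Perms_length[OF \<sigma>] k by auto
    then obtain a0 b0 where opt: "optimal_window (val (left_perm \<sigma>)) (val (right_perm \<sigma>)) (val \<sigma>) a0 b0"
      using val_window by blast
    have "is_minimizer \<sigma> (a \<sigma>) (b \<sigma>)" using m k \<sigma> unfolding minimizer_choice_def by blast
    then show "optimal_window (val (left_perm \<sigma>)) (val (right_perm \<sigma>)) (val \<sigma>) (a \<sigma>) (b \<sigma>)"
      using opt is_minimizer_iff[OF \<sigma> opt] by simp
  qed
next
  assume "optimal_windows a b"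
  then show "minimizer_choice a b"
    unfolding minimizer_choice_def optimal_windows_def using is_minimizer_iff by blast
qed

text \<open>Chebyshev's inequality for the real-valued version \<open>Z\<close> of the final time; its variance is at most
  \<open>spread \<pi> = 2 \<surd>2 (val \<pi>)\<^bsup>3/2\<^esup>\<close>, and the deviation has square \<open>y\<^sup>2 (val \<pi>)\<^bsup>3/2\<^esup>\<close>.\<close>

lemma canonical_concentration:
  assumes opt: "optimal_windows a b" and \<pi>: "\<pi> \<in> Perms k" and k: "1 \<le> k" and y: "1 \<le> y"
  shows "measure stream_law {\<omega> \<in> space stream_law.
      \<bar>ereal_of_enat (final_time \<pi> (canonical a b \<pi>) \<omega>) - ereal (val \<pi>)\<bar> > ereal (y * val \<pi> powr (3/4))}
    \<le> 2 * sqrt 2 * y powr (-2)"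
proof -
  interpret prob_space stream_law by (rule prob_space_stream_law)
  define v where "v = val \<pi>"
  have "\<pi> \<noteq> []" using Perms_length[OF \<pi>] k by (cases \<pi>) auto
  then have v: "0 < v" unfolding v_def by (rule val_pos)
  define T where "T \<omega> = fst (run a b \<pi> 0 (\<lambda>_. (0, 1)) k \<omega>)" for \<omega>
  have T: "final_time \<pi> (canonical a b \<pi>) \<omega> = T \<omega>" for \<omega>
    by (simp add: final_time_def Perms_length[OF \<pi>] canonical_run T_def)
  have T_meas: "T \<in> measurable stream_law (count_space UNIV)"
    unfolding T_def by (rule conjunct1[OF measurable_run])
  have ET: "(\<integral>\<^sup>+\<omega>. ennreal_of_enat (T \<omega>) \<partial>stream_law) = ennreal v"
    using val_le_expected_time[OF opt \<pi> k canonical_OA[OF opt \<pi> k]] expected_time_canonical_le[OF opt \<pi>]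
    unfolding expected_time_def T v_def by (rule antisym[rotated])
  have ET2: "(\<integral>\<^sup>+\<omega>. (ennreal_of_enat (T \<omega>))\<^sup>2 \<partial>stream_law) \<le> ennreal (v\<^sup>2 + spread \<pi>)"
    using run_moments(2)[OF opt \<pi>] unfolding T_def v_def .
  have "AE \<omega> in stream_law. ennreal_of_enat (T \<omega>) \<noteq> \<infinity>"
    by (rule nn_integral_PInf_AE[OF measurable_compose[OF T_meas]]) (simp_all add: ET)
  then have finite: "AE \<omega> in stream_law. T \<omega> = enat (the_enat (T \<omega>))"
  proof eventually_elim
    case (elim \<omega>)
    then show ?case by (cases "T \<omega>") auto
  qed
  define Z where "Z \<omega> = real (the_enat (T \<omega>))" for \<omega>
  have Z_meas [measurable]: "Z \<in> borel_measurable stream_law"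
    unfolding Z_def by (rule measurable_compose[OF T_meas]) simp
  have Z_eq: "AE \<omega> in stream_law. ennreal (Z \<omega>) = ennreal_of_enat (T \<omega>)"
    using finite
  proof eventually_elim
    case (elim \<omega>)
    have "ennreal_of_enat (T \<omega>) = of_nat (the_enat (T \<omega>))" by (subst elim) simp
    then show ?case by (simp add: Z_def ennreal_of_nat_eq_real_of_nat)
  qed
  have "(\<integral>\<^sup>+\<omega>. ennreal (Z \<omega>) \<partial>stream_law) = ennreal v"
    using ET nn_integral_cong_AE[OF Z_eq] by simp
  then have EZ: "integrable stream_law Z" "expectation Z = v"
    using nn_integral_eq_integrable[of Z stream_law v] v by (auto simp: Z_def)
  have Z2: "(\<integral>\<^sup>+\<omega>. ennreal ((Z \<omega>)\<^sup>2) \<partial>stream_law) \<le> ennreal (v\<^sup>2 + spread \<pi>)"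
  proof -
    have "AE \<omega> in stream_law. ennreal ((Z \<omega>)\<^sup>2) = (ennreal_of_enat (T \<omega>))\<^sup>2"
      using Z_eq by eventually_elim (simp add: Z_def flip: ennreal_power)
    from nn_integral_cong_AE[OF this] ET2 show ?thesis by simp
  qed
  have iZ2: "integrable stream_law (\<lambda>\<omega>. (Z \<omega>)\<^sup>2)"
    by (rule integrableI_bounded) (use Z2 in \<open>auto intro: le_less_trans[OF _ ennreal_less_top]\<close>)
  have "ennreal (expectation (\<lambda>\<omega>. (Z \<omega>)\<^sup>2)) \<le> ennreal (v\<^sup>2 + spread \<pi>)"
    using Z2 nn_integral_eq_integral[OF iZ2] by simp
  then have "expectation (\<lambda>\<omega>. (Z \<omega>)\<^sup>2) \<le> v\<^sup>2 + spread \<pi>"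
    using spread_nonneg by (subst (asm) ennreal_le_iff) auto
  then have var: "variance Z \<le> spread \<pi>"
    using variance_eq[OF EZ(1) iZ2] EZ(2) by simp
  define r where "r = y * v powr (3/4)"
  have r: "0 < r" using y v by (simp add: r_def)
  have "v powr (3/4) * v powr (3/4) = v * sqrt v"
  proof -
    have "v powr (3/4) * v powr (3/4) = v powr (1 + 1/2)" by (simp flip: powr_add)
    also have "\<dots> = v * sqrt v" using v by (simp only: powr_add powr_half_sqrt powr_one less_imp_le)
    finally show ?thesis .
  qed
  then have r2: "r\<^sup>2 = y\<^sup>2 * (v * sqrt v)"
    by (simp add: r_def power2_eq_square algebra_simps)
  have "measure stream_law {\<omega> \<in> space stream_law.
      \<bar>ereal_of_enat (final_time \<pi> (canonical a b \<pi>) \<omega>) - ereal v\<bar> > ereal r}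
    \<le> measure stream_law {\<omega> \<in> space stream_law. r \<le> \<bar>Z \<omega> - expectation Z\<bar>}"
  proof (rule finite_measure_mono_AE)
    show "AE \<omega> in stream_law. \<omega> \<in> {\<omega> \<in> space stream_law.
        \<bar>ereal_of_enat (final_time \<pi> (canonical a b \<pi>) \<omega>) - ereal v\<bar> > ereal r} \<longrightarrow>
        \<omega> \<in> {\<omega> \<in> space stream_law. r \<le> \<bar>Z \<omega> - expectation Z\<bar>}"
      using finite
    proof eventually_elim
      case (elim \<omega>)
      have "ereal_of_enat (T \<omega>) = ereal (Z \<omega>)" unfolding Z_def by (subst elim) simp
      then show ?case by (simp add: T EZ(2))
    qed
    show "{\<omega> \<in> space stream_law. r \<le> \<bar>Z \<omega> - expectation Z\<bar>} \<in> sets stream_law" by measurable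
  qed
  also have "\<dots> \<le> variance Z / r\<^sup>2"
    by (rule Chebyshev_inequality[OF Z_meas iZ2 r])
  also have "\<dots> \<le> spread \<pi> / r\<^sup>2"
    using var by (simp add: divide_right_mono)
  also have "\<dots> = 2 * sqrt 2 * y powr (-2)"
    using v y by (simp add: spread_def v_def[symmetric] r2 powr_minus_divide powr_numeral field_simps)
  finally show ?thesis unfolding r_def v_def .
qed

theorem theorem1p3:
  shows "(\<exists>a b. minimizer_choice a b) \<and>
    (\<exists>C::real. C > 0 \<and>
      (\<forall>k\<ge>1. \<forall>\<pi>\<in>Perms k.
        (\<forall>a b. minimizer_choice a b \<longrightarrow>
          canonical a b \<pi> \<in> OA \<pi> \<and>
          expected_time \<pi> (canonical a b \<pi>) = ennreal (beta \<pi>) \<and>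
          (\<forall>y\<ge>1.
            measure stream_law {\<omega> \<in> space stream_law.
              \<bar>ereal_of_enat (final_time \<pi> (canonical a b \<pi>) \<omega>) - ereal (beta \<pi>)\<bar>
                > ereal (y * beta \<pi> powr (3/4))}
            \<le> C * y powr (-2))) \<and>
        (\<forall>\<tau>\<in>OA \<pi>. \<forall>\<delta>\<in>{0<..<1}.
          measure stream_law {\<omega> \<in> space stream_law.
            ereal_of_enat (final_time \<pi> \<tau> \<omega>) \<le> ereal ((1 - \<delta>) * beta \<pi>)}
          \<le> 1 - \<delta>)))"
proof (intro conjI exI[of _ "2 * sqrt 2"] allI impI ballI)
  show "\<exists>a b. minimizer_choice a b"
    using optimal_windows_exist unfolding minimizer_choice_iff .
next
  show "0 < 2 * sqrt (2::real)" by simp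
next
  fix k :: nat and \<pi> a b
  assume k: "1 \<le> k" and \<pi>: "\<pi> \<in> Perms k" and "minimizer_choice a b"
  then have opt: "optimal_windows a b" by (simp add: minimizer_choice_iff)
  show OA: "canonical a b \<pi> \<in> OA \<pi>" by (rule canonical_OA[OF opt \<pi> k])
  show "expected_time \<pi> (canonical a b \<pi>) = ennreal (beta \<pi>)"
    unfolding beta_eq_val[OF \<pi>]
    by (rule antisym[OF expected_time_canonical_le[OF opt \<pi>] val_le_expected_time[OF opt \<pi> k OA]])
  fix y :: real assume "1 \<le> y"
  then show "measure stream_law {\<omega> \<in> space stream_law.
      \<bar>ereal_of_enat (final_time \<pi> (canonical a b \<pi>) \<omega>) - ereal (beta \<pi>)\<bar> > ereal (y * beta \<pi> powr (3/4))}
    \<le> 2 * sqrt 2 * y powr (-2)"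
    unfolding beta_eq_val[OF \<pi>] by (rule canonical_concentration[OF opt \<pi> k])
next
  fix k :: nat and \<pi> \<tau> and \<delta> :: real
  assume k: "1 \<le> k" and \<pi>: "\<pi> \<in> Perms k" and \<tau>: "\<tau> \<in> OA \<pi>" and \<delta>: "\<delta> \<in> {0<..<1}"
  obtain a b where opt: "optimal_windows a b" using optimal_windows_exist by blast
  show "measure stream_law {\<omega> \<in> space stream_law.
      ereal_of_enat (final_time \<pi> \<tau> \<omega>) \<le> ereal ((1 - \<delta>) * beta \<pi>)} \<le> 1 - \<delta>"
    unfolding beta_eq_val[OF \<pi>] by (rule early_completion_bound[OF opt \<pi> k \<tau> \<delta>])
qed

end
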